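(* Let $k\ge1$ be an integer and let $\beta_k=\pi\sqrt{\frac{k}{6n}}$. Then, as $n\to\infty$, uniformly for integers $m$ with $1\le|m|\le\sqrt{\frac{n}{6k}}\,\frac{\log n}{\pi}$, $$\frac{a_{m,k}(n)}{p_k(n)}=P(m,\beta_k)\left(1+O\!\left(\beta_k^{\frac12}|m|^{\frac13}\right)\right).$$
   Context: For $w\in\mathbb{C}$, $\tau$ in the upper half-plane, put $\zeta=e^{2\pi i w}$, $q=e^{2\pi i\tau}$, $\eta(\tau)=q^{1/24}\prod_{n\ge1}(1-q^n)$, $\vartheta(w;\tau)=i\zeta^{1/2}q^{1/8}\prod_{n\ge1}(1-q^n)(1-\zeta q^n)(1-\zeta^{-1}q^{n-1})$, and $$g(w;\tau)=i\,\frac{(\zeta^{1/2}-\zeta^{-1/2})\,\eta(\tau)^3}{\vartheta(w;\tau)}=\prod_{n\ge1}\frac{(1-q^n)^2}{(1-\zeta q^n)(1-\zeta^{-1}q^n)},\qquad f_k(w;\tau)=\frac{g(w;\tau)^2}{\eta(\tau)^k}.$$ The numbers $a_{m,k}(n)$ are defined by expanding in powers of $q$ with coefficients Laurent polynomials in $\zeta$: $f_k(w;\tau)=\sum_{m,n}a_{m,k}(n)\,\zeta^m q^{n-\frac{k}{24}}$. $p_k(n)$ is the number of partitions of $n$ in $k$ colors, i.e. $\sum_{n\ge0}p_k(n)q^n=\prod_{n\ge1}(1-q^n)^{-k}$. The profile function is $$P(m,\beta)=\frac{d^2}{dm^2}\left(\frac m2\coth\!\left(\frac{\beta m}{2}\right)\right)=\frac{\beta}{4}\,\frac{1}{\sinh^2(\beta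 m/2)}\left(\beta m\coth\!\left(\frac{\beta m}{2}\right)-2\right).$$ *)

theory Defs
  imports "HOL-Analysis.Analysis" "HOL-Library.Multiset"
begin

text \<open>Throughout, \<open>\<zeta> = e\<^sup>2\<^sup>\<pi>\<^sup>i\<^sup>w\<close> and \<open>q = e\<^sup>2\<^sup>\<pi>\<^sup>i\<^sup>\<tau>\<close>; a (possibly fractional) power of
  \<open>\<zeta>\<close> or \<open>q\<close> always means the exponential with the exponent scaled accordingly, so that no branch
  of a root has to be chosen. Products over \<open>n \<ge> 1\<close> are indexed by \<open>Suc n\<close>.\<close>

definition e2pi :: "complex \<Rightarrow> complex" where
  "e2pi z = exp (2 * of_real pi * \<i> * z)"

definition dedekind_eta :: "complex \<Rightarrow> complex" where
  "dedekind_eta \<tau> = e2pi (\<tau> / 24) * (\<Prod>n. 1 - e2pi \<tau> ^ Suc n)"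

definition jacobi_theta :: "complex \<Rightarrow> complex \<Rightarrow> complex" where
  "jacobi_theta w \<tau> = \<i> * e2pi (w / 2) * e2pi (\<tau> / 8) *
     (\<Prod>n. (1 - e2pi \<tau> ^ Suc n) * (1 - e2pi w * e2pi \<tau> ^ Suc n) * (1 - e2pi (- w) * e2pi \<tau> ^ n))"

text \<open>The product form of \<open>g\<close> is taken as the definition because, unlike the theta quotient, it
  needs no removal of singularities at \<open>w \<in> \<int>\<close> (where the quotient is \<open>0 / 0\<close>). The two
  agree everywhere else, see \<open>g_fun_eq_theta_quotient\<close> below.\<close>

definition g_fun :: "complex \<Rightarrow> complex \<Rightarrow> complex" where
  "g_fun w \<tau> = (\<Prod>n. (1 - e2pi \<tau> ^ Suc n) ^ 2 /
                      ((1 - e2pi w * e2pi \<tau> ^ Suc n) * (1 - e2pi (- w) * e2pi \<tau> ^ Suc n)))"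

definition f_fun :: "nat \<Rightarrow> complex \<Rightarrow> complex \<Rightarrow> complex" where
  "f_fun k w \<tau> = g_fun w \<tau> ^ 2 / dedekind_eta \<tau> ^ k"

text \<open>An expansion of \<open>f\<^sub>k\<close> in powers of \<open>q\<close> whose coefficients are Laurent polynomials in \<open>\<zeta>\<close>:
  for each \<open>n\<close> only finitely many \<open>a m n\<close> are nonzero. The condition \<open>\<bar>Im w\<bar> < Im \<tau>\<close> says
  \<open>\<bar>q\<bar> < \<bar>\<zeta>\<bar> < 1 / \<bar>q\<bar>\<close>, i.e. \<open>\<tau>\<close> is above the first poles of \<open>f\<^sub>k\<close>, which is exactly where
  the power series in \<open>q\<close> converges.\<close>

definition is_f_expansion :: "nat \<Rightarrow> (int \<Rightarrow> nat \<Rightarrow> real) \<Rightarrow> bool" where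
  "is_f_expansion k a \<longleftrightarrow>
     (\<forall>n. finite {m. a m n \<noteq> 0}) \<and>
     (\<forall>w \<tau>. Im \<tau> > 0 \<longrightarrow> \<bar>Im w\<bar> < Im \<tau> \<longrightarrow>
        (\<lambda>n. (\<Sum>m | a m n \<noteq> 0. of_real (a m n) * e2pi (of_int m * w)) *
              e2pi ((of_nat n - of_nat k / 24) * \<tau>)) sums f_fun k w \<tau>)"

text \<open>The expansion is unique: the series determines, for each \<open>\<zeta>\<close> on the unit circle, the
  coefficients of all powers of \<open>q\<close>, and a Laurent polynomial is determined by its values there.\<close>

definition a_coeff :: "nat \<Rightarrow> int \<Rightarrow> nat \<Rightarrow> real" where
  "a_coeff k = (THE a. is_f_expansion k a)"

text \<open>A partition of \<open>n\<close> in \<open>k\<close> colours is a multiset of pairs (part, colour).\<close>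

definition colored_partitions :: "nat \<Rightarrow> nat \<Rightarrow> (nat \<times> nat) multiset set" where
  "colored_partitions k n =
     {M. (\<forall>(s, c) \<in> set_mset M. 1 \<le> s \<and> c < k) \<and> (\<Sum>(s, c) \<in># M. s) = n}"

definition p_col :: "nat \<Rightarrow> nat \<Rightarrow> nat" where
  "p_col k n = card (colored_partitions k n)"

definition coth :: "real \<Rightarrow> real" where
  "coth x = cosh x / sinh x"

definition profile :: "real \<Rightarrow> real \<Rightarrow> real" where
  "profile m \<beta> = (deriv ^^ 2) (\<lambda>x. x / 2 * coth (\<beta> * x / 2)) m"

definition beta :: "nat \<Rightarrow> nat \<Rightarrow> real" where
  "beta k n = pi * sqrt (real k / (6 * real n))"


lemma norm_e2pi: "norm (e2pi z) = exp (- 2 * pi * Im z)"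
  by (simp add: e2pi_def)

lemma e2pi_add: "e2pi (x + y) = e2pi x * e2pi y"
  by (simp add: e2pi_def exp_add ring_distribs)

lemma convergent_prod_geometric:
  fixes c q :: complex
  assumes "norm q < 1"
  shows "convergent_prod (\<lambda>n. 1 - c * q ^ n)"
proof (rule abs_convergent_prod_imp_convergent_prod)
  have "summable (\<lambda>n. norm c * norm q ^ n)"
    using assms by (intro summable_mult summable_geometric) auto
  then show "abs_convergent_prod (\<lambda>n. 1 - c * q ^ n)"
    by (simp add: abs_convergent_prod_conv_summable norm_mult norm_power)
qed

lemma g_fun_eq_theta_quotient:
  assumes "Im \<tau> > 0" "w \<notin> \<int>"
  shows "g_fun w \<tau> = \<i> * (e2pi (w / 2) - e2pi (- w / 2)) * dedekind_eta \<tau> ^ 3 / jacobi_theta w \<tau>"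
proof -
  define q where "q = e2pi \<tau>"
  have q: "norm q < 1" using assms by (simp add: q_def norm_e2pi)
  define Q where "Q = (\<Prod>n. 1 - q ^ Suc n)"
  define A where "A = (\<Prod>n. 1 - e2pi w * q ^ Suc n)"
  define B where "B = (\<Prod>n. 1 - e2pi (- w) * q ^ Suc n)"
  have conv: "convergent_prod (\<lambda>n. 1 - c * q ^ Suc n)" for c
    using convergent_prod_geometric[OF q, of "c * q"] by (simp add: mult.assoc)
  have convQ: "convergent_prod (\<lambda>n. 1 - q ^ Suc n)" using conv[of 1] by simp
  have ne: "e2pi (- w) \<noteq> 1"
  proof
    assume "e2pi (- w) = 1"
    then obtain n :: int where n: "Im w = 0" "- (pi * Re w) = pi * of_int n"
      unfolding e2pi_def exp_eq_1 by auto
    have "pi * (Re w + of_int n) = 0" using n(2) by (simp add: algebra_simps)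
    then have "w = of_int (- n)" using n(1) by (simp add: complex_eq_iff)
    with assms show False by (metis Ints_of_int)
  qed
  have g: "g_fun w \<tau> = Q ^ 2 / (A * B)"
    unfolding g_fun_def q_def[symmetric] Q_def A_def B_def
    by (rule has_prod_unique[symmetric] has_prod_divide has_prod_mult has_prod_power
             convergent_prod_has_prod conv convQ)+
  have B0: "(\<Prod>n. 1 - e2pi (- w) * q ^ n) = (1 - e2pi (- w)) * B"
    unfolding B_def
    using prodinf_split_head[OF convergent_prod_geometric[OF q, of "e2pi (- w)"]] ne
    by (simp add: field_simps)
  have th: "jacobi_theta w \<tau> = \<i> * e2pi (w / 2) * e2pi (\<tau> / 8) * (Q * A * ((1 - e2pi (- w)) * B))"
  proof -
    have "(\<lambda>n. (1 - q ^ Suc n) * (1 - e2pi w * q ^ Suc n) * (1 - e2pi (- w) * q ^ n)) has_prod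
            (Q * A * ((1 - e2pi (- w)) * B))"
      unfolding B0[symmetric] Q_def A_def
      by (rule has_prod_mult convergent_prod_has_prod conv convQ convergent_prod_geometric q)+
    then show ?thesis
      unfolding jacobi_theta_def q_def[symmetric] by (simp add: has_prod_unique[symmetric])
  qed
  have "Q \<noteq> 0"
    unfolding Q_def
  proof (rule prodinf_nonzero[OF convQ])
    fix i
    have "norm (q ^ Suc i) < 1"
      using q power_Suc_less_one[of "norm q" i] power_less_one_iff[of "norm q" "Suc i"]
      by (simp add: norm_power del: power_Suc)
    then show "1 - q ^ Suc i \<noteq> 0" by auto
  qed
  have eta: "dedekind_eta \<tau> ^ 3 = e2pi (\<tau> / 8) * Q ^ 3"
    by (simp add: dedekind_eta_def Q_def q_def power_mult_distrib e2pi_def flip: exp_of_nat_mult)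
  have half: "e2pi (w / 2) - e2pi (- w / 2) = e2pi (w / 2) * (1 - e2pi (- w))"
    using e2pi_add[of "w / 2" "- w"] by (simp add: algebra_simps)
  have nz: "e2pi z \<noteq> 0" for z by (simp add: e2pi_def)
  show ?thesis
    unfolding g th eta half using \<open>Q \<noteq> 0\<close> ne nz
    by (cases "A * B = 0") (auto simp: field_simps power2_eq_square power3_eq_cube)
qed

lemma finite_colored_partitions: "finite (colored_partitions k n)"
proof (rule finite_subset)
  show "finite (\<Union>j\<le>n. multisets_of_size ({1..n} \<times> {..<k}) j)"
    by (auto intro: finite_multisets_of_size)
  show "colored_partitions k n \<subseteq> (\<Union>j\<le>n. multisets_of_size ({1..n} \<times> {..<k}) j)"
  proof
    fix M assume M: "M \<in> colored_partitions k n"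
    have sum: "(\<Sum>x \<in># M. fst x) = n" and pos: "\<And>x. x \<in># M \<Longrightarrow> 1 \<le> fst x \<and> snd x < k"
      using M by (auto simp: colored_partitions_def case_prod_unfold)
    have "fst x \<le> n" if "x \<in># M" for x
      using sum that by (metis insert_DiffM le_add1 image_mset_add_mset sum_mset.add_mset)
    moreover have "size M \<le> n"
    proof -
      have "size M = (\<Sum>x \<in># M. 1)" by simp
      also have "\<dots> \<le> (\<Sum>x \<in># M. fst x)" using pos by (intro sum_mset_mono) auto
      finally show ?thesis using sum by simp
    qed
    ultimately show "M \<in> (\<Union>j\<le>n. multisets_of_size ({1..n} \<times> {..<k}) j)"
      using pos by (force simp: multisets_of_size_def)
  qed
qed

lemma profile_eq:
  assumes "m \<noteq> 0" "\<beta> \<noteq> 0"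
  shows "profile m \<beta> = \<beta> / 4 * (1 / sinh (\<beta> * m / 2) ^ 2) * (\<beta> * m * coth (\<beta> * m / 2) - 2)"
proof -
  define F where "F = (\<lambda>x. x / 2 * coth (\<beta> * x / 2))"
  define G where "G = (\<lambda>x. coth (\<beta> * x / 2) / 2 - \<beta> * x / 4 / sinh (\<beta> * x / 2) ^ 2)"
  have id: "cosh y ^ 2 = 1 + sinh y ^ 2" for y :: real by (simp add: cosh_square_eq)
  have F: "(F has_real_derivative G x) (at x)" if "x \<noteq> 0" for x
  proof -
    have s: "sinh (\<beta> * x / 2) \<noteq> 0" using that assms by simp
    show ?thesis
      unfolding F_def G_def coth_def using s
      apply (auto intro!: derivative_eq_intros)
      using id[of "\<beta> * x / 2"]
      by (simp add: field_simps power2_eq_square power4_eq_xxxx)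
  qed
  have G: "(G has_real_derivative
      \<beta> / 4 * (1 / sinh (\<beta> * m / 2) ^ 2) * (\<beta> * m * coth (\<beta> * m / 2) - 2)) (at m)"
  proof -
    have s: "sinh (\<beta> * m / 2) \<noteq> 0" using assms by simp
    show ?thesis
      unfolding G_def coth_def using s
      apply (auto intro!: derivative_eq_intros)
      using id[of "\<beta> * m / 2"]
      by (simp add: field_simps power2_eq_square power4_eq_xxxx)
  qed
  have "\<forall>\<^sub>F x in nhds m. deriv F x = G x"
    using t1_space_nhds[OF assms(1)]
    by eventually_elim (use F in \<open>auto intro: DERIV_imp_deriv\<close>)
  then have "deriv (deriv F) m = deriv G m"
    by (intro deriv_cong_ev) auto
  then show ?thesis
    using DERIV_imp_deriv[OF G] by (simp add: profile_def F_def numeral_2_eq_2)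
qed

end

theory Submission
  imports Defs "HOL-Complex_Analysis.Complex_Analysis" "HOL-Probability.Sinc_Integral"
begin

text \<open>The square of the theta quotient has the Laurent expansion
  \<open>g\<^sup>2 = 1 + (\<zeta> - 2 + 1/\<zeta>) * S\<close>, where \<open>S\<close> is the sum of \<open>A\<^bsub>|m|\<^esub>(q) \<zeta>\<^sup>m\<close> over all integers \<open>m\<close> and
  \<open>A\<^sub>m(q)\<close> is the sum of \<open>(m + 2r) q\<^bsup>r(r+m)\<^esup>\<close> over \<open>r \<ge> 1\<close>: after multiplication by the square of the
  theta product both sides are holomorphic and invariant under \<open>\<zeta> \<mapsto> q\<zeta>\<close>, hence constant. So for
  \<open>m \<ge> 1\<close> the numbers \<open>a\<^bsub>m,k\<^esub>(n)\<close> have the generating function \<open>C\<^sub>m(q) * \<Prod>(1 - q\<^sup>n)\<^bsup>-k\<^esup>\<close> with \<open>C\<^sub>m\<close> the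
  second difference of \<open>A\<^sub>m\<close> in \<open>m\<close>. For \<open>q = e\<^bsup>-t\<^esup>\<close> in a sector around the positive axis,
  Euler--Maclaurin summation gives \<open>C\<^sub>m(q) = P(m,t) + O(|t|\<^bsup>3/2\<^esup>)\<close> uniformly in \<open>m\<close>. In Cauchy's integral
  over the circle of radius \<open>e\<^bsup>-\<beta>\<^esup>\<close>, \<open>\<beta> = \<beta>\<^sub>k\<close>, the infinite product decays like a Gaussian of width
  \<open>\<beta>\<^bsup>3/2\<^esup>\<close>, and dominated convergence bounds \<open>p\<^sub>k(n)\<close> below by the mass of that Gaussian; hence
  \<open>a\<^bsub>m,k\<^esub>(n) / p\<^sub>k(n) = P(m,\<beta>) + O(\<beta>\<^bsup>3/2\<^esup>)\<close> uniformly in \<open>m\<close>. This absolute error is small enough because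
  \<open>P(m,\<beta>) \<ge> c \<beta> e\<^bsup>-\<beta>m\<^esup>\<close>, and \<open>e\<^bsup>\<beta>m\<^esup> = O(m\<^bsup>1/3\<^esup>)\<close> in the given range.\<close>

section \<open>The infinite product as an exponential\<close>

text \<open>All estimates must be uniform in m, while m t ranges from the size of t to infinity, so
  no expansion in m t is available. For bounded m t each \<open>A_ser m\<close> has size 1/t but
  \<open>C_ser m\<close> only size t: separate asymptotics of the three summands would have to be
  two orders sharper, so the second difference is taken under the sum. There everything is a total
  derivative, since (m + 2x) e^(-t(x^2+mx)) is -1/t times the derivative of the exponential; the
  integral in Euler-Maclaurin vanishes, leaving boundary terms and remainders. The error t^(3/2) is
  t^2 times a loss of t^(-1/2), the number of terms that matter. On the circle the comparison is
  with the profile at the real point, a constant that leaves the integral. So no asymptotic formula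
  for p_k(n) is needed, only a lower bound of the right order. The sector |Im t| <= Re t suffices
  because outside it all losses are fixed powers of 1/Re t, which the decay of the product
  outweighs. As \<open>a_coeff\<close> is a definite description, existence and uniqueness of the
  expansion belong to the proof.\<close>

text \<open>Minus the logarithm of the product of \<open>1 - x * q ^ n\<close> over \<open>n \<ge> 0\<close>; the logarithmic series makes
  holomorphy in \<open>x\<close> immediate.\<close>

definition qlog :: "complex \<Rightarrow> complex \<Rightarrow> complex" where
  "qlog q x = (\<Sum>l. x ^ Suc l / (of_nat (Suc l) * (1 - q ^ Suc l)))"

lemma one_minus_power_norm_ge:
  fixes q :: complex
  assumes "norm q < 1"
  shows "1 - norm q \<le> norm (1 - q ^ Suc l)"
proof -
  have "norm (q ^ Suc l) \<le> norm q"
    using assms by (simp add: norm_power norm_mult mult_left_le power_le_one)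
  then show ?thesis
    using norm_triangle_ineq2[of 1 "q ^ Suc l"] by simp
qed

lemma qlog_term_bound:
  fixes q x :: complex
  assumes "norm q < 1"
  shows "norm (x ^ Suc l / (of_nat (Suc l) * (1 - q ^ Suc l))) \<le> norm x ^ Suc l / (1 - norm q)"
proof -
  have "1 * (1 - norm q) \<le> real (Suc l) * norm (1 - q ^ Suc l)"
    using one_minus_power_norm_ge[OF assms, of l] assms
    by (intro mult_mono) auto
  then have "1 - norm q \<le> norm (of_nat (Suc l) * (1 - q ^ Suc l) :: complex)"
    by (metis mult_1 norm_mult norm_of_nat)
  then show ?thesis
    using assms unfolding norm_divide norm_power
    by (intro divide_left_mono) (auto intro!: mult_pos_pos)
qed

lemma qlog_abs_summable:
  fixes q x :: complex
  assumes "norm q < 1" "norm x < 1"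
  shows "summable (\<lambda>l. norm (x ^ Suc l / (of_nat (Suc l) * (1 - q ^ Suc l))))"
proof (rule summable_comparison_test')
  show "summable (\<lambda>l. norm x ^ Suc l / (1 - norm q))"
    using assms by (intro summable_divide) (simp add: summable_geometric)
qed (use qlog_term_bound[OF assms(1)] in auto)

lemma qlog_sums:
  assumes "norm q < 1" "norm x < 1"
  shows "(\<lambda>l. x ^ Suc l / (of_nat (Suc l) * (1 - q ^ Suc l))) sums qlog q x"
  unfolding qlog_def by (intro summable_sums summable_norm_cancel[OF qlog_abs_summable] assms)

lemma norm_qlog_le:
  assumes "norm q < 1" "norm x < 1"
  shows "norm (qlog q x) \<le> norm x / ((1 - norm x) * (1 - norm q))"
proof -
  have "(\<lambda>l. norm x ^ Suc l / (1 - norm q)) sums (norm x * (1 / (1 - norm x)) / (1 - norm q))"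
    using assms unfolding power_Suc by (intro sums_divide sums_mult geometric_sums) simp
  note geo = this
  from suminf_le[OF qlog_term_bound[OF assms(1), of x] qlog_abs_summable[OF assms] sums_summable[OF geo]]
  show ?thesis
    using summable_norm[OF qlog_abs_summable[OF assms]] sums_unique[OF geo]
    unfolding qlog_def by simp
qed

text \<open>In \<open>qlog q x - qlog q (x * q)\<close> the factors \<open>1 - q ^ Suc l\<close> of
  the denominators cancel; what remains is the logarithmic series of
  \<open>- Ln (1 - x)\<close>.\<close>

lemma exp_qlog_step:
  assumes "norm q < 1" "norm x < 1"
  shows "exp (- qlog q x) = (1 - x) * exp (- qlog q (x * q))"
proof -
  have xq: "norm (x * q) < 1"
    using assms norm_mult_less[of x 1 q 1] by simp
  have *: "(\<lambda>l. x ^ Suc l / of_nat (Suc l)) sums (qlog q x - qlog q (x * q))"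
  proof -
    have "x ^ Suc l / (of_nat (Suc l) * (1 - q ^ Suc l)) -
        (x * q) ^ Suc l / (of_nat (Suc l) * (1 - q ^ Suc l)) = x ^ Suc l / of_nat (Suc l)" for l
    proof -
      have "1 - q ^ Suc l \<noteq> 0" using one_minus_power_norm_ge[OF assms(1), of l] assms by auto
      then have "x ^ Suc l * (1 - q ^ Suc l) / (of_nat (Suc l) * (1 - q ^ Suc l)) = x ^ Suc l / of_nat (Suc l)"
        by (rule nonzero_mult_divide_mult_cancel_right)
      moreover have "x ^ Suc l * (1 - q ^ Suc l) = x ^ Suc l - (x * q) ^ Suc l"
        by (simp only: power_mult_distrib right_diff_distrib mult_1_right)
      ultimately show ?thesis by (simp only: diff_divide_distrib)
    qed
    then show ?thesis
      using sums_diff[OF qlog_sums[OF assms] qlog_sums[OF assms(1) xq]] by simp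
  qed
  have "(\<lambda>n. (-1) ^ Suc n / of_nat n * (- x) ^ n) sums Ln (1 + (- x))"
    using assms by (intro Ln_series) simp
  then have "(\<lambda>n. (-1) ^ Suc (Suc n) / of_nat (Suc n) * (- x) ^ Suc n) sums Ln (1 - x)"
    by (subst sums_Suc_iff) simp
  moreover have "(-1) ^ Suc (Suc n) / of_nat (Suc n) * (- x) ^ Suc n = - (x ^ Suc n / of_nat (Suc n))" for n
  proof -
    have "x ^ Suc n = (-1) ^ Suc n * (- x) ^ Suc n"
      using power_mult_distrib[of "-1" "-x" "Suc n"] by simp
    then show ?thesis by (simp only: power_Suc) simp
  qed
  ultimately have "(\<lambda>l. - (x ^ Suc l / of_nat (Suc l))) sums Ln (1 - x)" by (simp only:)
  with sums_minus[OF *] have "- (qlog q x - qlog q (x * q)) = Ln (1 - x)"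
    using sums_unique2 by blast
  then have "- qlog q x = Ln (1 - x) + (- qlog q (x * q))" by (simp add: algebra_simps)
  moreover have "1 - x \<noteq> 0" using assms by auto
  ultimately show ?thesis by (simp add: exp_diff exp_minus field_simps)
qed

text \<open>Iterating the one-step identity leaves the tail factor
  \<open>exp (qlog q (x * q ^ N))\<close>, which tends to 1 because \<open>qlog\<close> is bounded
  by a multiple of the norm of its argument near 0.\<close>

lemma has_prod_exp_qlog:
  assumes "norm q < 1" "norm x < 1"
  shows "(\<lambda>n. 1 - x * q ^ n) has_prod exp (- qlog q x)"
proof -
  have xq: "norm (x * q ^ N) < 1" for N
  proof -
    have "norm x * norm q ^ N \<le> norm x * 1"
      using assms by (intro mult_left_mono power_le_one) auto
    then show ?thesis using assms by (simp add: norm_mult norm_power)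
  qed
  have eq: "(\<Prod>n<N. 1 - x * q ^ n) = exp (- qlog q x) * exp (qlog q (x * q ^ N))" for N
  proof (induction N)
    case (Suc N)
    have "(1 - x * q ^ N) * exp (qlog q (x * q ^ N)) = exp (qlog q (x * q ^ Suc N))"
      using exp_qlog_step[OF assms(1) xq[of N]] by (simp add: exp_minus field_simps)
    then show ?case using Suc by (simp add: mult_ac)
  qed (simp flip: exp_add)
  have to0: "(\<lambda>N. norm (x * q ^ N)) \<longlonglongrightarrow> 0"
    using assms by (intro tendsto_norm_zero tendsto_mult_right_zero LIMSEQ_power_zero)
  have "(\<lambda>N. qlog q (x * q ^ N)) \<longlonglongrightarrow> 0"
  proof (rule Lim_null_comparison)
    show "\<forall>\<^sub>F N in sequentially. norm (qlog q (x * q ^ N)) \<le>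
        norm (x * q ^ N) / ((1 - norm (x * q ^ N)) * (1 - norm q))"
      using norm_qlog_le[OF assms(1) xq] by (intro always_eventually) blast
    show "(\<lambda>N. norm (x * q ^ N) / ((1 - norm (x * q ^ N)) * (1 - norm q))) \<longlonglongrightarrow> 0"
      using assms by (auto intro!: tendsto_eq_intros to0)
  qed
  then have "(\<lambda>N. exp (- qlog q x) * exp (qlog q (x * q ^ N))) \<longlonglongrightarrow> exp (- qlog q x) * exp 0"
    by (intro tendsto_intros)
  then have "(\<lambda>N. \<Prod>n<N. 1 - x * q ^ n) \<longlonglongrightarrow> exp (- qlog q x)"
    unfolding eq by simp
  then have lim: "(\<lambda>N. \<Prod>n\<le>N. 1 - x * q ^ n) \<longlonglongrightarrow> exp (- qlog q x)"
    by (simp add: LIMSEQ_lessThan_iff_atMost)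
  moreover have "convergent_prod (\<lambda>n. 1 - x * q ^ n)"
    by (rule convergent_prod_geometric) fact
  ultimately have "prodinf (\<lambda>n. 1 - x * q ^ n) = exp (- qlog q x)"
    using convergent_prod_LIMSEQ LIMSEQ_unique by blast
  with convergent_prod_has_prod[OF \<open>convergent_prod _\<close>] show ?thesis by simp
qed

lemma holomorphic_qlog: "norm q < 1 \<Longrightarrow> qlog q holomorphic_on ball 0 1"
proof (rule power_series_holomorphic)
  fix x :: complex assume q: "norm q < 1" and x: "x \<in> ball 0 1"
  define a where "a = (\<lambda>n. case n of 0 \<Rightarrow> 0 | Suc l \<Rightarrow> 1 / (of_nat (Suc l) * (1 - q ^ Suc l)))"
  have "(\<lambda>l. a (Suc l) * (x - 0) ^ Suc l) sums qlog q x"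
    using qlog_sums[OF q, of x] x by (simp add: a_def del: of_nat_Suc power_Suc)
  then have "(\<lambda>n. a n * (x - 0) ^ n) sums qlog q x"
    by (subst (asm) sums_Suc_iff) (simp add: a_def)
  then show "(\<lambda>n. (case n of 0 \<Rightarrow> 0 | Suc l \<Rightarrow> 1 / (of_nat (Suc l) * (1 - q ^ Suc l))) * (x - 0) ^ n) sums qlog q x"
    unfolding a_def .
qed

lemma holomorphic_qlog_compose:
  assumes "norm q < 1" "f holomorphic_on A" "\<And>z. z \<in> A \<Longrightarrow> norm (f z) < 1"
  shows "(\<lambda>z. qlog q (f z)) holomorphic_on A"
  using holomorphic_on_compose_gen[OF assms(2) holomorphic_qlog[OF assms(1)]] assms(3)
  by (auto simp: o_def image_subset_iff)

section \<open>The Laurent expansion of the theta quotient\<close>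

definition A_ser :: "nat \<Rightarrow> complex \<Rightarrow> complex" where
  "A_ser m q = (\<Sum>r. of_nat (m + 2 * Suc r) * q ^ (Suc r * (Suc r + m)))"

text \<open>\<open>m - 1\<close> is truncated subtraction; the facts that relate
  \<open>C_ser\<close> to the coefficients and to the profile are stated for
  \<open>m \<ge> 1\<close>.\<close>

definition C_ser :: "nat \<Rightarrow> complex \<Rightarrow> complex" where
  "C_ser m q = A_ser (m - 1) q - 2 * A_ser m q + A_ser (m + 1) q"

text \<open>Since \<open>Suc r * (Suc r + m) \<ge> m + Suc r\<close>, the dependence on m and on r
  separates. One bound thus serves both the summation over r and the later power series in z with
  coefficients \<open>A_ser m q\<close>.\<close>

lemma A_ser_term_bound:
  fixes q :: complex
  assumes "norm q < 1"
  shows "norm (of_nat (m + 2 * Suc r) * q ^ (Suc r * (Suc r + m))) \<le>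
           (real (m + 1) * norm q ^ m) * (2 * (real (Suc r) * norm q ^ Suc r))"
proof -
  have "real (m + 2 * Suc r) \<le> real (m + 1) * (2 * real (Suc r))"
    by (simp add: algebra_simps)
  moreover have "norm q ^ (Suc r * (Suc r + m)) \<le> norm q ^ (m + Suc r)"
    using assms by (intro power_decreasing) (auto simp: algebra_simps)
  ultimately have "real (m + 2 * Suc r) * norm q ^ (Suc r * (Suc r + m)) \<le>
      (real (m + 1) * (2 * real (Suc r))) * norm q ^ (m + Suc r)"
    by (intro mult_mono) auto
  then show ?thesis
    unfolding norm_mult norm_of_nat norm_power power_add by (simp only: mult_ac)
qed

lemma summable_Suc_times_power:
  fixes x :: real
  assumes "0 \<le> x" "x < 1"
  shows "summable (\<lambda>r. real (Suc r) * x ^ Suc r)"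
  using geometric_deriv_sums[of x] assms summable_mult[of "\<lambda>n. real (Suc n) * x ^ n" x]
  by (auto simp: sums_iff mult_ac)

lemma A_ser_abs_summable:
  fixes q :: complex
  assumes "norm q < 1"
  shows "summable (\<lambda>r. norm (of_nat (m + 2 * Suc r) * q ^ (Suc r * (Suc r + m))))"
  by (rule summable_comparison_test'[OF summable_mult[OF summable_mult[OF summable_Suc_times_power[of "norm q"]]]])
     (use A_ser_term_bound[OF assms] assms in auto)

lemma A_ser_sums:
  fixes q :: complex
  assumes "norm q < 1"
  shows "(\<lambda>r. of_nat (m + 2 * Suc r) * q ^ (Suc r * (Suc r + m))) sums A_ser m q"
  unfolding A_ser_def by (intro summable_sums summable_norm_cancel[OF A_ser_abs_summable] assms)

lemma norm_A_ser_le: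
  assumes "norm q < 1"
  obtains K where "K \<ge> 0" "\<And>m. norm (A_ser m q) \<le> K * (real (m + 1) * norm q ^ m)"
proof
  let ?K = "\<Sum>r. 2 * (real (Suc r) * norm q ^ Suc r)"
  have s: "summable (\<lambda>r. 2 * (real (Suc r) * norm q ^ Suc r))"
    using assms by (intro summable_mult summable_Suc_times_power) auto
  show "?K \<ge> 0" by (intro suminf_nonneg s) simp
  show "norm (A_ser m q) \<le> ?K * (real (m + 1) * norm q ^ m)" for m
  proof -
    have "norm (A_ser m q) \<le> (\<Sum>r. norm (of_nat (m + 2 * Suc r) * q ^ (Suc r * (Suc r + m))))"
      unfolding A_ser_def by (rule summable_norm[OF A_ser_abs_summable[OF assms]])
    also have "\<dots> \<le> (\<Sum>r. (real (m + 1) * norm q ^ m) * (2 * (real (Suc r) * norm q ^ Suc r)))"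
      by (intro suminf_le A_ser_term_bound A_ser_abs_summable summable_mult s assms)
    also have "\<dots> = (real (m + 1) * norm q ^ m) * ?K" by (rule suminf_mult[OF s])
    finally show ?thesis by (simp only: mult_ac)
  qed
qed

text \<open>Putting back the term of index 0, which is \<open>of_nat (j + 2)\<close>, makes both
  sides equal term by term: the weights agree, and r(r+j+2) + (j+2) = (r+1)(r+1+j) + 1.\<close>

lemma A_ser_shift:
  assumes "norm q < 1"
  shows "q ^ (j + 2) * (of_nat (j + 2) + A_ser (j + 2) q) = q * A_ser j q"
proof -
  have "(\<lambda>r. of_nat (j + 2 + 2 * r) * q ^ (r * (r + (j + 2)))) sums (A_ser (j + 2) q + of_nat (j + 2))"
    using A_ser_sums[OF assms, of "j + 2"] by (subst (asm) sums_Suc_iff) simp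
  then have "(\<lambda>r. q ^ (j + 2) * (of_nat (j + 2 + 2 * r) * q ^ (r * (r + (j + 2))))) sums
      (q ^ (j + 2) * (A_ser (j + 2) q + of_nat (j + 2)))"
    by (rule sums_mult)
  moreover have "(\<lambda>r. q * (of_nat (j + 2 * Suc r) * q ^ (Suc r * (Suc r + j)))) sums (q * A_ser j q)"
    by (rule sums_mult[OF A_ser_sums[OF assms]])
  moreover have "q ^ (j + 2) * (of_nat (j + 2 + 2 * r) * q ^ (r * (r + (j + 2)))) =
      q * (of_nat (j + 2 * Suc r) * q ^ (Suc r * (Suc r + j)))" for r
  proof -
    have p: "q ^ (j + 2) * q ^ (r * (r + (j + 2))) = q * q ^ (Suc r * (Suc r + j))"
      by (simp only: flip: power_add power_Suc) (simp add: algebra_simps)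
    have eq: "of_nat (j + 2 + 2 * r) = (of_nat (j + 2 * Suc r) :: complex)" by simp
    show ?thesis unfolding eq mult.left_commute[of "q ^ (j + 2)"] p by (rule mult.left_commute)
  qed
  ultimately have "q ^ (j + 2) * (A_ser (j + 2) q + of_nat (j + 2)) = q * A_ser j q"
    by (simp only: sums_unique2)
  then show ?thesis by (simp only: add.commute)
qed

text \<open>Laurent coefficients on \<open>norm q < norm x < 1\<close> of the function \<open>L\<close> that agrees, up to a constant
  factor, with \<open>x\<close> over the square of the theta product. Reflecting the index expresses that the
  expansions of \<open>L\<close> on both sides of its double pole at \<open>1\<close> satisfy \<open>L (x * q) = q * x\<^sup>2 * L x\<close>.\<close>

definition L_coeff :: "complex \<Rightarrow> int \<Rightarrow> complex" where
  "L_coeff q m = A_ser (nat \<bar>m\<bar>) q + of_int (max m 0)"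

text \<open>For \<open>m \<ge> 2\<close> this is \<open>A_ser_shift\<close>, where
  \<open>of_int (max m 0)\<close> supplies the term \<open>of_nat (j + 2)\<close>; for
  \<open>m \<le> 0\<close> it is the same identity read backwards; \<open>m = 1\<close> is the fixed
  point of the reflection.\<close>

lemma L_coeff_reflect:
  assumes "norm q < 1" "q \<noteq> 0"
  shows "L_coeff q m * q powi m = q * L_coeff q (2 - m)"
proof -
  have *: "L_coeff q (int j + 2) * q powi (int j + 2) = q * L_coeff q (- int j)" for j
  proof -
    have "nat \<bar>int j + 2\<bar> = j + 2" "q powi (int j + 2) = q ^ (j + 2)"
      using power_int_of_nat[of q "j + 2"] by (auto simp: add.commute)
    then show ?thesis
      using A_ser_shift[OF assms(1), of j] by (simp add: L_coeff_def max_def mult_ac add_ac)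
  qed
  consider j where "m = int j + 2" | "m = 1" | j where "m = - int j"
  proof -
    have "m = int (nat (m - 2)) + 2 \<or> m = 1 \<or> m = - int (nat (- m))" by linarith
    with that show thesis by blast
  qed
  then show ?thesis
  proof cases
    case 1 then show ?thesis using *[of j] by simp
  next
    case 3
    have "q powi (int j + 2) * q powi (- int j) = q * q"
      using assms by (simp flip: power_int_add) (simp add: power2_eq_square)
    moreover have "q * (L_coeff q (- int j) * q powi (- int j)) =
        L_coeff q (int j + 2) * (q powi (int j + 2) * q powi (- int j))"
      by (simp only: *[of j, symmetric] flip: mult.assoc)
    ultimately have "q * (L_coeff q (- int j) * q powi (- int j)) = q * (q * L_coeff q (int j + 2))"
      by (simp only: mult_ac)
    then show ?thesis using 3 assms by (simp add: add.commute)
  qed simp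
qed

lemma has_sum_int:
  fixes f :: "int \<Rightarrow> 'a :: {topological_comm_monoid_add, t2_space}"
  assumes "((\<lambda>n. f (int n)) has_sum a) UNIV" "((\<lambda>n. f (- int (Suc n))) has_sum b) UNIV"
  shows "(f has_sum (a + b)) UNIV"
proof -
  have "(f has_sum a) (range int)"
    using assms(1) by (subst has_sum_reindex) (auto simp: o_def)
  moreover have "(f has_sum b) (range (\<lambda>n. - int (Suc n)))"
    using assms(2) by (subst has_sum_reindex) (auto simp: o_def inj_on_def)
  moreover have "range int \<union> range (\<lambda>n. - int (Suc n)) = UNIV"
  proof -
    have "m \<in> range int \<union> range (\<lambda>n. - int (Suc n))" for m
      by (cases m rule: int_cases) blast+
    then show ?thesis by blast
  qed
  moreover have "range int \<inter> range (\<lambda>n. - int (Suc n)) = {}" by auto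
  ultimately show ?thesis using has_sum_Un_disjoint[OF \<open>(f has_sum a) _\<close> \<open>(f has_sum b) _\<close>] by simp
qed

text \<open>Two power series, in \<open>z\<close> and in \<open>inverse z\<close>, instead of a sum
  over the integers, so that holomorphy is immediate. The index 0 occurs in both, hence the
  subtraction.\<close>

definition S_fun :: "complex \<Rightarrow> complex \<Rightarrow> complex" where
  "S_fun q z = (\<Sum>m. A_ser m q * z ^ m) + (\<Sum>m. A_ser m q * inverse z ^ m) - A_ser 0 q"

lemma A_ser_powser_summable:
  assumes "norm q < 1" "norm (q * z) < 1"
  shows "summable (\<lambda>m. norm (A_ser m q * z ^ m))"
proof -
  obtain K where K: "K \<ge> 0" "\<And>m. norm (A_ser m q) \<le> K * (real (m + 1) * norm q ^ m)"
    using norm_A_ser_le[OF assms(1)] by blast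
  have "summable (\<lambda>m. K * (real (Suc m) * norm (q * z) ^ m))"
    using geometric_deriv_sums[of "norm (q * z)"] assms by (intro summable_mult) (auto simp: sums_iff)
  moreover have "norm (A_ser m q * z ^ m) \<le> K * (real (Suc m) * norm (q * z) ^ m)" for m
    using mult_right_mono[OF K(2)[of m], of "norm z ^ m"]
    by (simp add: norm_mult norm_power power_mult_distrib mult_ac)
  ultimately show ?thesis
    by (elim summable_comparison_test'[where N = 0]) (simp only: norm_ge_zero real_norm_def abs_of_nonneg)
qed

lemma S_fun_has_sum:
  assumes "norm q < 1" "norm (q * z) < 1" "norm q < norm z"
  shows "((\<lambda>m. A_ser (nat \<bar>m\<bar>) q * z powi m) has_sum S_fun q z) UNIV"
    and "(\<lambda>m. norm (A_ser (nat \<bar>m\<bar>) q * z powi m)) summable_on UNIV"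
proof -
  have "norm (q * inverse z) < 1"
  proof -
    have "norm z > 0" using assms by (meson norm_ge_zero order_le_less_trans)
    then show ?thesis using assms by (simp add: norm_mult norm_inverse norm_divide field_simps)
  qed
  note s1 = A_ser_powser_summable[OF assms(1,2)] and s2 = A_ser_powser_summable[OF assms(1) this]
  note s2' = summable_Suc_iff[of "\<lambda>m. norm (A_ser m q * inverse z ^ m)", THEN iffD2, OF s2]
  have powi: "z powi - int (Suc n) = inverse z ^ Suc n" for n
    by (metis power_int_minus power_int_of_nat power_inverse)
  have 1: "((\<lambda>n. A_ser (nat \<bar>int n\<bar>) q * z powi int n) has_sum (\<Sum>m. A_ser m q * z ^ m)) UNIV"
    using norm_summable_imp_has_sum[OF s1 summable_sums[OF summable_norm_cancel[OF s1]]] by simp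
  have "(\<lambda>n. A_ser (Suc n) q * inverse z ^ Suc n) sums ((\<Sum>m. A_ser m q * inverse z ^ m) - A_ser 0 q)"
    using summable_sums[OF summable_norm_cancel[OF s2]] by (subst sums_Suc_iff) simp
  from norm_summable_imp_has_sum[OF s2' this]
  have 2: "((\<lambda>n. A_ser (nat \<bar>- int (Suc n)\<bar>) q * z powi (- int (Suc n))) has_sum
     ((\<Sum>m. A_ser m q * inverse z ^ m) - A_ser 0 q)) UNIV"
    unfolding powi by (simp del: of_nat_Suc power_Suc)
  show "((\<lambda>m. A_ser (nat \<bar>m\<bar>) q * z powi m) has_sum S_fun q z) UNIV"
    using has_sum_int[OF 1 2] unfolding S_fun_def by (simp only: add_diff_eq)
  have 3: "((\<lambda>n. norm (A_ser (nat \<bar>int n\<bar>) q * z powi int n)) has_sum (\<Sum>m. norm (A_ser m q * z ^ m))) UNIV"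
    using norm_summable_imp_has_sum[OF _ summable_sums[OF s1]] s1 by simp
  have 4: "((\<lambda>n. norm (A_ser (nat \<bar>- int (Suc n)\<bar>) q * z powi (- int (Suc n)))) has_sum
     (\<Sum>m. norm (A_ser (Suc m) q * inverse z ^ Suc m))) UNIV"
    unfolding powi using norm_summable_imp_has_sum[OF _ summable_sums[OF s2']] s2' by (simp del: of_nat_Suc power_Suc)
  show "(\<lambda>m. norm (A_ser (nat \<bar>m\<bar>) q * z powi m)) summable_on UNIV"
    using has_sum_imp_summable[OF has_sum_int[OF 3 4]] .
qed

lemma S_fun_inverse: "S_fun q (inverse z) = S_fun q z"
  by (simp add: S_fun_def)

text \<open>The part \<open>of_int (max m 0)\<close> of the coefficients sums to x/(1-x)^2, the
  double pole at 1; \<open>S_fun q\<close> itself is regular there.\<close>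

lemma L_coeff_has_sum:
  assumes "norm q < 1" "norm x < 1" "norm q < norm x"
  shows "((\<lambda>m. L_coeff q m * x powi m) has_sum (S_fun q x + x / (1 - x)^2)) UNIV"
proof -
  have qx: "norm (q * x) < 1" using assms norm_mult_less[of q 1 x 1] by simp
  have gs: "(\<lambda>n. of_nat n * x ^ n) sums (x / (1 - x)^2)"
  proof -
    have "(\<lambda>n. x * (of_nat (Suc n) * x ^ n)) sums (x * (1 / (1 - x)^2))"
      by (intro sums_mult geometric_deriv_sums assms)
    then have "(\<lambda>n. of_nat (Suc n) * x ^ Suc n) sums (x / (1 - x)^2)" by (simp add: mult_ac)
    then show ?thesis by (subst (asm) sums_Suc_iff) simp
  qed
  have sn: "summable (\<lambda>n. norm (of_nat n * x ^ n))"
    using summable_Suc_times_power[of "norm x"] assms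
    by (subst summable_Suc_iff[symmetric]) (simp add: norm_mult norm_power del: power_Suc of_nat_Suc)
  have "((\<lambda>m. of_int (max m 0) * x powi m) has_sum (x / (1 - x)^2 + 0)) UNIV"
    by (rule has_sum_int)
       (use norm_summable_imp_has_sum[OF sn gs] in \<open>auto simp: max.absorb1 max.absorb2 intro: has_sum_0\<close>)
  from has_sum_add[OF S_fun_has_sum(1)[OF assms(1) qx assms(3)] this] show ?thesis
    by (simp add: L_coeff_def ring_distribs)
qed

text \<open>\<open>L_coeff_has_sum\<close> is applied at \<open>z * q\<close> and at
  \<open>inverse z\<close>, which both lie in its annulus. The two sums match by
  \<open>L_coeff_reflect\<close> after substituting \<open>2 - m\<close> for \<open>m\<close>, and
  \<open>inverse z\<close> may be replaced by \<open>z\<close> because \<open>S_fun q\<close> and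
  x/(1-x)^2 are invariant under inversion.\<close>

lemma S_fun_functional_equation:
  assumes "norm q < 1" "q \<noteq> 0" "1 < norm z" "norm (q * z) < 1"
  shows "S_fun q (z * q) + z * q / (1 - z * q)^2 = q * z^2 * (S_fun q z + z / (1 - z)^2)"
proof -
  have z0: "z \<noteq> 0" "norm z > 0" using assms by auto
  have z: "z \<noteq> 0" "norm (inverse z) < 1" "norm q < norm (inverse z)"
    using assms z0
    by (auto simp: norm_divide norm_mult inverse_eq_divide divide_less_eq less_divide_eq)
  have "norm q * 1 < norm q * norm z" using assms by (intro mult_strict_left_mono) auto
  then have zq: "norm (z * q) < 1" "norm q < norm (z * q)"
    using assms by (auto simp: norm_mult mult.commute)
  have "((\<lambda>m. q * z^2 * (L_coeff q m * inverse z powi m)) has_sum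
      q * z^2 * (S_fun q (inverse z) + inverse z / (1 - inverse z)^2)) UNIV"
    by (intro has_sum_cmult_right L_coeff_has_sum assms z)
  also have "q * z^2 * (S_fun q (inverse z) + inverse z / (1 - inverse z)^2) =
      q * z^2 * (S_fun q z + z / (1 - z)^2)"
  proof -
    have "z \<noteq> 1" using assms by auto
    then have "inverse z / (1 - inverse z)^2 = z / (1 - z)^2"
      using z by (simp add: field_simps power2_eq_square)
    then show ?thesis unfolding S_fun_inverse by simp
  qed
  finally have "((\<lambda>m. q * z^2 * (L_coeff q (2 - m) * inverse z powi (2 - m))) has_sum
      q * z^2 * (S_fun q z + z / (1 - z)^2)) UNIV"
    by (subst has_sum_reindex_bij_betw[of "\<lambda>m. 2 - m" UNIV UNIV])
       (auto intro!: bij_betwI[of _ _ _ "\<lambda>m. 2 - m"])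
  moreover have "q * z^2 * (L_coeff q (2 - m) * inverse z powi (2 - m)) = L_coeff q m * (z * q) powi m" for m
  proof -
    have "z^2 * inverse z powi (2 - m) = z powi m"
      using z by (simp add: power_int_diff power_int_inverse field_simps)
    then have "q * z^2 * (L_coeff q (2 - m) * inverse z powi (2 - m)) = (q * L_coeff q (2 - m)) * z powi m"
      by (metis (no_types, lifting) mult.assoc mult.commute)
    then show ?thesis by (simp add: power_int_mult_distrib L_coeff_reflect[OF assms(1,2), symmetric])
  qed
  ultimately have "((\<lambda>m. L_coeff q m * (z * q) powi m) has_sum q * z^2 * (S_fun q z + z / (1 - z)^2)) UNIV"
    by simp
  with L_coeff_has_sum[OF assms(1) zq] show ?thesis using has_sum_unique by blast
qed

lemma holomorphic_S_fun:
  assumes "norm q < 1" and nz: "q \<noteq> 0"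
  shows "S_fun q holomorphic_on {z. norm q < norm z \<and> norm (q * z) < 1}"
proof -
  let ?A = "{z :: complex. norm q < norm z \<and> norm (q * z) < 1}"
  define P where "P = (\<lambda>z. \<Sum>m. A_ser m q * z ^ m)"
  have hol: "P holomorphic_on ball 0 (1 / norm q)"
  proof (rule power_series_holomorphic)
    fix w :: complex assume "w \<in> ball 0 (1 / norm q)"
    then have "norm (q * w) < 1" using nz by (simp add: norm_mult field_simps)
    from A_ser_powser_summable[OF assms(1) this]
    show "(\<lambda>n. A_ser n q * (w - 0) ^ n) sums P w"
      unfolding P_def by (simp add: summable_norm_cancel summable_sums)
  qed
  have "P holomorphic_on ?A"
    by (rule holomorphic_on_subset[OF hol]) (use nz in \<open>auto simp: norm_mult field_simps\<close>)
  moreover have "(\<lambda>z. P (inverse z)) holomorphic_on ?A"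
  proof (rule holomorphic_on_compose_gen[OF _ hol, unfolded o_def])
    show "inverse holomorphic_on ?A"
      by (intro holomorphic_intros) auto
    show "inverse ` ?A \<subseteq> ball 0 (1 / norm q)"
    proof safe
      fix z :: complex assume "norm q < norm z"
      moreover have "norm q > 0" using nz by simp
      ultimately show "inverse z \<in> ball 0 (1 / norm q)"
        by (simp add: norm_inverse inverse_eq_divide norm_divide frac_less2)
    qed
  qed
  moreover have "S_fun q = (\<lambda>z. P z + P (inverse z) - A_ser 0 q)"
    by (auto simp: S_fun_def P_def)
  ultimately show ?thesis by (simp add: holomorphic_intros)
qed

lemma open_connected_annulus:
  assumes "0 < norm q" "norm (q :: complex) < 1"
  shows "open {z. norm q < norm z \<and> norm (q * z) < 1}" "connected {z. norm q < norm z \<and> norm (q * z) < 1}"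
proof -
  have eq: "{z. norm q < norm z \<and> norm (q * z) < 1} = {z :: complex. norm q < norm (z - 0) \<and> norm (z - 0) < 1 / norm q}"
    using assms by (auto simp: norm_mult field_simps)
  show "connected {z. norm q < norm z \<and> norm (q * z) < 1}"
    unfolding eq by (rule connected_annulus) simp
  show "open {z. norm q < norm z \<and> norm (q * z) < 1}"
    by (intro open_Collect_conj open_Collect_less continuous_intros)
qed

text \<open>The left-hand side is holomorphic on the annulus and takes the same value at \<open>z\<close> and \<open>z * q\<close>, so
  its modulus attains a maximum in the annulus and it is constant.\<close>

lemma theta_quotient_identity:
  assumes q: "norm q < 1" "q \<noteq> 0" and z: "norm q < norm z" "norm (q * z) < 1"
  shows "exp (- qlog q (q * z)) ^ 2 * exp (- qlog q (q * inverse z)) ^ 2 *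
     (1 + (1 - z)^2 / z * S_fun q z) = exp (- qlog q q) ^ 4"
proof -
  define A where "A = {z. norm q < norm z \<and> norm (q * z) < 1}"
  define F where "F = (\<lambda>z. exp (- qlog q (q * z)) ^ 2 * exp (- qlog q (q * inverse z)) ^ 2 *
     (1 + (1 - z)^2 / z * S_fun q z))"
  have q0: "norm q > 0" using q by simp
  have A: "open A" "connected A" unfolding A_def using open_connected_annulus[OF q0 q(1)] by auto
  have Anz: "z \<noteq> 0" "norm z > 0" if "z \<in> A" for z
    using that q0 unfolding A_def by auto
  have Ainv: "norm (q * inverse z) < 1" if "z \<in> A" for z
    using that Anz[OF that] unfolding A_def
    by (simp add: norm_mult norm_inverse norm_divide divide_less_eq inverse_eq_divide)
  have hol: "F holomorphic_on A"
    unfolding F_def using Ainv Anz holomorphic_S_fun[OF q] q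
    by (intro holomorphic_intros holomorphic_qlog_compose) (auto simp: A_def)
  \<comment> \<open>The summand 1 in \<open>F\<close> is the pole term z/(1-z)^2 times (1-z)^2/z.
    The definition of \<open>F\<close> is visibly holomorphic at 1, whereas this form fits the
    functional equation.\<close>
  have F1: "F z = exp (- qlog q (q * z)) ^ 2 * exp (- qlog q (q * inverse z)) ^ 2 *
      ((1 - z)^2 / z * (S_fun q z + z / (1 - z)^2))" if "z \<noteq> 0" "z \<noteq> 1" for z
    unfolding F_def using that by (simp add: field_simps)
  have per: "F (z * q) = F z" if z: "1 < norm z" "norm (q * z) < 1" for z
  proof -
    have nz: "z \<noteq> 0" "z \<noteq> 1" "z * q \<noteq> 0" "z * q \<noteq> 1" using z q by (auto simp: mult.commute)
    have inv: "q * inverse (z * q) = inverse z" using nz by (simp add: field_simps)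
    have ninv: "norm (inverse z) < 1" using z by (simp add: norm_inverse inverse_less_1_iff)
    have e1: "exp (- qlog q (q * z)) = (1 - q * z) * exp (- qlog q (q * (z * q)))"
      using exp_qlog_step[OF q(1) z(2)] by (simp add: mult_ac)
    have e2: "exp (- qlog q (inverse z)) = (1 - inverse z) * exp (- qlog q (q * inverse z))"
      using exp_qlog_step[OF q(1) ninv] by (simp add: mult_ac)
    have gen: "a^2 * ((1 - inverse z) * b)^2 * ((1 - z * q)^2 / (z * q) * (q * z^2 * L)) =
        ((1 - q * z) * a)^2 * b^2 * ((1 - z)^2 / z * L)" for a b L :: complex
    proof -
      have "(1 - inverse z)^2 * (q * z^2 / (z * q)) = (1 - z)^2 / z"
        using nz q(2) by (simp add: field_simps power2_eq_square)
      then have "((1 - q * z)^2 * a^2 * b^2 * L) * ((1 - inverse z)^2 * (q * z^2 / (z * q))) =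
          ((1 - q * z)^2 * a^2 * b^2 * L) * ((1 - z)^2 / z)"
        by (rule arg_cong)
      then show ?thesis unfolding power_mult_distrib divide_inverse by (simp only: mult_ac)
    qed
    show ?thesis
      unfolding F1[OF nz(3,4)] F1[OF nz(1,2)] inv e1 e2 S_fun_functional_equation[OF q z]
      by (rule gen)
  qed
  obtain \<rho> where \<rho>: "norm q < \<rho>" "\<rho> < 1" using dense[OF q(1)] by blast
  \<comment> \<open>A closed annulus inside \<open>A\<close> whose radii have the ratio
    \<open>norm q\<close>: every point of \<open>A\<close> enters \<open>B\<close> after at most one
    multiplication or division by \<open>q\<close>, so the maximum over the compact \<open>B\<close>
    is a maximum over \<open>A\<close>.\<close>
  define B where "B = {z :: complex. \<rho> \<le> norm z \<and> norm z \<le> \<rho> / norm q}"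
  have "closed B" unfolding B_def by (intro closed_Collect_conj closed_Collect_le continuous_intros)
  moreover have "bounded B" unfolding B_def bounded_iff by auto
  ultimately have cB: "compact B" by (simp add: compact_eq_bounded_closed)
  have BA: "B \<subseteq> A"
  proof
    fix z assume "z \<in> B"
    moreover then have "norm z * norm q \<le> \<rho>" using q0 by (simp add: B_def field_simps)
    ultimately show "z \<in> A" using \<rho> by (auto simp: A_def B_def norm_mult mult.commute)
  qed
  have "\<rho> > 0" using \<rho> q0 by linarith
  then have "\<rho> * norm q \<le> \<rho>" using q by (intro mult_left_le) auto
  then have "of_real \<rho> \<in> B" using \<open>\<rho> > 0\<close> q0 by (simp add: B_def le_divide_eq)
  then have "B \<noteq> {}" by blast
  moreover have "continuous_on B (\<lambda>z. norm (F z))"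
    by (intro continuous_on_norm continuous_on_subset[OF holomorphic_on_imp_continuous_on[OF hol] BA])
  ultimately obtain \<xi> where \<xi>: "\<xi> \<in> B" "\<And>z. z \<in> B \<Longrightarrow> norm (F z) \<le> norm (F \<xi>)"
    using continuous_attains_sup[OF cB, of "\<lambda>z. norm (F z)"] by blast
  have max: "norm (F z) \<le> norm (F \<xi>)" if "z \<in> A" for z
  proof -
    note zA = that[unfolded A_def, simplified]
    consider "z \<in> B" | "norm z < \<rho>" | "norm z > \<rho> / norm q" unfolding B_def by force
    then show ?thesis
    proof cases
      case 1 then show ?thesis using \<xi> by blast
    next
      case 2
      have n: "norm (z / q) = norm z / norm q" by (simp add: norm_divide)
      have "1 < norm (z / q)" "norm (q * (z / q)) < 1" "z / q * q = z"
        using zA 2 \<rho> q q0 by (auto simp: n less_divide_eq)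
      then have "F z = F (z / q)" using per[of "z / q"] by simp
      moreover have "z / q \<in> B"
      proof -
        have "\<rho> \<le> norm z / norm q"
          using \<open>1 < norm (z / q)\<close> \<rho> unfolding n by simp
        then show ?thesis using 2 q0 by (auto simp: B_def n divide_right_mono)
      qed
      ultimately show ?thesis using \<xi> by simp
    next
      case 3
      have "1 < \<rho> / norm q" using \<rho> q0 by simp
      then have "norm z > 1" using 3 by simp
      then have "F (z * q) = F z" using per zA by simp
      moreover have "z * q \<in> B"
      proof -
        have "\<rho> < norm z * norm q" using 3 q0 by (simp add: divide_less_eq)
        moreover have "norm z * norm q < 1" using zA by (simp add: norm_mult mult.commute)
        moreover have "1 < \<rho> / norm q" using \<rho> q0 by simp
        ultimately show ?thesis by (simp add: B_def norm_mult)
      qed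
      ultimately show ?thesis using \<xi>(2)[of "z * q"] by simp
    qed
  qed
  have "F constant_on A"
    by (rule maximum_modulus_principle[OF hol A A(1) order_refl]) (use \<xi> BA max in auto)
  \<comment> \<open>The constant is read off at 1, where the factor (1-z)^2 removes
    \<open>S_fun\<close>.\<close>
  moreover have "z \<in> A" "1 \<in> A" using z q by (auto simp: A_def)
  ultimately have "F z = F 1" unfolding constant_on_def by metis
  then show ?thesis by (simp add: F_def flip: power_add)
qed

lemma g_fun_eq_S_fun:
  assumes \<tau>: "Im \<tau> > 0" "\<bar>Im w\<bar> < Im \<tau>"
  shows "g_fun w \<tau> ^ 2 = 1 + (1 - e2pi w)^2 / e2pi w * S_fun (e2pi \<tau>) (e2pi w)"
proof -
  define q where "q = e2pi \<tau>"
  define z where "z = e2pi w"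
  have q: "norm q < 1" "q \<noteq> 0" using \<tau> by (simp_all add: q_def norm_e2pi) (simp add: e2pi_def)
  have iz: "e2pi (- w) = inverse z" unfolding z_def e2pi_def by (simp add: exp_minus)
  have z: "norm q < norm z" "norm (q * z) < 1" "norm (q * inverse z) < 1"
  proof -
    have "pi * Im w < pi * Im \<tau>" "- (pi * Im w) < pi * Im \<tau>"
      using \<tau> mult_strict_left_mono[of "Im w" "Im \<tau>" pi] mult_strict_left_mono[of "- Im w" "Im \<tau>" pi]
      by simp_all
    then show "norm q < norm z" "norm (q * z) < 1" "norm (q * inverse z) < 1"
      unfolding q_def iz[symmetric] unfolding z_def e2pi_add[symmetric] norm_e2pi
      by (simp_all add: distrib_left)
  qed
  have prod: "(\<lambda>n. 1 - c * q ^ Suc n) has_prod exp (- qlog q (q * c))" if "norm (q * c) < 1" for c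
    using has_prod_exp_qlog[OF q(1) that] by (simp add: mult_ac)
  have "(\<lambda>n. (1 - 1 * q ^ Suc n) ^ 2 / ((1 - z * q ^ Suc n) * (1 - inverse z * q ^ Suc n))) has_prod
      (exp (- qlog q (q * 1)) ^ 2 / (exp (- qlog q (q * z)) * exp (- qlog q (q * inverse z))))"
    by (intro has_prod_divide has_prod_mult has_prod_power prod z) (use q in simp)
  then have "g_fun w \<tau> = exp (- qlog q q) ^ 2 / (exp (- qlog q (q * z)) * exp (- qlog q (q * inverse z)))"
    unfolding g_fun_def q_def[symmetric] z_def[symmetric] iz by (simp add: has_prod_unique[symmetric])
  then have "g_fun w \<tau> ^ 2 = exp (- qlog q q) ^ 4 /
     (exp (- qlog q (q * z)) ^ 2 * exp (- qlog q (q * inverse z)) ^ 2)"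
    by (simp add: power_divide power_mult_distrib flip: power_mult)
  then show ?thesis
    unfolding q_def[symmetric] z_def[symmetric] theta_quotient_identity[OF q z(1,2), symmetric]
    by simp
qed

section \<open>Coloured partitions\<close>

text \<open>Enlarging \<open>J\<close> by one pair at a time builds up the generating function
  factor by factor.\<close>

definition restricted_partitions :: "nat \<Rightarrow> (nat \<times> nat) set \<Rightarrow> nat \<Rightarrow> (nat \<times> nat) multiset set" where
  "restricted_partitions k J n = {M \<in> colored_partitions k n. set_mset M \<subseteq> J}"

lemma finite_restricted_partitions: "finite (restricted_partitions k J n)"
  using finite_colored_partitions by (simp add: restricted_partitions_def)

lemma restricted_partitions_empty: "restricted_partitions k {} n = (if n = 0 then {{#}} else {})"
  by (auto simp: restricted_partitions_def colored_partitions_def)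

text \<open>A multiset containing the new pair arises from exactly one smaller multiset by adding
  one copy, and the smaller one may contain the pair again; this is the recursion behind the factor
  1/(1 - q^s).\<close>

lemma card_restricted_partitions_insert:
  assumes "1 \<le> s" "c < k" "(s, c) \<notin> J"
  shows "card (restricted_partitions k (insert (s, c) J) n) =
    card (restricted_partitions k J n) +
    (if s \<le> n then card (restricted_partitions k (insert (s, c) J) (n - s)) else 0)"
proof -
  let ?R = "restricted_partitions k (insert (s, c) J)"
  have *: "?R n = restricted_partitions k J n \<union> (if s \<le> n then add_mset (s, c) ` ?R (n - s) else {})"
  proof (intro equalityI subsetI)
    fix M assume M: "M \<in> ?R n"
    show "M \<in> restricted_partitions k J n \<union> (if s \<le> n then add_mset (s, c) ` ?R (n - s) else {})"
    proof (cases "(s, c) \<in># M")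
      case True
      then obtain M' where M': "M = add_mset (s, c) M'" by (metis insert_DiffM)
      then have "s \<le> n" "M' \<in> ?R (n - s)"
        using M by (auto simp: restricted_partitions_def colored_partitions_def)
      then show ?thesis using M' by auto
    qed (use M in \<open>auto simp: restricted_partitions_def\<close>)
  qed (use assms in \<open>auto simp: restricted_partitions_def colored_partitions_def split: if_splits\<close>)
  have "restricted_partitions k J n \<inter> (if s \<le> n then add_mset (s, c) ` ?R (n - s) else {}) = {}"
    using assms by (auto simp: restricted_partitions_def)
  with * have "card (?R n) = card (restricted_partitions k J n) +
      card (if s \<le> n then add_mset (s, c) ` ?R (n - s) else {})"
    using finite_restricted_partitions by (simp add: card_Un_disjoint del: Un_iff)
  then show ?thesis by (simp add: card_image inj_on_def)
qed

lemma restricted_partitions_sums: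
  assumes "finite J" "J \<subseteq> {1..} \<times> {..<k}" "norm (q :: complex) < 1"
  shows "summable (\<lambda>n. card (restricted_partitions k J n) * norm q ^ n) \<and>
    (\<lambda>n. of_nat (card (restricted_partitions k J n)) * q ^ n) sums (\<Prod>(s, c)\<in>J. 1 / (1 - q ^ s))"
  using assms(1,2)
proof (induction J rule: finite_induct)
  case empty
  have "summable (\<lambda>n. card (restricted_partitions k {} n) * norm q ^ n)"
    by (rule summable_finite[of "{0}"]) (auto simp: restricted_partitions_empty)
  moreover have "(\<lambda>n. of_nat (card (restricted_partitions k {} n)) * q ^ n) sums
      (\<Sum>n\<in>{0}. of_nat (card (restricted_partitions k {} n)) * q ^ n)"
    by (rule sums_finite) (auto simp: restricted_partitions_empty)
  ultimately show ?case by (simp add: restricted_partitions_empty)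
next
  case (insert j J)
  obtain s c where j: "j = (s, c)" "1 \<le> s" "c < k" using insert.prems by (cases j) auto
  define a where "a = (\<lambda>n. card (restricted_partitions k (insert j J) n))"
  define b where "b = (\<lambda>n. card (restricted_partitions k J n))"
  have rec: "a n = b n + (if s \<le> n then a (n - s) else 0)" for n
    unfolding a_def b_def j(1) by (rule card_restricted_partitions_insert) (use j insert in auto)
  have rec': "of_nat (a n) * x ^ n = of_nat (b n) * x ^ n + (if s \<le> n then of_nat (a (n - s)) else 0) * x ^ n"
    for n and x :: "'c :: comm_semiring_1"
    by (subst rec) (simp add: distrib_right)
  have b: "summable (\<lambda>n. b n * norm q ^ n)"
    "(\<lambda>n. of_nat (b n) * q ^ n) sums (\<Prod>(s, c)\<in>J. 1 / (1 - q ^ s))"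
    using insert by (auto simp: b_def)
  have qs: "norm q ^ s < 1" using assms j by (simp add: power_less_one_iff)
  have shift: "(\<Sum>n<N. (if s \<le> n then f (n - s) else 0) * x ^ n) = x ^ s * (\<Sum>n<N - s. f n * x ^ n)"
    for N f and x :: "'b :: comm_semiring_1"
  proof -
    have "(\<Sum>n<N. (if s \<le> n then f (n - s) else 0) * x ^ n) = (\<Sum>n\<in>{s..<N}. f (n - s) * x ^ n)"
      by (rule sum.mono_neutral_cong_right) auto
    also have "\<dots> = (\<Sum>n<N - s. f n * x ^ (n + s))"
      by (rule sum.reindex_bij_witness[of _ "\<lambda>n. n + s" "\<lambda>n. n - s"]) auto
    finally show ?thesis by (simp add: sum_distrib_left power_add mult_ac)
  qed
  \<comment> \<open>Convergence must be known before the recursion can be solved for the sum. In the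
    recursion for the partial sums the shifted part is at most \<open>norm q ^ s\<close> times the
    same partial sum, so it can be absorbed on the left.\<close>
  have bound: "(\<Sum>n<N. a n * norm q ^ n) \<le> (\<Sum>n. b n * norm q ^ n) / (1 - norm q ^ s)" for N
  proof -
    have "(\<Sum>n<N. a n * norm q ^ n) =
        (\<Sum>n<N. b n * norm q ^ n) + (\<Sum>n<N. (if s \<le> n then real (a (n - s)) else 0) * norm q ^ n)"
      by (subst rec') (rule sum.distrib)
    also have "(\<Sum>n<N. (if s \<le> n then real (a (n - s)) else 0) * norm q ^ n) =
        norm q ^ s * (\<Sum>n<N - s. a n * norm q ^ n)" by (rule shift)
    also have "\<dots> \<le> norm q ^ s * (\<Sum>n<N. a n * norm q ^ n)"
      by (intro mult_left_mono sum_mono2) auto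
    also have "(\<Sum>n<N. b n * norm q ^ n) \<le> (\<Sum>n. b n * norm q ^ n)"
      by (intro sum_le_suminf b) auto
    finally have "(1 - norm q ^ s) * (\<Sum>n<N. a n * norm q ^ n) \<le> (\<Sum>n. b n * norm q ^ n)"
      by (simp add: algebra_simps)
    then show ?thesis using qs by (simp add: field_simps)
  qed
  have a: "summable (\<lambda>n. a n * norm q ^ n)"
    by (rule summableI_nonneg_bounded[OF _ bound]) simp
  then have "summable (\<lambda>n. norm (of_nat (a n) * q ^ n))" by (simp add: norm_mult norm_power)
  then have "(\<lambda>n. of_nat (a n) * q ^ n) sums (\<Sum>n. of_nat (a n) * q ^ n)" (is "_ sums ?A")
    by (intro summable_sums) (rule summable_norm_cancel)
  note A = this
  have "(\<lambda>n. (if s \<le> n then of_nat (a (n - s)) else 0) * q ^ n) sums (q ^ s * ?A)"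
    unfolding sums_def shift[of "\<lambda>i. of_nat (a i)"]
  proof (rule tendsto_mult_left)
    have "filterlim (\<lambda>N. N - s) sequentially sequentially"
      by (rule filterlim_minus_const_nat_at_top)
    from filterlim_compose[OF A[unfolded sums_def] this]
    show "(\<lambda>N. \<Sum>n<N - s. of_nat (a n) * q ^ n) \<longlonglongrightarrow> ?A" .
  qed
  from sums_add[OF b(2) this]
  have "(\<lambda>n. of_nat (a n) * q ^ n) sums ((\<Prod>(s, c)\<in>J. 1 / (1 - q ^ s)) + q ^ s * ?A)"
    by (subst rec')
  with A have "?A = (\<Prod>(s, c)\<in>J. 1 / (1 - q ^ s)) + q ^ s * ?A" using sums_unique2 by blast
  moreover have "1 - q ^ s \<noteq> 0" using qs by (metis eq_iff_diff_eq_0 norm_one norm_power order_less_irrefl)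
  ultimately have "?A = 1 / (1 - q ^ s) * (\<Prod>(s, c)\<in>J. 1 / (1 - q ^ s))"
    by (simp add: field_simps)
  also have "\<dots> = (\<Prod>(s, c)\<in>insert j J. 1 / (1 - q ^ s))"
    using insert j by simp
  finally show ?case using a A unfolding a_def by simp
qed

lemma restricted_partitions_all:
  assumes "n \<le> N"
  shows "restricted_partitions k ({1..N} \<times> {..<k}) n = colored_partitions k n"
proof -
  have "fst x \<le> n" if "M \<in> colored_partitions k n" "x \<in># M" for M x
    using that unfolding colored_partitions_def case_prod_unfold
    by (auto dest!: multi_member_split)
  note le = this
  have "set_mset M \<subseteq> {1..N} \<times> {..<k}" if M: "M \<in> colored_partitions k n" for M
  proof
    fix x assume x: "x \<in># M"
    then have "1 \<le> fst x" "snd x < k"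
      using M unfolding colored_partitions_def case_prod_unfold by blast+
    then show "x \<in> {1..N} \<times> {..<k}"
      using le[OF M x] assms by (simp add: mem_Times_iff)
  qed
  then show ?thesis unfolding restricted_partitions_def by blast
qed

text \<open>With parts restricted to at most \<open>N\<close>, the counts agree with
  \<open>p_col k n\<close> for \<open>n \<le> N\<close> and never exceed it. The convergent products
  at the real point \<open>norm q\<close> bound the partial sums; the tail of the resulting series
  then dominates the error at complex \<open>q\<close>.\<close>

lemma p_col_sums:
  assumes "norm (q :: complex) < 1"
  shows "summable (\<lambda>n. p_col k n * norm q ^ n)"
    and "(\<lambda>n. of_nat (p_col k n) * q ^ n) sums exp (of_nat k * qlog q q)"
proof -
  define c where "c = (\<lambda>N n. card (restricted_partitions k ({1..N} \<times> {..<k}) n))"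
  have c_le: "c N n \<le> p_col k n" for N n
    unfolding c_def p_col_def by (intro card_mono finite_colored_partitions) (auto simp: restricted_partitions_def)
  have c_eq: "c N n = p_col k n" if "n \<le> N" for N n
    unfolding c_def p_col_def using restricted_partitions_all[OF that] by simp
  have prod_eq: "(\<Prod>(s, c)\<in>{1..N} \<times> {..<k}. 1 / (1 - x ^ s)) = 1 / (\<Prod>n<N. 1 - x * x ^ n) ^ k"
    for N and x :: complex
  proof -
    have "(\<Prod>(s, c)\<in>{1..N} \<times> {..<k}. 1 / (1 - x ^ s)) = (\<Prod>s\<in>{1..N}. (1 / (1 - x ^ s)) ^ k)"
      by (subst prod.cartesian_product[symmetric]) simp
    also have "\<dots> = (\<Prod>n<N. (1 / (1 - x * x ^ n)) ^ k)"
      by (rule prod.reindex_bij_witness[of _ Suc "\<lambda>n. n - 1"]) (auto simp flip: power_Suc)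
    finally show ?thesis by (simp add: prod_dividef power_one_over flip: prod_power_distrib)
  qed
  have c_sums: "summable (\<lambda>n. c N n * norm x ^ n)"
    "(\<lambda>n. of_nat (c N n) * x ^ n) sums (1 / (\<Prod>n<N. 1 - x * x ^ n) ^ k)" if "norm x < 1" for N and x :: complex
  proof -
    have "finite ({1..N} \<times> {..<k})" "{1..N} \<times> {..<k} \<subseteq> {1..} \<times> {..<k}" by auto
    from restricted_partitions_sums[OF this that]
    show "summable (\<lambda>n. c N n * norm x ^ n)"
      "(\<lambda>n. of_nat (c N n) * x ^ n) sums (1 / (\<Prod>n<N. 1 - x * x ^ n) ^ k)"
      unfolding c_def prod_eq by blast+
  qed
  have lim: "(\<lambda>N. 1 / (\<Prod>n<N. 1 - x * x ^ n) ^ k) \<longlonglongrightarrow> exp (of_nat k * qlog x x)"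
    if "norm x < 1" for x :: complex
  proof -
    have "(\<lambda>N. \<Prod>n<N. 1 - x * x ^ n) \<longlonglongrightarrow> exp (- qlog x x)"
      using has_prod_imp_tendsto'[OF has_prod_exp_qlog[OF that that]] .
    then have "(\<lambda>N. 1 / (\<Prod>n<N. 1 - x * x ^ n) ^ k) \<longlonglongrightarrow> 1 / exp (- qlog x x) ^ k"
      by (intro tendsto_intros) auto
    also have "1 / exp (- qlog x x) ^ k = exp (of_nat k * qlog x x)"
      by (simp add: exp_minus exp_of_nat_mult power_one_over inverse_eq_divide)
    finally show ?thesis .
  qed
  define r where "r = complex_of_real (norm q)"
  have r: "norm r < 1" "norm r = norm q" using assms by (simp_all add: r_def)
  obtain K where K: "\<And>N. norm (1 / (\<Prod>n<N. 1 - r * r ^ n) ^ k) \<le> K"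
    using convergentI[OF lim[OF r(1)], THEN convergent_imp_Bseq] unfolding Bseq_def by blast
  have "(\<Sum>n<N. p_col k n * norm q ^ n) \<le> K" for N
  proof -
    have "(\<Sum>n<N. p_col k n * norm q ^ n) = (\<Sum>n<N. c N n * norm q ^ n)" by (simp add: c_eq)
    also have "\<dots> \<le> (\<Sum>n. c N n * norm q ^ n)"
      using c_sums(1)[OF r(1), of N] r by (intro sum_le_suminf) auto
    also have "\<dots> = norm (\<Sum>n. of_nat (c N n) * r ^ n)"
    proof -
      have "(\<Sum>n. of_nat (c N n) * r ^ n) = of_real (\<Sum>n. c N n * norm q ^ n)"
        using c_sums(1)[OF r(1), of N] r by (subst suminf_of_real) (auto simp: r_def)
      then show ?thesis
        using c_sums(1)[OF r(1), of N] r by (simp add: suminf_nonneg)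
    qed
    also have "\<dots> \<le> K" using K[of N] sums_unique[OF c_sums(2)[OF r(1)], of N] by simp
    finally show ?thesis .
  qed
  then show p: "summable (\<lambda>n. p_col k n * norm q ^ n)"
    by (intro summableI_nonneg_bounded) auto
  define S where "S = (\<lambda>N. \<Sum>n<N. of_nat (p_col k n) * q ^ n)"
  have diff: "norm (1 / (\<Prod>n<N. 1 - q * q ^ n) ^ k - S N) \<le>
      (\<Sum>n. p_col k n * norm q ^ n) - (\<Sum>n<N. p_col k n * norm q ^ n)" for N
  proof -
    have "(\<lambda>n. of_nat (c N (n + N)) * q ^ (n + N)) sums (1 / (\<Prod>n<N. 1 - q * q ^ n) ^ k - S N)"
      using sums_split_initial_segment[OF c_sums(2)[OF assms, of N], of N]
      by (simp add: S_def c_eq)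
    moreover have tail: "(\<lambda>n. p_col k (n + N) * norm q ^ (n + N)) sums
        ((\<Sum>n. p_col k n * norm q ^ n) - (\<Sum>n<N. p_col k n * norm q ^ n))"
      using sums_split_initial_segment[OF summable_sums[OF p], of N] .
    moreover have "norm (of_nat (c N (n + N)) * q ^ (n + N)) \<le> p_col k (n + N) * norm q ^ (n + N)" for n
      using c_le[of N "n + N"] by (simp add: norm_mult norm_power mult_right_mono)
    ultimately show ?thesis
      using norm_suminf_le[of "\<lambda>n. of_nat (c N (n + N)) * q ^ (n + N)" "\<lambda>n. p_col k (n + N) * norm q ^ (n + N)"]
      by (simp only: sums_iff)
  qed
  have "(\<lambda>N. (\<Sum>n. p_col k n * norm q ^ n) - (\<Sum>n<N. p_col k n * norm q ^ n)) \<longlonglongrightarrow>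
      (\<Sum>n. p_col k n * norm q ^ n) - (\<Sum>n. p_col k n * norm q ^ n)"
    by (intro tendsto_intros summable_LIMSEQ p)
  then have "(\<lambda>N. 1 / (\<Prod>n<N. 1 - q * q ^ n) ^ k - S N) \<longlonglongrightarrow> 0"
    by (intro Lim_null_comparison[OF always_eventually[OF allI[OF diff]]]) simp
  from tendsto_diff[OF lim[OF assms] this] have "S \<longlonglongrightarrow> exp (of_nat k * qlog q q)" by simp
  then show "(\<lambda>n. of_nat (p_col k n) * q ^ n) sums exp (of_nat k * qlog q q)"
    by (simp add: sums_def S_def)
qed

section \<open>The coefficients of the expansion\<close>

definition A_exp :: "nat \<Rightarrow> nat \<Rightarrow> nat" where
  "A_exp m r = Suc r * (Suc r + m)"

text \<open>\<open>A_ser m\<close> as an ordinary power series in \<open>q\<close>, the form needed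
  for a Cauchy product with the series of \<open>p_col k\<close>. The exponents are strictly
  increasing in the index, so \<open>inv\<close> recovers the index.\<close>

definition A_coeff :: "nat \<Rightarrow> nat \<Rightarrow> nat" where
  "A_coeff m j = (if j \<in> range (A_exp m) then m + 2 * Suc (inv (A_exp m) j) else 0)"

lemma strict_mono_A_exp: "strict_mono (A_exp m)"
  unfolding A_exp_def by (rule strict_mono_Suc_iff[THEN iffD2]) (simp add: algebra_simps)

lemma A_coeff_A_exp: "A_coeff m (A_exp m r) = m + 2 * Suc r"
  using strict_mono_imp_inj_on[OF strict_mono_A_exp] by (simp add: A_coeff_def inv_f_f)

lemma A_coeff_eq_0: "j \<le> m \<Longrightarrow> A_coeff m j = 0"
  by (auto simp: A_coeff_def A_exp_def)

lemma A_coeff_sums: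
  fixes q :: complex
  assumes "norm q < 1"
  shows "summable (\<lambda>j. norm (of_nat (A_coeff m j) * q ^ j))"
    and "(\<lambda>j. of_nat (A_coeff m j) * q ^ j) sums A_ser m q"
proof -
  show "(\<lambda>j. of_nat (A_coeff m j) * q ^ j) sums A_ser m q"
  proof (subst sums_mono_reindex[OF strict_mono_A_exp[of m], symmetric])
    show "(\<lambda>r. of_nat (A_coeff m (A_exp m r)) * q ^ A_exp m r) sums A_ser m q"
      unfolding A_coeff_A_exp using A_ser_sums[OF assms, of m] by (simp only: A_exp_def)
  qed (simp add: A_coeff_def)
  have "(\<lambda>r. norm (of_nat (A_coeff m (A_exp m r)) * q ^ A_exp m r)) sums
      (\<Sum>r. norm (of_nat (m + 2 * Suc r) * q ^ (Suc r * (Suc r + m))))"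
    unfolding A_coeff_A_exp using A_ser_abs_summable[OF assms, of m] by (simp only: A_exp_def summable_sums)
  then show "summable (\<lambda>j. norm (of_nat (A_coeff m j) * q ^ j))"
    by (subst (asm) sums_mono_reindex[OF strict_mono_A_exp]) (auto simp: A_coeff_def sums_iff)
qed

definition s_coeff :: "nat \<Rightarrow> nat \<Rightarrow> nat \<Rightarrow> nat" where
  "s_coeff k m n = (\<Sum>i\<le>n. A_coeff m i * p_col k (n - i))"

text \<open>\<open>A_ser m q\<close> begins with the power \<open>m + 1\<close> of \<open>q\<close>.
  This is what makes every coefficient of the expansion a Laurent polynomial in \<zeta>.\<close>

lemma s_coeff_eq_0: "n \<le> m \<Longrightarrow> s_coeff k m n = 0"
  by (simp add: s_coeff_def A_coeff_eq_0)

lemma s_coeff_sums: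
  fixes q :: complex
  assumes q: "norm q < 1"
  shows "(\<lambda>n. of_nat (s_coeff k m n) * q ^ n) sums (A_ser m q * exp (of_nat k * qlog q q))"
    and "summable (\<lambda>n. norm (of_nat (s_coeff k m n) * q ^ n))"
proof -
  have *: "(\<Sum>i\<le>n. (of_nat (A_coeff m i) * x ^ i) * (of_nat (p_col k (n - i)) * x ^ (n - i))) =
      of_nat (s_coeff k m n) * x ^ n" for n and x :: "'b :: comm_semiring_1"
  proof -
    have "(of_nat (A_coeff m i) * x ^ i) * (of_nat (p_col k (n - i)) * x ^ (n - i)) =
        of_nat (A_coeff m i * p_col k (n - i)) * x ^ n" if "i \<le> n" for i
    proof -
      have "x ^ n = x ^ i * x ^ (n - i)" using that by (simp flip: power_add)
      then show ?thesis unfolding of_nat_mult by (simp only: mult_ac)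
    qed
    then show ?thesis by (simp add: s_coeff_def sum_distrib_right)
  qed
  have p: "summable (\<lambda>n. norm (of_nat (p_col k n) * q ^ n))"
    using p_col_sums(1)[OF q] by (simp add: norm_mult norm_power)
  from Cauchy_product_sums[OF A_coeff_sums(1)[OF q, of m] p]
  show "(\<lambda>n. of_nat (s_coeff k m n) * q ^ n) sums (A_ser m q * exp (of_nat k * qlog q q))"
    unfolding * using A_coeff_sums(2)[OF q, of m] p_col_sums(2)[OF q, of k] by (simp add: sums_iff)
  have "summable (\<lambda>j. norm (real (A_coeff m j) * norm q ^ j))" "summable (\<lambda>j. norm (real (p_col k j) * norm q ^ j))"
    using A_coeff_sums(1)[OF q, of m] p by (simp_all add: norm_mult norm_power)
  from summable_Cauchy_product[OF this] show "summable (\<lambda>n. norm (of_nat (s_coeff k m n) * q ^ n))"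
    unfolding * by (simp add: norm_mult norm_power)
qed

text \<open>Multiplication by z - 2 + 1/z becomes a second difference in \<open>m\<close>, and the 1
  in front of it contributes the partition count at \<open>m = 0\<close>. The absolute values
  reflect the symmetry of \<open>S_fun\<close> under inversion.\<close>

definition f_coeff :: "nat \<Rightarrow> int \<Rightarrow> nat \<Rightarrow> real" where
  "f_coeff k m n = (if m = 0 then real (p_col k n) else 0) + real (s_coeff k (nat \<bar>m - 1\<bar>) n)
     - 2 * real (s_coeff k (nat \<bar>m\<bar>) n) + real (s_coeff k (nat \<bar>m + 1\<bar>) n)"

lemma finite_f_coeff: "finite {m. f_coeff k m n \<noteq> 0}"
proof (rule finite_subset)
  show "{m. f_coeff k m n \<noteq> 0} \<subseteq> {- int n - 1..int n + 1}"
  proof (rule ccontr)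
    assume "\<not> ?thesis"
    then obtain m where m: "f_coeff k m n \<noteq> 0" "\<bar>m\<bar> > int n + 1" by fastforce
    then have "n \<le> nat \<bar>m - 1\<bar>" "n \<le> nat \<bar>m\<bar>" "n \<le> nat \<bar>m + 1\<bar>" "m \<noteq> 0" by linarith+
    with m show False by (simp add: f_coeff_def s_coeff_eq_0)
  qed
qed simp

definition T_coeff :: "nat \<Rightarrow> complex \<Rightarrow> nat \<Rightarrow> complex" where
  "T_coeff k z n = (\<Sum>m\<in>{- int n..int n}. of_nat (s_coeff k (nat \<bar>m\<bar>) n) * z powi m)"

lemma T_coeff_has_sum:
  "((\<lambda>m. of_nat (s_coeff k (nat \<bar>m\<bar>) n) * z powi m) has_sum T_coeff k z n) UNIV"
  unfolding T_coeff_def by (rule has_sum_finite_neutralI) (auto simp: s_coeff_eq_0)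

lemma f_coeff_sum:
  assumes "z \<noteq> 0"
  shows "(\<Sum>m | f_coeff k m n \<noteq> 0. of_real (f_coeff k m n) * z powi m) =
    of_nat (p_col k n) + (1 - z)^2 / z * T_coeff k z n"
proof -
  let ?s = "\<lambda>m. of_nat (s_coeff k (nat \<bar>m\<bar>) n) * z powi m"
  have shift: "((\<lambda>m. of_nat (s_coeff k (nat \<bar>m + d\<bar>) n) * z powi m) has_sum (z powi (- d) * T_coeff k z n)) UNIV" for d
  proof -
    have "((\<lambda>m. z powi (- d) * ?s (m + d)) has_sum (z powi (- d) * T_coeff k z n)) UNIV"
      by (intro has_sum_cmult_right, subst has_sum_reindex_bij_betw[of "\<lambda>m. m + d" UNIV UNIV])
         (auto intro!: bij_betwI[of _ _ _ "\<lambda>m. m - d"] T_coeff_has_sum)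
    moreover have "z powi (- d) * ?s (m + d) = of_nat (s_coeff k (nat \<bar>m + d\<bar>) n) * z powi m" for m
      using power_int_add[of z "- d" "m + d"] assms by (simp add: mult_ac)
    ultimately show ?thesis by simp
  qed
  have p: "((\<lambda>m. (if m = 0 then of_nat (p_col k n) else 0) * z powi m) has_sum of_nat (p_col k n)) UNIV"
    by (rule has_sum_finite_neutralI[of "{0}"]) auto
  have "((\<lambda>m. (if m = 0 then of_nat (p_col k n) else 0) * z powi m
        + (of_nat (s_coeff k (nat \<bar>m + -1\<bar>) n) * z powi m + (-2) * (of_nat (s_coeff k (nat \<bar>m + 0\<bar>) n) * z powi m)
        + of_nat (s_coeff k (nat \<bar>m + 1\<bar>) n) * z powi m))
     has_sum (of_nat (p_col k n) + (z powi (- (-1)) * T_coeff k z n + (-2) * (z powi (- 0) * T_coeff k z n)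
        + z powi (- 1) * T_coeff k z n))) UNIV"
    by (intro has_sum_add has_sum_cmult_right shift p)
  also have "(\<lambda>m. (if m = 0 then of_nat (p_col k n) else 0) * z powi m
        + (of_nat (s_coeff k (nat \<bar>m + -1\<bar>) n) * z powi m + (-2) * (of_nat (s_coeff k (nat \<bar>m + 0\<bar>) n) * z powi m)
        + of_nat (s_coeff k (nat \<bar>m + 1\<bar>) n) * z powi m)) = (\<lambda>m. of_real (f_coeff k m n) * z powi m)"
    by (rule ext) (simp add: f_coeff_def algebra_simps)
  also have "of_nat (p_col k n) + (z powi (- (-1)) * T_coeff k z n + (-2) * (z powi (- 0) * T_coeff k z n)
        + z powi (- 1) * T_coeff k z n) = of_nat (p_col k n) + (1 - z)^2 / z * T_coeff k z n"
    using assms by (simp add: field_simps power2_eq_square)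
  finally have "((\<lambda>m. of_real (f_coeff k m n) * z powi m) has_sum
      (of_nat (p_col k n) + (1 - z)^2 / z * T_coeff k z n)) UNIV" .
  moreover have "((\<lambda>m. of_real (f_coeff k m n) * z powi m) has_sum
      (\<Sum>m | f_coeff k m n \<noteq> 0. of_real (f_coeff k m n) * z powi m)) UNIV"
    by (rule has_sum_finite_neutralI[OF finite_f_coeff]) auto
  ultimately show ?thesis using has_sum_unique by blast
qed

text \<open>One double series over \<open>m\<close> and \<open>n\<close>: summing over
  \<open>n\<close> inside gives the Laurent series of \<open>S_fun\<close>, summing over
  \<open>m\<close> inside gives the power series in \<open>q\<close>.\<close>

lemma T_coeff_sums:
  assumes q: "norm q < 1" and z: "norm q < norm z" "norm (q * z) < 1"
  shows "(\<lambda>n. T_coeff k z n * q ^ n) sums (S_fun q z * exp (of_nat k * qlog q q))"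
proof -
  define g where "g = (\<lambda>(m, n). of_nat (s_coeff k (nat \<bar>m\<bar>) n) * z powi m * q ^ n)"
  define E where "E = exp (of_nat k * qlog q q)"
  define r where "r = complex_of_real (norm q)"
  define \<rho> where "\<rho> = complex_of_real (norm z)"
  have r: "norm r < 1" "norm r = norm q" "norm \<rho> = norm z" using q by (auto simp: r_def \<rho>_def)
  have inner: "((\<lambda>n. g (m, n)) has_sum (A_ser (nat \<bar>m\<bar>) q * z powi m * E)) UNIV" for m
  proof -
    have "((\<lambda>n. z powi m * (of_nat (s_coeff k (nat \<bar>m\<bar>) n) * q ^ n)) has_sum (z powi m * (A_ser (nat \<bar>m\<bar>) q * E))) UNIV"
      unfolding E_def using s_coeff_sums[OF q, of k "nat \<bar>m\<bar>"]
      by (intro has_sum_cmult_right norm_summable_imp_has_sum)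
    then show ?thesis by (simp add: g_def mult_ac)
  qed
  have outer: "((\<lambda>m. A_ser (nat \<bar>m\<bar>) q * z powi m * E) has_sum (S_fun q z * E)) UNIV"
    by (intro has_sum_cmult_left S_fun_has_sum q z)
  have "(\<lambda>p. norm (g p)) summable_on Sigma UNIV (\<lambda>_. UNIV)"
  proof (rule summable_on_SigmaI)
    fix m :: int
    show "((\<lambda>n. norm (g (m, n))) has_sum (\<Sum>n. norm (g (m, n)))) UNIV"
    proof (rule norm_summable_imp_has_sum)
      have "summable (\<lambda>n. norm z powi m * norm (of_nat (s_coeff k (nat \<bar>m\<bar>) n) * q ^ n))"
        by (intro summable_mult s_coeff_sums q)
      then show "summable (\<lambda>n. norm (norm (g (m, n))))"
        by (simp add: g_def norm_mult norm_power norm_power_int mult_ac)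
      then show "(\<lambda>n. norm (g (m, n))) sums (\<Sum>n. norm (g (m, n)))"
        by (simp add: summable_sums)
    qed
  next
    \<comment> \<open>All \<open>s_coeff\<close> are nonnegative, so the sum of the norms over
      \<open>n\<close> is the same closed form at the real points \<open>norm q\<close> and
      \<open>norm z\<close>; absolute summability over \<open>m\<close> is then that of the Laurent
      series there.\<close>
    have eq: "(\<Sum>n. norm (g (m, n))) = norm (A_ser (nat \<bar>m\<bar>) r * \<rho> powi m) * norm (exp (of_nat k * qlog r r))" for m
    proof -
      have "(\<lambda>n. of_nat (s_coeff k (nat \<bar>m\<bar>) n) * r ^ n) sums (A_ser (nat \<bar>m\<bar>) r * exp (of_nat k * qlog r r))"
        by (rule s_coeff_sums[OF r(1)])
      then have "(\<lambda>n. complex_of_real (norm (g (m, n)))) sums (\<rho> powi m * (A_ser (nat \<bar>m\<bar>) r * exp (of_nat k * qlog r r)))"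
        using sums_mult[of _ _ "\<rho> powi m"] by (fastforce simp: g_def norm_mult norm_power norm_power_int r_def \<rho>_def mult_ac)
      note 1 = this
      then have eq: "complex_of_real (\<Sum>n. norm (g (m, n))) = \<rho> powi m * (A_ser (nat \<bar>m\<bar>) r * exp (of_nat k * qlog r r))"
        unfolding suminf_of_real[OF summable_of_real_iff[THEN iffD1, OF sums_summable[OF 1]]]
        by (rule sums_unique[symmetric])
      have "(\<Sum>n. norm (g (m, n))) \<ge> 0"
        using \<open>(\<lambda>n. complex_of_real (norm (g (m, n)))) sums _\<close>
        by (intro suminf_nonneg) (auto simp: sums_iff summable_of_real_iff)
      then have "(\<Sum>n. norm (g (m, n))) = norm (complex_of_real (\<Sum>n. norm (g (m, n))))" by simp
      then show ?thesis unfolding eq by (simp add: norm_mult mult_ac)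
    qed
    have "(\<lambda>m. norm (A_ser (nat \<bar>m\<bar>) r * \<rho> powi m)) summable_on UNIV"
      by (rule S_fun_has_sum(2)) (use z r in \<open>auto simp: norm_mult\<close>)
    then show "(\<lambda>m. \<Sum>n. norm (g (m, n))) summable_on UNIV"
      unfolding eq by (rule summable_on_cmult_left)
  qed auto
  then have "g summable_on (UNIV \<times> UNIV)" by (rule abs_summable_summable)
  from has_sum_SigmaI[OF inner outer this] have "(g has_sum (S_fun q z * E)) (UNIV \<times> UNIV)" by simp
  then have "((\<lambda>(n, m). g (m, n)) has_sum (S_fun q z * E)) (UNIV \<times> UNIV)"
    by (subst (asm) has_sum_swap)
  then have "((\<lambda>n. T_coeff k z n * q ^ n) has_sum (S_fun q z * E)) UNIV"
  proof (rule has_sum_SigmaD)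
    fix n :: nat
    show "((\<lambda>m. case (n, m) of (n, m) \<Rightarrow> g (m, n)) has_sum (T_coeff k z n * q ^ n)) UNIV"
      using has_sum_cmult_left[OF T_coeff_has_sum] by (simp add: g_def)
  qed
  then show ?thesis unfolding E_def by (rule has_sum_imp_sums)
qed

lemma is_f_expansion_f_coeff: "is_f_expansion k (f_coeff k)"
  unfolding is_f_expansion_def
proof (intro conjI allI impI finite_f_coeff)
  fix w \<tau> assume \<tau>: "Im \<tau> > 0" "\<bar>Im w\<bar> < Im \<tau>"
  define q where "q = e2pi \<tau>"
  define z where "z = e2pi w"
  define E where "E = exp (of_nat k * qlog q q)"
  define Q where "Q = e2pi (- of_nat k / 24 * \<tau>)"
  have q: "norm q < 1" using \<tau> by (simp add: q_def norm_e2pi)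
  have nz: "z \<noteq> 0" by (simp add: z_def e2pi_def)
  have z: "norm q < norm z" "norm (q * z) < 1"
  proof -
    have "pi * Im w < pi * Im \<tau>" "- (pi * Im w) < pi * Im \<tau>"
      using \<tau> mult_strict_left_mono[of "Im w" "Im \<tau>" pi] mult_strict_left_mono[of "- Im w" "Im \<tau>" pi]
      by simp_all
    then show "norm q < norm z" "norm (q * z) < 1"
      unfolding q_def z_def e2pi_add[symmetric] norm_e2pi by (simp_all add: distrib_left)
  qed
  have zpow: "e2pi (of_int m * w) = z powi m" for m
    unfolding z_def e2pi_def by (simp add: exp_power_int mult_ac)
  have qpow: "e2pi ((of_nat n - of_nat k / 24) * \<tau>) = Q * q ^ n" for n
  proof -
    have "q ^ n = e2pi (of_nat n * \<tau>)"
      unfolding q_def e2pi_def by (simp add: mult_ac flip: exp_of_nat_mult)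
    then show ?thesis unfolding Q_def by (simp add: ring_distribs flip: e2pi_add)
  qed
  have "(\<lambda>n. Q * (of_nat (p_col k n) * q ^ n + (1 - z)^2 / z * (T_coeff k z n * q ^ n))) sums
     (Q * (E + (1 - z)^2 / z * (S_fun q z * E)))"
    unfolding E_def by (intro sums_mult sums_add p_col_sums T_coeff_sums q z)
  also have "Q * (E + (1 - z)^2 / z * (S_fun q z * E)) = f_fun k w \<tau>"
  proof -
    have "dedekind_eta \<tau> = e2pi (\<tau> / 24) * exp (- qlog q q)"
      using has_prod_exp_qlog[OF q q] by (simp add: dedekind_eta_def q_def[symmetric] has_prod_unique[symmetric])
    then have "dedekind_eta \<tau> ^ k * (Q * E) = e2pi (\<tau> / 24) ^ k * Q * (exp (- qlog q q) ^ k * E)"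
      by (simp add: power_mult_distrib mult_ac)
    also have "e2pi (\<tau> / 24) ^ k * Q = 1"
      unfolding Q_def e2pi_def by (simp add: field_simps flip: exp_of_nat_mult exp_add)
    also have "exp (- qlog q q) ^ k * E = 1"
      unfolding E_def by (simp flip: exp_of_nat_mult exp_add)
    finally have 1: "dedekind_eta \<tau> ^ k * (Q * E) = 1" by simp
    then have "dedekind_eta \<tau> ^ k \<noteq> 0" by (metis mult_zero_left zero_neq_one)
    then have "Q * E = 1 / dedekind_eta \<tau> ^ k" using 1 by (simp add: eq_divide_eq mult.commute)
    moreover have "Q * (E + (1 - z)^2 / z * (S_fun q z * E)) = (1 + (1 - z)^2 / z * S_fun q z) * (Q * E)"
      by (simp add: algebra_simps)
    ultimately show ?thesis
      unfolding f_fun_def g_fun_eq_S_fun[OF \<tau>] q_def[symmetric] z_def[symmetric] by simp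
  qed
  also have "(\<lambda>n. Q * (of_nat (p_col k n) * q ^ n + (1 - z)^2 / z * (T_coeff k z n * q ^ n))) =
      (\<lambda>n. (\<Sum>m | f_coeff k m n \<noteq> 0. of_real (f_coeff k m n) * e2pi (of_int m * w)) *
              e2pi ((of_nat n - of_nat k / 24) * \<tau>))"
    unfolding zpow qpow f_coeff_sum[OF nz] by (rule ext) (simp add: algebra_simps)
  finally show "(\<lambda>n. (\<Sum>m | f_coeff k m n \<noteq> 0. of_real (f_coeff k m n) * e2pi (of_int m * w)) *
              e2pi ((of_nat n - of_nat k / 24) * \<tau>)) sums f_fun k w \<tau>" .
qed

section \<open>Uniqueness of the expansion\<close>

lemma powser_eq_0_imp_coeffs_eq_0:
  fixes d :: "nat \<Rightarrow> complex"
  assumes "\<And>q. q \<noteq> 0 \<Longrightarrow> norm q < 1 \<Longrightarrow> (\<lambda>n. d n * q ^ n) sums 0"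
  shows "d n = 0"
proof (rule ccontr)
  assume "d n \<noteq> 0"
  \<comment> \<open>The hypothesis says nothing at \<open>q = 0\<close>. Multiplying the series by
    \<open>q\<close> makes it sum to 0 there too, and it moves \<open>d 0\<close> to a positive
    index, as \<open>powser_0_nonzero\<close> requires.\<close>
  define a where "a = (\<lambda>n. case n of 0 \<Rightarrow> 0 | Suc n \<Rightarrow> d n)"
  have "(\<lambda>n. a n * (q - 0) ^ n) sums 0" if q: "norm (q - 0) < 1" for q
  proof -
    have "(\<lambda>n. q * (d n * q ^ n)) sums (q * 0)"
    proof (cases "q = 0")
      case False
      then show ?thesis using assms q by (intro sums_mult) auto
    qed simp
    then have "(\<lambda>n. a (Suc n) * q ^ Suc n) sums 0" by (simp add: a_def mult_ac)
    then show ?thesis by (subst (asm) sums_Suc_iff) (simp add: a_def)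
  qed
  then obtain s :: real where "0 < s" "\<And>z :: complex. z \<in> cball 0 s - {0} \<Longrightarrow> (0 :: complex) \<noteq> 0"
    using powser_0_nonzero[of 1 0 a "\<lambda>_. 0" "Suc n"] \<open>d n \<noteq> 0\<close>
    by (metis a_def nat.simps(5) zero_less_Suc zero_less_one)
  moreover from \<open>0 < s\<close> have "complex_of_real s \<in> cball 0 s - {0}" by simp
  ultimately show False by blast
qed

lemma Laurent_polynomial_eq_0:
  fixes d :: "int \<Rightarrow> complex"
  assumes "finite M" "m \<in> M" and 0: "\<And>z. norm z = 1 \<Longrightarrow> (\<Sum>m\<in>M. d m * z powi m) = 0"
  shows "d m = 0"
proof -
  \<comment> \<open>A common bound for the exponents in absolute value; multiplication by
    \<open>z powi N\<close> produces a polynomial, which has infinitely many roots on the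
    circle.\<close>
  define N where "N = (\<Sum>m\<in>M. \<bar>m\<bar>)"
  have N: "\<bar>j\<bar> \<le> N" if "j \<in> M" for j
    unfolding N_def using member_le_sum[of j M "\<lambda>m. \<bar>m\<bar>"] assms(1) that by auto
  define p where "p = (\<Sum>j\<in>M. monom (d j) (nat (j + N)))"
  have "poly p z = 0" if z: "norm z = 1" for z
  proof -
    have "z \<noteq> 0" using z by auto
    have "poly p z = (\<Sum>j\<in>M. z powi N * (d j * z powi j))"
      unfolding p_def poly_sum
    proof (rule sum.cong)
      fix j assume "j \<in> M"
      then have "z ^ nat (j + N) = z powi (j + N)" using N[of j] by (simp add: power_int_def)
      then show "poly (monom (d j) (nat (j + N))) z = z powi N * (d j * z powi j)"
        using \<open>z \<noteq> 0\<close> by (simp add: poly_monom power_int_add)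
    qed simp
    then show ?thesis using 0[OF z] by (simp flip: sum_distrib_left)
  qed
  then have "sphere 0 1 \<subseteq> {z. poly p z = 0}" by auto
  moreover have "infinite (sphere (0::complex) 1)"
  proof -
    have "uncountable (sphere (0::complex) 1)"
      by (rule connected_uncountable[of _ 1 "-1"]) (auto intro: connected_sphere)
    then show ?thesis using countable_finite by blast
  qed
  ultimately have "p = 0" using poly_roots_finite finite_subset by blast
  then have "0 = coeff p (nat (m + N))" by simp
  also have "\<dots> = (\<Sum>j\<in>M. if j = m then d j else 0)"
    unfolding p_def coeff_sum
  proof (rule sum.cong)
    fix j assume "j \<in> M"
    with N[of j] N[of m] assms(2) have "nat (j + N) = nat (m + N) \<longleftrightarrow> j = m" by auto
    then show "coeff (monom (d j) (nat (j + N))) (nat (m + N)) = (if j = m then d j else 0)"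
      by simp
  qed simp
  finally show ?thesis using assms by simp
qed

lemma is_f_expansion_unique:
  assumes a: "is_f_expansion k a" and b: "is_f_expansion k b"
  shows "a = b"
proof (intro ext)
  fix m n
  define L where "L = (\<lambda>(a :: int \<Rightarrow> nat \<Rightarrow> real) z n. \<Sum>m | a m n \<noteq> 0. complex_of_real (a m n) * z powi m)"
  have fin: "finite {m. a m n \<noteq> 0}" "finite {m. b m n \<noteq> 0}" for n
    using a b by (auto simp: is_f_expansion_def)
  have eq: "L a z n - L b z n = 0" if z: "norm z = 1" for z n
  proof (rule powser_eq_0_imp_coeffs_eq_0)
    fix q :: complex assume q: "q \<noteq> 0" "norm q < 1"
    define \<tau> where "\<tau> = Ln q / (2 * of_real pi * \<i>)"
    \<comment> \<open>\<open>w\<close> is real, so the condition on \<open>Im w\<close> holds for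
      every \<tau> in the upper half-plane, and \<open>q\<close> may range over the whole punctured
      disc.\<close>
    define w where "w = complex_of_real (Arg z / (2 * pi))"
    have q_eq: "e2pi \<tau> = q" using q by (simp add: e2pi_def \<tau>_def)
    then have "exp (- 2 * pi * Im \<tau>) < 1" using norm_e2pi[of \<tau>] q by simp
    then have Im: "Im \<tau> > 0" by (simp add: zero_less_mult_iff)
    have z_eq: "e2pi w = z"
      using z cis_Arg[of z] by (cases "z = 0") (auto simp: e2pi_def w_def cis_conv_exp sgn_div_norm mult_ac)
    have zpow: "e2pi (of_int m * w) = z powi m" for m
      unfolding z_eq[symmetric] e2pi_def by (simp add: exp_power_int mult_ac)
    have qpow: "e2pi ((of_nat n - of_nat k / 24) * \<tau>) * e2pi (of_nat k / 24 * \<tau>) = q ^ n" for n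
      unfolding q_eq[symmetric] by (simp add: e2pi_def algebra_simps flip: exp_of_nat_mult exp_add)
    have s: "(\<lambda>n. L c z n * q ^ n) sums (f_fun k w \<tau> * e2pi (of_nat k / 24 * \<tau>))"
      if "is_f_expansion k c" for c
    proof -
      have "(\<lambda>n. L c z n * e2pi ((of_nat n - of_nat k / 24) * \<tau>)) sums f_fun k w \<tau>"
      proof -
        have "\<bar>Im w\<bar> < Im \<tau>" using Im by (simp add: w_def)
        then show ?thesis using that Im unfolding is_f_expansion_def L_def zpow[symmetric] by blast
      qed
      from sums_mult2[OF this, of "e2pi (of_nat k / 24 * \<tau>)"] show ?thesis
        unfolding mult.assoc qpow .
    qed
    from sums_diff[OF s[OF a] s[OF b]]
    show "(\<lambda>n. (L a z n - L b z n) * q ^ n) sums 0" by (simp add: algebra_simps)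
  qed
  define M where "M = insert m ({m. a m n \<noteq> 0} \<union> {m. b m n \<noteq> 0})"
  have M: "finite M" "m \<in> M" using fin by (auto simp: M_def)
  have "complex_of_real (a m n - b m n) = 0"
  proof (rule Laurent_polynomial_eq_0[OF M])
    fix z :: complex assume z: "norm z = 1"
    have "L a z n = (\<Sum>m\<in>M. complex_of_real (a m n) * z powi m)"
      "L b z n = (\<Sum>m\<in>M. complex_of_real (b m n) * z powi m)"
      unfolding L_def by (rule sum.mono_neutral_left; use M in \<open>auto simp: M_def\<close>)+
    then show "(\<Sum>m\<in>M. complex_of_real (a m n - b m n) * z powi m) = 0"
      using eq[OF z, of n] by (simp add: algebra_simps sum_subtractf)
  qed
  then show "a m n = b m n" by simp
qed

lemma a_coeff_eq: "a_coeff k = f_coeff k"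
  unfolding a_coeff_def using is_f_expansion_f_coeff is_f_expansion_unique by blast

lemma f_coeff_minus: "f_coeff k (- m) n = f_coeff k m n"
proof -
  have "\<bar>- m - 1\<bar> = \<bar>m + 1\<bar>" "\<bar>- m + 1\<bar> = \<bar>m - 1\<bar>" by auto
  then show ?thesis by (simp add: f_coeff_def)
qed

lemma f_coeff_sums:
  fixes q :: complex
  assumes q: "norm q < 1" and m: "m \<ge> 1"
  shows "(\<lambda>n. of_real (f_coeff k (int m) n) * q ^ n) sums (C_ser m q * exp (of_nat k * qlog q q))"
    and "summable (\<lambda>n. norm (of_real (f_coeff k (int m) n) * q ^ n))"
proof -
  have eq: "f_coeff k (int m) n = real (s_coeff k (m - 1) n) - 2 * real (s_coeff k m n) + real (s_coeff k (m + 1) n)" for n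
  proof -
    have "nat \<bar>int m - 1\<bar> = m - 1" "nat \<bar>int m\<bar> = m" "nat \<bar>int m + 1\<bar> = m + 1" using m by auto
    then show ?thesis unfolding f_coeff_def using m by simp
  qed
  let ?s = "\<lambda>m n. of_nat (s_coeff k m n) * q ^ n"
  have eq2: "of_real (f_coeff k (int m) n) * q ^ n = ?s (m - 1) n - 2 * ?s m n + ?s (m + 1) n" for n
    unfolding eq by (simp add: algebra_simps)
  show "(\<lambda>n. of_real (f_coeff k (int m) n) * q ^ n) sums (C_ser m q * exp (of_nat k * qlog q q))"
    unfolding eq2 C_ser_def ring_distribs mult.assoc left_diff_distrib
    by (intro sums_add sums_diff sums_mult s_coeff_sums q)
  have "summable (\<lambda>n. norm (?s (m - 1) n) + 2 * norm (?s m n) + norm (?s (m + 1) n))"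
    by (intro summable_add summable_mult s_coeff_sums q)
  then show "summable (\<lambda>n. norm (of_real (f_coeff k (int m) n) * q ^ n))"
  proof (rule summable_comparison_test')
    fix n
    have "norm (?s (m - 1) n - 2 * ?s m n + ?s (m + 1) n) \<le> norm (?s (m - 1) n) + norm (2 * ?s m n) + norm (?s (m + 1) n)"
      by (rule norm_triangle_le[OF add_right_mono[OF norm_triangle_ineq4]])
    then show "norm (norm (of_real (f_coeff k (int m) n) * q ^ n)) \<le>
        norm (?s (m - 1) n) + 2 * norm (?s m n) + norm (?s (m + 1) n)"
      unfolding eq2 by (simp add: norm_mult)
  qed
qed

section \<open>Euler--Maclaurin summation of Gaussian sums\<close>

lemma Taylor_on_unit_interval:
  fixes D :: "nat \<Rightarrow> complex \<Rightarrow> complex"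
  assumes D: "\<And>i x. i \<le> n \<Longrightarrow> (D i has_field_derivative D (Suc i) x) (at x)"
    and B: "\<And>x. a \<le> x \<Longrightarrow> x \<le> a + 1 \<Longrightarrow> norm (D (Suc n) (of_real x)) \<le> B"
  shows "norm (D 0 (of_real a + 1) - (\<Sum>i\<le>n. D i (of_real a) / fact i)) \<le> B / fact n"
    and "norm (D 0 (of_real a) - (\<Sum>i\<le>n. D i (of_real a + 1) * (-1) ^ i / fact i)) \<le> B / fact n"
proof -
  let ?S = "complex_of_real ` {a..a + 1}"
  have S: "?S = closed_segment (of_real a) (of_real (a + 1))"
    unfolding closed_segment_of_real by (simp add: closed_segment_eq_real_ivl)
  have c: "convex ?S" unfolding S by simp
  have D': "(D i has_field_derivative D (Suc i) x) (at x within ?S)" if "i \<le> n" for i x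
    using D[OF that] has_field_derivative_at_within by blast
  have B': "norm (D (Suc n) x) \<le> B" if "x \<in> ?S" for x using that B by auto
  have mem: "of_real a \<in> ?S" "of_real a + 1 \<in> ?S"
    by (auto simp: image_iff intro!: bexI[of _ "a + 1"])
  show "norm (D 0 (of_real a + 1) - (\<Sum>i\<le>n. D i (of_real a) / fact i)) \<le> B / fact n"
    using complex_Taylor[of ?S n D B, OF c D' B' mem(1) mem(2)] by simp
  show "norm (D 0 (of_real a) - (\<Sum>i\<le>n. D i (of_real a + 1) * (-1) ^ i / fact i)) \<le> B / fact n"
    using complex_Taylor[of ?S n D B, OF c D' B' mem(2) mem(1)] by simp
qed

text \<open>The values of \<open>F'\<close> at the positive integers are compared with the
  increments of \<open>F\<close>, whose total is 0 because \<open>F\<close> vanishes at 0 and along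
  the integers at infinity. Taylor expansion at the right end of each unit interval leaves only
  \<open>F''\<close>. This first-order rule is enough where \<open>F''\<close> is already
  small.\<close>

lemma norm_sum_deriv_le:
  fixes F F' F'' :: "complex \<Rightarrow> complex"
  assumes D: "\<And>x. (F has_field_derivative F' x) (at x)" "\<And>x. (F' has_field_derivative F'' x) (at x)"
    and B: "\<And>r x. real r \<le> x \<Longrightarrow> x \<le> real r + 1 \<Longrightarrow> norm (F'' (of_real x)) \<le> B r"
    and sB: "summable B" and lim: "(\<lambda>r. F (of_nat r)) \<longlonglongrightarrow> 0" and F0: "F 0 = 0"
  shows "summable (\<lambda>r. F' (of_nat (Suc r)))" "norm (\<Sum>r. F' (of_nat (Suc r))) \<le> suminf B"
proof -
  define e where "e = (\<lambda>r. F (of_nat r) - F (of_nat (Suc r)) + F' (of_nat (Suc r)))"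
  have e: "norm (e r) \<le> B r" for r
  proof -
    have "norm (([F, F', F''] ! 0) (of_real (real r)) -
        (\<Sum>i\<le>1. ([F, F', F''] ! i) (of_real (real r) + 1) * (-1) ^ i / fact i)) \<le> B r / fact 1"
    proof (rule Taylor_on_unit_interval(2))
      fix i x assume "i \<le> (1 :: nat)"
      then have "i = 0 \<or> i = 1" by auto
      then show "(([F, F', F''] ! i) has_field_derivative ([F, F', F''] ! Suc i) x) (at x)"
        using D by auto
    qed (use B in auto)
    then show ?thesis by (simp add: e_def add.commute[of _ 1] algebra_simps)
  qed
  have se: "summable e" by (rule summable_comparison_test'[OF sB]) (use e in auto)
  have "(\<lambda>r. F (of_nat (Suc r)) - F (of_nat r)) sums (0 - F (of_nat 0))"
    by (rule telescope_sums[OF lim])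
  from sums_add[OF this summable_sums[OF se]]
  have *: "(\<lambda>r. F' (of_nat (Suc r))) sums suminf e" by (simp add: e_def F0)
  then show "summable (\<lambda>r. F' (of_nat (Suc r)))" by (rule sums_summable)
  have "norm (suminf e) \<le> suminf B" by (rule norm_suminf_le[OF e sB])
  then show "norm (\<Sum>r. F' (of_nat (Suc r))) \<le> suminf B"
    unfolding sums_unique[OF *, symmetric] .
qed

text \<open>The combination of values at two consecutive integers below is the error of the trapezoidal
  rule with its first correction term, so it only sees the fourth derivative.\<close>

lemma Euler_Maclaurin_deriv_le:
  fixes F F' F'' Fc Fd :: "complex \<Rightarrow> complex"
  assumes D: "\<And>x. (F has_field_derivative F' x) (at x)" "\<And>x. (F' has_field_derivative F'' x) (at x)"
      "\<And>x. (F'' has_field_derivative Fc x) (at x)" "\<And>x. (Fc has_field_derivative Fd x) (at x)"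
    and B: "\<And>r x. real r \<le> x \<Longrightarrow> x \<le> real r + 1 \<Longrightarrow> norm (Fd (of_real x)) \<le> B r"
    and sB: "summable B"
    and lim: "(\<lambda>r. F (of_nat r)) \<longlonglongrightarrow> 0" "(\<lambda>r. F'' (of_nat r)) \<longlonglongrightarrow> 0"
    and F0: "F 0 = 0" "F' 0 = 0" and s: "summable (\<lambda>r. F' (of_nat (Suc r)))"
  shows "norm ((\<Sum>r. F' (of_nat (Suc r))) + F'' 0 / 12) \<le> suminf B"
proof -
  define e where "e = (\<lambda>r. F (of_nat (Suc r)) - F (of_nat r) -
      (F' (of_nat r) + F' (of_nat (Suc r))) / 2 + (F'' (of_nat (Suc r)) - F'' (of_nat r)) / 12)"
  let ?D = "\<lambda>i. [F, F', F'', Fc, Fd] ! i"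
  have D': "(?D i has_field_derivative ?D (Suc i) x) (at x)" if "i \<le> 3" for i x
  proof -
    have "i = 0 \<or> i = 1 \<or> i = 2 \<or> i = 3" using that by auto
    then show ?thesis using D by (auto simp: numeral_2_eq_2 numeral_3_eq_3)
  qed
  have e: "norm (e r) \<le> B r" for r
  proof -
    let ?a = "real r"
    define R where "R = (\<lambda>j n. ?D j (of_real ?a + 1) - (\<Sum>i\<le>n. ?D (i + j) (of_real ?a) / fact i))"
    have R: "norm (R j n) \<le> B r / fact n" if "n + j = 3" for j n
      unfolding R_def using Taylor_on_unit_interval(1)[of n "\<lambda>i. ?D (i + j)" ?a "B r"] D' B that
      by (auto simp: add_ac)
    \<comment> \<open>With the weights 1, -1/2 and 1/12 the third derivative drops out, because 1/6
      - 1/4 + 1/12 = 0, and \<open>e r\<close> becomes a combination of remainders that are all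
      controlled by the fourth derivative.\<close>
    have "e r = R 0 3 - R 1 2 / 2 + R 2 1 / 12"
    proof -
      let ?x = "of_nat r :: complex"
      have "R 0 3 = F (?x + 1) - (F ?x + F' ?x + F'' ?x / 2 + Fc ?x / 6)"
        "R 1 2 = F' (?x + 1) - (F' ?x + F'' ?x + Fc ?x / 2)"
        "R 2 1 = F'' (?x + 1) - (F'' ?x + Fc ?x)"
        by (simp_all add: R_def eval_nat_numeral)
      moreover have "of_nat (Suc r) = ?x + 1" by simp
      ultimately show ?thesis unfolding e_def by (simp only:) (simp add: field_simps)
    qed
    also have "norm \<dots> \<le> norm (R 0 3) + norm (R 1 2 / 2) + norm (R 2 1 / 12)"
      by (intro norm_triangle_le add_right_mono norm_triangle_ineq4)
    also have "\<dots> \<le> B r / 6 + B r / 4 + B r / 12"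
      using R[of 3 0] R[of 2 1] R[of 1 2] by (simp add: norm_divide fact_numeral)
    also have "\<dots> \<le> B r"
      using order_trans[OF norm_ge_zero B[of r "real r"]] by simp
    finally show ?thesis .
  qed
  have se: "summable e" by (rule summable_comparison_test'[OF sB]) (use e in auto)
  \<comment> \<open>As \<open>F' 0 = 0\<close>, the sum may start at 0, which supplies the left end
    values of the trapezoidal rule.\<close>
  have s': "(\<lambda>r. F' (of_nat r)) sums (\<Sum>r. F' (of_nat (Suc r)))"
    using summable_sums[OF s] by (subst (asm) sums_Suc_iff) (simp add: F0)
  have "e sums ((0 - F (of_nat 0)) - ((\<Sum>r. F' (of_nat (Suc r))) + (\<Sum>r. F' (of_nat (Suc r)))) / 2 + (0 - F'' (of_nat 0)) / 12)"
    unfolding e_def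
    by (intro sums_add sums_diff sums_divide telescope_sums lim s' summable_sums[OF s])
  then have "suminf e = - ((\<Sum>r. F' (of_nat (Suc r))) + F'' 0 / 12)"
    by (simp add: sums_iff F0)
  moreover have "norm (suminf e) \<le> suminf B" by (rule norm_suminf_le[OF e sB])
  ultimately show ?thesis by (metis norm_minus_cancel)
qed

text \<open>Comparison with the integral, whose primitive is arctan(sqrt(b) x)/sqrt(b); the 1 is the
  term at 0. With \<open>b\<close> of the size of t this is the loss of t^(-1/2) in the bounds for
  the sums.\<close>

lemma suminf_inverse_quadratic_le:
  fixes b :: real
  assumes "b > 0"
  shows "summable (\<lambda>r. 1 / (1 + b * real r ^ 2))"
    and "(\<Sum>r. 1 / (1 + b * real r ^ 2)) \<le> 1 + pi / (2 * sqrt b)"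
proof -
  define g where "g = (\<lambda>x. arctan (sqrt b * x) / sqrt b)"
  have g: "(g has_real_derivative 1 / (1 + b * x ^ 2)) (at x)" for x
  proof -
    have "(g has_real_derivative (inverse (1 + (sqrt b * x) ^ 2) * sqrt b) / sqrt b) (at x)"
      unfolding g_def by (rule DERIV_cdivide[OF DERIV_chain2[OF DERIV_arctan DERIV_cmult_Id]])
    then show ?thesis using assms by (simp add: power_mult_distrib inverse_eq_divide)
  qed
  have step: "1 / (1 + b * real (Suc r) ^ 2) \<le> g (real (Suc r)) - g (real r)" for r
  proof -
    obtain z where z: "real r < z" "z < real (Suc r)"
      "g (real (Suc r)) - g (real r) = (real (Suc r) - real r) * (1 / (1 + b * z ^ 2))"
      using MVT2[of "real r" "real (Suc r)" g "\<lambda>x. 1 / (1 + b * x ^ 2)"] g by auto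
    have "z ^ 2 \<le> real (Suc r) ^ 2" using z by (intro power_mono) auto
    then have "1 / (1 + b * real (Suc r) ^ 2) \<le> 1 / (1 + b * z ^ 2)"
      using assms by (intro divide_left_mono) (auto intro!: mult_pos_pos add_pos_nonneg mult_left_mono)
    then show ?thesis using z(3) by simp
  qed
  have bound: "(\<Sum>r<N. 1 / (1 + b * real r ^ 2)) \<le> 1 + pi / (2 * sqrt b)" for N
  proof (cases N)
    case (Suc M)
    have "(\<Sum>r<N. 1 / (1 + b * real r ^ 2)) = 1 + (\<Sum>r<M. 1 / (1 + b * real (Suc r) ^ 2))"
      unfolding Suc by (subst sum.lessThan_Suc_shift) simp
    also have "(\<Sum>r<M. 1 / (1 + b * real (Suc r) ^ 2)) \<le> (\<Sum>r<M. g (real (Suc r)) - g (real r))"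
      by (intro sum_mono step)
    also have "\<dots> = g (real M) - g (real 0)" by (rule sum_lessThan_telescope)
    also have "\<dots> \<le> pi / 2 / sqrt b"
    proof -
      have "arctan (sqrt b * M) / sqrt b \<le> (pi / 2) / sqrt b"
        using arctan_ubound[of "sqrt b * M"] assms by (intro divide_right_mono) auto
      then show ?thesis by (simp add: g_def)
    qed
    finally show ?thesis by (simp add: field_simps)
  qed (use assms in auto)
  show "summable (\<lambda>r. 1 / (1 + b * real r ^ 2))"
    by (rule summableI_nonneg_bounded[OF _ bound]) (use assms in auto)
  then show "(\<Sum>r. 1 / (1 + b * real r ^ 2)) \<le> 1 + pi / (2 * sqrt b)"
    by (rule suminf_le_const[OF _ bound])
qed

section \<open>Gaussian summands: decay and bounds for their derivatives\<close>

lemma power_times_gauss_tendsto_0: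
  fixes c s :: complex
  assumes "Re c \<ge> 0" "Re s > 0"
  shows "(\<lambda>r. of_nat r ^ j * exp (- (c * of_nat r ^ 2 + s * of_nat r))) \<longlonglongrightarrow> 0"
proof (rule Lim_null_comparison)
  have "filterlim (\<lambda>r. Re s * real r) at_top sequentially"
    using assms(2) by (intro filterlim_tendsto_pos_mult_at_top[OF tendsto_const _ filterlim_real_sequentially])
  from filterlim_compose[OF tendsto_power_div_exp_0 this]
  have "(\<lambda>r. (Re s * real r) ^ j / exp (Re s * real r) / Re s ^ j) \<longlonglongrightarrow> 0 / Re s ^ j"
    by (intro tendsto_intros) (use assms in auto)
  then show "(\<lambda>r. real r ^ j * exp (- (Re s * real r))) \<longlonglongrightarrow> 0"
    using assms by (simp add: power_mult_distrib exp_minus field_simps)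
  have "Re (c * of_nat r ^ 2) \<ge> 0" for r
    using assms by (simp flip: of_nat_power)
  then show "\<forall>\<^sub>F r in sequentially. norm (of_nat r ^ j * exp (- (c * of_nat r ^ 2 + s * of_nat r))) \<le>
      real r ^ j * exp (- (Re s * real r))"
    by (intro always_eventually allI) (simp add: norm_mult norm_power mult_left_mono)
qed

text \<open>From 1 + Y <= 8 (1 + Y/8) <= 8 exp(Y/8), raised to the fourth power, with 4096 = 8^4.
  Half of an exponential decay thus pays for a polynomial of degree 4.\<close>

lemma one_plus_power4_le: "(1 + Y) ^ 4 \<le> 4096 * exp (Y / 2)" if "Y \<ge> 0" for Y :: real
proof -
  have "(1 + Y) ^ 4 \<le> (8 * (1 + Y / 8)) ^ 4" using that by (intro power_mono) auto
  also have "\<dots> = 4096 * (1 + Y / 8) ^ 4" unfolding power_mult_distrib by simp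
  also have "(1 + Y / 8) ^ 4 \<le> exp (Y / 8) ^ 4" using that by (intro power_mono) auto
  also have "exp (Y / 8) ^ 4 = exp (Y / 2)" by (simp flip: exp_of_nat_mult)
  finally show ?thesis by simp
qed

text \<open>With s = m t, the value c = t gives the powers of q = e^(-t) in \<open>A_ser m\<close>,
  and c = 0 gives the profile; \<open>c\<close> is a free parameter so that one can interpolate
  between the two.\<close>

definition gauss :: "complex \<Rightarrow> complex \<Rightarrow> complex \<Rightarrow> complex" where
  "gauss c s x = exp (- (c * x ^ 2 + s * x))"

text \<open>The derivatives of \<open>x\<^sup>2 * gauss c s x\<close> of orders 1 to 4 with respect to \<open>x\<close>, written in terms of
  the logarithmic derivative \<open>- v\<close> of \<open>gauss c s x\<close>.\<close>

definition gauss1 where "gauss1 c s x = (let v = 2 * c * x + s in (2 * x - x^2 * v) * gauss c s x)"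
definition gauss2 where "gauss2 c s x = (let v = 2 * c * x + s in
  (2 - 4 * x * v + x^2 * v^2 - 2 * c * x^2) * gauss c s x)"
definition gauss3 where "gauss3 c s x = (let v = 2 * c * x + s in
  (- 6 * v - 12 * c * x + 6 * x * v^2 + 6 * c * x^2 * v - x^2 * v^3) * gauss c s x)"
definition gauss4 where "gauss4 c s x = (let v = 2 * c * x + s in
  (- 24 * c + 12 * v^2 + 48 * c * x * v + 12 * c^2 * x^2 - 8 * x * v^3 - 12 * c * x^2 * v^2 + x^2 * v^4)
    * gauss c s x)"

lemma has_field_derivative_gauss:
  "(gauss c s has_field_derivative - (2 * c * x + s) * gauss c s x) (at x)"
  unfolding gauss_def by (rule derivative_eq_intros refl | simp)+

lemma has_field_derivative_gauss1:
  "((\<lambda>x. x^2 * gauss c s x) has_field_derivative gauss1 c s x) (at x)"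
  unfolding gauss1_def Let_def
  by (rule derivative_eq_intros has_field_derivative_gauss refl | simp)+ (simp add: algebra_simps power2_eq_square)

lemma has_field_derivative_gauss2: "(gauss1 c s has_field_derivative gauss2 c s x) (at x)"
  unfolding gauss1_def[abs_def] gauss2_def Let_def
  by (rule derivative_eq_intros has_field_derivative_gauss refl | simp)+
     (simp add: algebra_simps power2_eq_square)

lemma has_field_derivative_gauss3: "(gauss2 c s has_field_derivative gauss3 c s x) (at x)"
  unfolding gauss2_def[abs_def] gauss3_def Let_def
  by (rule derivative_eq_intros has_field_derivative_gauss refl | simp)+
     (simp add: algebra_simps power2_eq_square power3_eq_cube)

lemma has_field_derivative_gauss4: "(gauss3 c s has_field_derivative gauss4 c s x) (at x)"
  unfolding gauss3_def[abs_def] gauss4_def Let_def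
  by (rule derivative_eq_intros has_field_derivative_gauss refl | simp)+
     (simp add: algebra_simps power2_eq_square power3_eq_cube power4_eq_xxxx)

text \<open>The fourth derivative of \<open>x^4 * gauss c s x\<close>, which is minus the derivative of \<open>gauss4\<close> in \<open>c\<close>.\<close>

definition gauss_quartic where "gauss_quartic c s x = (let v = 2 * c * x + s in
  (x^4 * (v^4 - 12 * c * v^2 + 12 * c^2) + 16 * x^3 * (6 * c * v - v^3) + 72 * x^2 * (v^2 - 2 * c)
    - 96 * x * v + 24) * gauss c s x)"

lemma gauss4_deriv_scale:
  "((\<lambda>\<theta>. gauss4 (of_real \<theta> * t) s x) has_vector_derivative
      - t * gauss_quartic (of_real \<theta> * t) s x) (at \<theta>)"
proof -
  have "((\<lambda>c. gauss4 c s x) has_field_derivative - gauss_quartic c s x) (at c)" for c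
    unfolding gauss4_def gauss_quartic_def gauss_def Let_def
    by (rule derivative_eq_intros refl | simp)+
       (simp add: algebra_simps power2_eq_square power3_eq_cube power4_eq_xxxx)
  note hf = this
  have hv: "((\<lambda>\<theta>. of_real \<theta> * t) has_vector_derivative t) (at \<theta>)"
    by (auto intro!: derivative_eq_intros)
  show ?thesis
    using field_vector_diff_chain_at[OF hv hf] by (simp add: o_def mult.commute)
qed

lemma norm_gauss: "norm (gauss c s (of_real x)) = exp (- (Re c * x ^ 2 + Re s * x))"
  unfolding gauss_def by (simp flip: of_real_power)

text \<open>The polynomial factor depends only on A = c x^2 and V = x v, because four derivatives
  were applied to x^4 times a function of c x^2 and s x. The sector conditions bound A and V by 2Y
  and 4Y, where exp(-Y) is the norm of the Gaussian, and half of Y absorbs the polynomial: 1638400 =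
  400 * 4096.\<close>

lemma norm_gauss_quartic_le:
  assumes c: "Re c \<ge> 0" "norm c \<le> 2 * Re c" and s: "Re s \<ge> 0" "norm s \<le> 2 * Re s" and x: "x \<ge> 0"
  shows "norm (gauss_quartic c s (of_real x)) \<le> 1638400 * exp (- (Re c * x ^ 2 / 2))"
proof -
  define Y where "Y = Re c * x ^ 2 + Re s * x"
  define X where "X = complex_of_real x"
  define v where "v = 2 * c * X + s"
  have Y: "Y \<ge> 0" "Re c * x ^ 2 \<le> Y" using c s x by (auto simp: Y_def)
  have a: "norm (c * X ^ 2) \<le> 2 * Y"
  proof -
    have "norm (c * X ^ 2) = norm c * x ^ 2" using x by (simp add: X_def norm_mult norm_power)
    also have "\<dots> \<le> (2 * Re c) * x ^ 2" using c by (intro mult_right_mono) auto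
    finally have "norm (c * X ^ 2) \<le> 2 * (Re c * x ^ 2)" by simp
    moreover have "Re s * x \<ge> 0" using s x by simp
    ultimately show ?thesis by (simp add: Y_def)
  qed
  have b: "norm (X * v) \<le> 4 * Y"
  proof -
    have "X * v = 2 * (c * X ^ 2) + s * X" by (simp add: v_def algebra_simps power2_eq_square)
    also have "norm \<dots> \<le> 2 * norm (c * X ^ 2) + norm s * x"
      using x by (simp add: X_def norm_mult norm_triangle_le)
    also have "norm s * x \<le> (2 * Re s) * x" using s x by (intro mult_right_mono) auto
    also have "norm (c * X ^ 2) = norm c * x ^ 2" using x by (simp add: X_def norm_mult norm_power)
    also have "2 * (norm c * x ^ 2) \<le> 2 * ((2 * Re c) * x ^ 2)"
      using c by (intro mult_left_mono mult_right_mono) auto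
    finally have "norm (X * v) \<le> 4 * (Re c * x ^ 2) + 2 * (Re s * x)" by simp
    moreover have "Re s * x \<ge> 0" using s x by simp
    ultimately show ?thesis by (simp add: Y_def)
  qed
  define A where "A = c * X ^ 2"
  define V where "V = X * v"
  have eq: "X^4 * (v^4 - 12 * c * v^2 + 12 * c^2) + 16 * X^3 * (6 * c * v - v^3) + 72 * X^2 * (v^2 - 2 * c)
    - 96 * X * v + 24 = V^4 - 12 * (A * V^2) + 12 * A^2 + 96 * (A * V) - 16 * V^3 + 72 * V^2 - 144 * A - 96 * V + 24"
    unfolding A_def V_def by (simp add: algebra_simps power2_eq_square power3_eq_cube power4_eq_xxxx)
  have "norm (V^4 - 12 * (A * V^2) + 12 * A^2 + 96 * (A * V) - 16 * V^3 + 72 * V^2 - 144 * A - 96 * V + 24) \<le> norm V^4 + 12 * (norm A * norm V^2) + 12 * norm A^2 + 96 * (norm A * norm V)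
      + 16 * norm V^3 + 72 * norm V^2 + 144 * norm A + 96 * norm V + 24"
    by (intro order_trans[OF norm_triangle_ineq add_mono] order_trans[OF norm_triangle_ineq4 add_mono])
       (simp_all add: norm_mult norm_power)
  also have "\<dots> \<le> (4*Y)^4 + 12 * ((2*Y) * (4*Y)^2) + 12 * (2*Y)^2 + 96 * ((2*Y) * (4*Y))
      + 16 * (4*Y)^3 + 72 * (4*Y)^2 + 144 * (2*Y) + 96 * (4*Y) + 24"
  proof -
    have A: "norm A \<le> 2 * Y" and V: "norm V \<le> 4 * Y" using a b by (simp_all add: A_def V_def)
    have P: "norm V ^ n \<le> (4 * Y) ^ n" "norm A ^ n \<le> (2 * Y) ^ n" for n
      by (intro power_mono A V norm_ge_zero)+
    have AV: "norm A * norm V ^ n \<le> (2 * Y) * (4 * Y) ^ n" for n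
      using Y by (intro mult_mono A P) auto
    show ?thesis
      by (intro add_mono order_refl mult_left_mono P A V AV[of 2] AV[of 1, unfolded power_one_right]) simp_all
  qed
  also have "\<dots> \<le> 400 * (1 + Y) ^ 4"
  proof -
    \<comment> \<open>The factor 400 makes all coefficients of the difference positive.\<close>
    have "400 * (1 + Y) ^ 4 - ((4*Y)^4 + 12 * ((2*Y) * (4*Y)^2) + 12 * (2*Y)^2 + 96 * ((2*Y) * (4*Y))
      + 16 * (4*Y)^3 + 72 * (4*Y)^2 + 144 * (2*Y) + 96 * (4*Y) + 24) =
      376 + 928 * Y + 432 * Y^2 + 192 * Y^3 + 144 * Y^4"
      by (simp add: algebra_simps power2_eq_square power3_eq_cube power4_eq_xxxx)
    moreover have "\<dots> \<ge> 0" using Y by simp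
    ultimately show ?thesis by linarith
  qed
  also have "(1 + Y) ^ 4 \<le> 4096 * exp (Y / 2)" by (rule one_plus_power4_le[OF Y(1)])
  finally have P: "norm (X^4 * (v^4 - 12 * c * v^2 + 12 * c^2) + 16 * X^3 * (6 * c * v - v^3) + 72 * X^2 * (v^2 - 2 * c)
    - 96 * X * v + 24) \<le> 1638400 * exp (Y / 2)" unfolding eq by simp
  have "norm (gauss_quartic c s X) \<le> 1638400 * exp (Y / 2) * exp (- Y)"
    unfolding gauss_quartic_def Let_def v_def[symmetric] norm_mult
    using mult_right_mono[OF P, of "norm (gauss c s X)"] norm_gauss[of c s x]
    by (simp add: X_def Y_def)
  also have "\<dots> = 1638400 * exp (- (Y / 2))" by (simp add: mult_exp_exp)
  also have "\<dots> \<le> 1638400 * exp (- (Re c * x ^ 2 / 2))" using Y by simp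
  finally show ?thesis unfolding X_def .
qed

text \<open>Integrating the derivative along \<open>c = \<theta> * t\<close> gives a decay in \<open>x\<close> that does not depend on \<open>s\<close>;
  estimating the two terms separately would lose it when \<open>s\<close> is small.\<close>

lemma norm_gauss4_diff_le:
  assumes t: "Re t > 0" "norm t \<le> 2 * Re t" and s: "Re s \<ge> 0" "norm s \<le> 2 * Re s" and x: "x \<ge> 0"
  shows "norm (gauss4 t s (of_real x) - gauss4 0 s (of_real x)) \<le>
    3276800 * norm t / (1 + Re t / 2 * x ^ 2)"
proof -
  define a where "a = Re t / 2 * x ^ 2"
  define K where "K = 1638400 * norm t"
  \<comment> \<open>A primitive in \<theta> of the bound \<open>K * exp (- (\<theta> * a))\<close>,
    with the degenerate case \<open>a = 0\<close> treated apart. For \<open>a > 0\<close> its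
    increment over [0,1] is K (1 - e^(-a))/a; as 1 - e^(-a) is at most a and at most 1, this is at
    most 2K/(1+a).\<close>
  define \<phi> where "\<phi> = (\<lambda>\<theta>. if a = 0 then K * \<theta> else - K * exp (- (\<theta> * a)) / a)"
  have a: "a \<ge> 0" and K: "K \<ge> 0" using t by (simp_all add: a_def K_def)
  let ?f = "\<lambda>\<theta>. gauss4 (of_real \<theta> * t) s (of_real x)"
  have \<phi>: "(\<phi> has_vector_derivative K * exp (- (\<theta> * a))) (at \<theta>)" for \<theta>
  proof (cases "a = 0")
    case True
    then show ?thesis unfolding \<phi>_def by (auto intro!: derivative_eq_intros)
  next
    case False
    then have "(\<phi> has_real_derivative K * exp (- (\<theta> * a))) (at \<theta>)"
      unfolding \<phi>_def by (auto intro!: derivative_eq_intros)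
    then show ?thesis by (simp add: has_real_derivative_iff_has_vector_derivative)
  qed
  have "norm (?f 1 - ?f 0) \<le> \<phi> 1 - \<phi> 0"
  proof (rule differentiable_bound_general)
    show "continuous_on {0..1} ?f"
      by (intro continuous_at_imp_continuous_on ballI has_vector_derivative_continuous[OF gauss4_deriv_scale])
    show "continuous_on {0..1} \<phi>"
      by (intro continuous_at_imp_continuous_on ballI has_vector_derivative_continuous[OF \<phi>])
    fix \<theta> :: real assume \<theta>: "0 < \<theta>" "\<theta> < 1"
    show "(?f has_vector_derivative - t * gauss_quartic (of_real \<theta> * t) s (of_real x)) (at \<theta>)"
      by (rule gauss4_deriv_scale)
    show "(\<phi> has_vector_derivative K * exp (- (\<theta> * a))) (at \<theta>)" by (rule \<phi>)
    have "norm (gauss_quartic (of_real \<theta> * t) s (of_real x)) \<le> 1638400 * exp (- (Re (of_real \<theta> * t) * x ^ 2 / 2))"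
    proof (rule norm_gauss_quartic_le[OF _ _ s x])
      show "norm (of_real \<theta> * t) \<le> 2 * Re (of_real \<theta> * t)"
        using mult_left_mono[OF t(2), of \<theta>] \<theta> by (simp add: norm_mult mult_ac)
    qed (use \<theta> t in simp)
    then have "norm t * norm (gauss_quartic (of_real \<theta> * t) s (of_real x)) \<le> norm t * (1638400 * exp (- (\<theta> * a)))"
      by (intro mult_left_mono) (simp_all add: a_def mult_ac)
    then show "norm (- t * gauss_quartic (of_real \<theta> * t) s (of_real x)) \<le> K * exp (- (\<theta> * a))"
      by (simp add: norm_mult K_def mult_ac)
  qed simp
  also have "\<phi> 1 - \<phi> 0 \<le> K * (2 / (1 + a))"
  proof (cases "a = 0")
    case True
    then show ?thesis using K by (simp add: \<phi>_def)
  next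
    case False
    have "1 + - a \<le> exp (- a)" by (rule exp_ge_add_one_self)
    then have 1: "1 - exp (- a) \<le> a" by simp
    have 2: "a * (1 - exp (- a)) \<le> a * 1" using a by (intro mult_left_mono) auto
    have "(1 - exp (- a)) * (1 + a) \<le> 2 * a"
      using 1 2 by (simp add: algebra_simps)
    then have "(1 - exp (- a)) / a \<le> 2 / (1 + a)" using a False by (simp add: field_simps)
    from mult_left_mono[OF this K] show ?thesis
      using False by (simp add: \<phi>_def diff_divide_distrib right_diff_distrib)
  qed
  finally show ?thesis by (simp add: K_def a_def)
qed

text \<open>The function 2 cosh z - 2 without its leading term z^2, followed by its first two
  derivatives; they vanish at 0 to the orders 4, 3 and 2.\<close>

definition cosh_rem :: "complex \<Rightarrow> complex" where "cosh_rem z = exp z - 2 + exp (- z) - z^2"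
definition cosh_rem1 :: "complex \<Rightarrow> complex" where "cosh_rem1 z = exp z - exp (- z) - 2 * z"
definition cosh_rem2 :: "complex \<Rightarrow> complex" where "cosh_rem2 z = exp z + exp (- z) - 2"

lemma norm_cosh_rem_le:
  "norm (cosh_rem z) \<le> exp \<bar>Re z\<bar> * norm z ^ 4"
  "norm (cosh_rem1 z) \<le> exp \<bar>Re z\<bar> * norm z ^ 3"
  "norm (cosh_rem2 z) \<le> 2 * exp \<bar>Re z\<bar> * norm z ^ 2"
proof -
  define R where "R = (\<lambda>n z. exp z - (\<Sum>k\<le>n. z ^ k / fact k) :: complex)"
  have R: "norm (R n z) \<le> exp \<bar>Re z\<bar> * norm z ^ Suc n / fact n" for n z
    unfolding R_def by (rule Taylor_exp)
  have eq: "cosh_rem z = R 3 z + R 3 (- z)" "cosh_rem1 z = R 2 z - R 2 (- z)" "cosh_rem2 z = R 1 z + R 1 (- z)"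
    unfolding R_def cosh_rem_def cosh_rem1_def cosh_rem2_def
    by (simp_all add: eval_nat_numeral)
  show "norm (cosh_rem z) \<le> exp \<bar>Re z\<bar> * norm z ^ 4"
  proof -
    have "norm (cosh_rem z) \<le> norm (R 3 z) + norm (R 3 (- z))" unfolding eq by (rule norm_triangle_ineq)
    also have "\<dots> \<le> exp \<bar>Re z\<bar> * norm z ^ 4 / 6 + exp \<bar>Re z\<bar> * norm z ^ 4 / 6"
      using R[of 3 z] R[of 3 "- z"] by (intro add_mono) (simp_all add: fact_numeral)
    also have "\<dots> \<le> exp \<bar>Re z\<bar> * norm z ^ 4" by simp
    finally show ?thesis .
  qed
  show "norm (cosh_rem1 z) \<le> exp \<bar>Re z\<bar> * norm z ^ 3"
    unfolding eq using norm_triangle_ineq4[of "R 2 z" "R 2 (- z)"] R[of 2 z] R[of 2 "- z"] by (simp add: fact_numeral)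
  show "norm (cosh_rem2 z) \<le> 2 * exp \<bar>Re z\<bar> * norm z ^ 2"
    unfolding eq using norm_triangle_ineq[of "R 1 z" "R 1 (- z)"] R[of 1 z] R[of 1 "- z"] by (simp add: numeral_2_eq_2)
qed

text \<open>The factor e^(tx) - 2 + e^(-tx) is t^2 x^2 + \<open>cosh_rem (t * x)\<close>. The
  quadratic part leads to \<open>gauss1\<close>; this is the rest, followed by its first two
  derivatives in \<open>x\<close>.\<close>

definition gauss_rem where "gauss_rem t s x = gauss t s x * cosh_rem (t * x)"
definition gauss_rem1 where "gauss_rem1 t s x = (t * cosh_rem1 (t * x) - (2 * t * x + s) * cosh_rem (t * x)) * gauss t s x"
definition gauss_rem2 where "gauss_rem2 t s x = (let v = 2 * t * x + s in
  (t^2 * cosh_rem2 (t * x) - 2 * t * v * cosh_rem1 (t * x) + (v^2 - 2 * t) * cosh_rem (t * x)) * gauss t s x)"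

lemma has_field_derivative_gauss_rem: "(gauss_rem t s has_field_derivative gauss_rem1 t s x) (at x)"
  unfolding gauss_rem_def[abs_def] gauss_rem1_def cosh_rem_def cosh_rem1_def
  by (rule derivative_eq_intros has_field_derivative_gauss refl | simp)+
     (simp add: algebra_simps power2_eq_square)

lemma has_field_derivative_gauss_rem1: "(gauss_rem1 t s has_field_derivative gauss_rem2 t s x) (at x)"
  unfolding gauss_rem1_def[abs_def] gauss_rem2_def Let_def cosh_rem_def cosh_rem1_def cosh_rem2_def
  by (rule derivative_eq_intros has_field_derivative_gauss refl | simp)+
     (simp add: algebra_simps power2_eq_square power3_eq_cube)

text \<open>The zeros of the \<open>cosh_rem\<close> functions supply powers of t x, so each of the
  three summands is bounded by |t|^3 times a polynomial in |t| x^2 and x |v|, up to the growth exp(x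
  Re t). The Gaussian absorbs that growth through x <= (x^2+1)/2 and \<open>Re t \<le> 1\<close>.
  The constant is 32 * 8192, with 8192 = 2 * 4096.\<close>

lemma norm_gauss_rem2_le:
  assumes t: "Re t > 0" "norm t \<le> 2 * Re t" "Re t \<le> 1" and s: "Re s \<ge> 0" "norm s \<le> 2 * Re s" and x: "x \<ge> 0"
  shows "norm (gauss_rem2 t s (of_real x)) \<le> 262144 * norm t ^ 3 / (1 + Re t / 2 * x ^ 2)"
proof -
  define Y where "Y = Re t * x ^ 2 + Re s * x"
  define X where "X = complex_of_real x"
  define v where "v = 2 * t * X + s"
  define T where "T = norm t"
  define E where "E = exp (Re t * x)"
  have Y: "Y \<ge> 0" "Re t * x ^ 2 \<le> Y" using t s x by (auto simp: Y_def)
  have nX: "norm X = x" using x by (simp add: X_def)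
  have sx: "Re s * x \<ge> 0" using s x by simp
  have a: "T * x ^ 2 \<le> 2 * Y"
    using mult_right_mono[OF t(2), of "x^2"] sx by (simp add: T_def Y_def)
  have b: "x * norm v \<le> 4 * Y"
  proof -
    have "norm v \<le> 2 * T * x + norm s"
      unfolding v_def using norm_triangle_ineq[of "2 * t * X" s] nX by (simp add: norm_mult T_def)
    then have "x * norm v \<le> x * (2 * T * x + norm s)" using x by (intro mult_left_mono)
    also have "\<dots> = 2 * (T * x ^ 2) + norm s * x" by (simp add: algebra_simps power2_eq_square)
    also have "norm s * x \<le> 2 * Re s * x" using s x by (intro mult_right_mono) auto
    also have "T * x ^ 2 \<le> 2 * Re t * x ^ 2" unfolding T_def using t by (intro mult_right_mono) auto
    finally show ?thesis using sx by (simp add: Y_def)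
  qed
  have T0: "T \<ge> 0" by (simp add: T_def)
  have w: "norm (cosh_rem (t * X)) \<le> E * (T * x) ^ 4" "norm (cosh_rem1 (t * X)) \<le> E * (T * x) ^ 3"
    "norm (cosh_rem2 (t * X)) \<le> 2 * E * (T * x) ^ 2"
    using norm_cosh_rem_le[of "t * X"] t x by (simp_all add: E_def X_def T_def norm_mult)
  have "norm (t^2 * cosh_rem2 (t * X) - 2 * t * v * cosh_rem1 (t * X) + (v^2 - 2 * t) * cosh_rem (t * X))
     \<le> T^2 * norm (cosh_rem2 (t * X)) + 2 * T * norm v * norm (cosh_rem1 (t * X)) + (norm v^2 + 2 * T) * norm (cosh_rem (t * X))"
  proof -
    have "norm (v^2 - 2 * t) \<le> norm v^2 + 2 * T"
      using norm_triangle_ineq4[of "v^2" "2 * t"] by (simp add: norm_mult norm_power T_def)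
    then have "norm ((v^2 - 2 * t) * cosh_rem (t * X)) \<le> (norm v^2 + 2 * T) * norm (cosh_rem (t * X))"
      unfolding norm_mult by (intro mult_right_mono) auto
    then show ?thesis
      by (intro order_trans[OF norm_triangle_ineq add_mono] order_trans[OF norm_triangle_ineq4 add_mono])
         (simp_all add: norm_mult norm_power T_def)
  qed
  also have "\<dots> \<le> T^2 * (2 * E * (T * x) ^ 2) + 2 * T * norm v * (E * (T * x) ^ 3) + (norm v^2 + 2 * T) * (E * (T * x) ^ 4)"
    using w T0 by (intro add_mono mult_left_mono) auto
  also have "\<dots> = T^3 * E * ((T * x ^ 2) * (2 + 2 * (x * norm v) + (x * norm v)^2 + 2 * (T * x ^ 2)))"
    by (simp add: algebra_simps power2_eq_square power3_eq_cube power4_eq_xxxx)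
  also have "\<dots> \<le> T^3 * E * ((2 * Y) * (2 + 2 * (4 * Y) + (4 * Y)^2 + 2 * (2 * Y)))"
  proof (rule mult_left_mono)
    have "(x * norm v)^2 \<le> (4 * Y)^2" using b x by (intro power_mono) auto
    with a b have *: "2 + 2 * (x * norm v) + (x * norm v)^2 + 2 * (T * x ^ 2) \<le> 2 + 2 * (4 * Y) + (4 * Y)^2 + 2 * (2 * Y)"
      by linarith
    show "(T * x ^ 2) * (2 + 2 * (x * norm v) + (x * norm v)^2 + 2 * (T * x ^ 2))
        \<le> (2 * Y) * (2 + 2 * (4 * Y) + (4 * Y)^2 + 2 * (2 * Y))"
      by (rule mult_mono[OF a *]) (use Y T0 x in auto)
  qed (use T0 in \<open>simp add: E_def\<close>)
  also have "\<dots> \<le> T^3 * E * (32 * (1 + Y) ^ 3)"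
  proof (rule mult_left_mono)
    have "32 * (1 + Y) ^ 3 - (2 * Y) * (2 + 2 * (4 * Y) + (4 * Y)^2 + 2 * (2 * Y)) = 32 + 92 * Y + 72 * Y^2"
      by (simp add: algebra_simps power2_eq_square power3_eq_cube)
    moreover have "\<dots> \<ge> 0" using Y by simp
    ultimately show "(2 * Y) * (2 + 2 * (4 * Y) + (4 * Y)^2 + 2 * (2 * Y)) \<le> 32 * (1 + Y) ^ 3" by linarith
  qed (use T0 in \<open>simp add: E_def\<close>)
  finally have P: "norm (t^2 * cosh_rem2 (t * X) - 2 * t * v * cosh_rem1 (t * X) + (v^2 - 2 * t) * cosh_rem (t * X))
     \<le> 32 * T^3 * (E * (1 + Y) ^ 3)" by (simp add: mult_ac)
  have c1: "E * (1 + Y) ^ 3 * exp (- Y) \<le> 8192 / (1 + Y)"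
  proof -
    have "Re t * x \<le> Re t * ((x^2 + 1) / 2)"
    proof (rule mult_left_mono)
      have "(x - 1)^2 \<ge> 0" by simp
      then show "x \<le> (x^2 + 1) / 2" by (simp add: power2_eq_square algebra_simps)
    qed (use t in simp)
    also have "\<dots> \<le> Y / 2 + 1 / 2" using Y t by (simp add: algebra_simps)
    finally have "E \<le> exp (Y / 2 + 1 / 2)" by (simp add: E_def)
    also have "\<dots> = exp (Y / 2) * exp (1 / 2)" by (rule exp_add)
    also have "\<dots> \<le> exp (Y / 2) * 2"
    proof (rule mult_left_mono)
      have "exp (1 / 2 :: real) ^ 2 = exp 1" by (simp flip: exp_of_nat_mult)
      also have "\<dots> \<le> 2 ^ 2" using exp_le by simp
      finally show "exp (1 / 2 :: real) \<le> 2" by (rule power2_le_imp_le) simp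
    qed simp
    finally have "E * exp (- Y) \<le> exp (Y / 2) * 2 * exp (- Y)" by (intro mult_right_mono) auto
    also have "\<dots> = 2 * exp (- (Y / 2))" by (simp add: mult_exp_exp)
    finally have E1: "E * exp (- Y) \<le> 2 * exp (- (Y / 2))" .
    have "(E * exp (- Y)) * (1 + Y) ^ 4 \<le> (2 * exp (- (Y / 2))) * (4096 * exp (Y / 2))"
      by (rule mult_mono[OF E1 one_plus_power4_le[OF Y(1)]]) (use Y in auto)
    also have "\<dots> = 8192" by (simp add: exp_minus)
    finally have "(E * exp (- Y)) * (1 + Y) ^ 4 \<le> 8192" .
    then have "(E * (1 + Y) ^ 3 * exp (- Y)) * (1 + Y) \<le> 8192"
      by (simp add: eval_nat_numeral mult_ac)
    then show ?thesis using Y by (simp add: pos_le_divide_eq)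
  qed
  have c2: "8192 / (1 + Y) \<le> 8192 / (1 + Re t / 2 * x ^ 2)"
    using Y t sx by (intro divide_left_mono mult_pos_pos add_pos_nonneg) (auto simp: Y_def)
  have "norm (gauss_rem2 t s X) \<le> 32 * T^3 * (E * (1 + Y) ^ 3) * exp (- Y)"
    unfolding gauss_rem2_def Let_def v_def[symmetric] norm_mult
    using mult_right_mono[OF P, of "norm (gauss t s X)"] norm_gauss[of t s x]
    by (simp add: X_def Y_def norm_mult)
  also have "32 * T^3 * (E * (1 + Y) ^ 3) * exp (- Y) = 32 * T^3 * (E * (1 + Y) ^ 3 * exp (- Y))"
    by (simp only: mult.assoc)
  also have "\<dots> \<le> 32 * T^3 * (8192 / (1 + Re t / 2 * x ^ 2))"
    by (rule mult_left_mono[OF order_trans[OF c1 c2]]) (use T0 in simp)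
  finally show ?thesis by (simp add: X_def T_def)
qed

section \<open>Comparison with the profile function\<close>

lemma power_times_gauss_nat_tendsto_0:
  assumes "Re c \<ge> 0" "Re s > 0"
  shows "(\<lambda>r. of_nat r ^ j * gauss c s (of_nat r)) \<longlonglongrightarrow> 0"
  unfolding gauss_def by (rule power_times_gauss_tendsto_0[OF assms])

lemma power2_gauss_tendsto_0:
  assumes "Re c \<ge> 0" "Re s > 0"
  shows "(\<lambda>r. of_nat r ^ 2 * gauss c s (of_nat r)) \<longlonglongrightarrow> 0"
    and "(\<lambda>r. gauss2 c s (of_nat r)) \<longlonglongrightarrow> 0"
    and "summable (\<lambda>r. gauss1 c s (of_nat (Suc r)))"
proof -
  let ?g = "\<lambda>r. gauss c s (of_nat r)"
  note lim = power_times_gauss_nat_tendsto_0[OF assms]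
  show "(\<lambda>r. of_nat r ^ 2 * ?g r) \<longlonglongrightarrow> 0" by (rule lim)
  have "(\<lambda>r. 2 * (of_nat r ^ 0 * ?g r) - 4 * s * (of_nat r ^ 1 * ?g r) + (s^2 - 10 * c) * (of_nat r ^ 2 * ?g r)
      + 4 * c * s * (of_nat r ^ 3 * ?g r) + 4 * c^2 * (of_nat r ^ 4 * ?g r)) \<longlonglongrightarrow>
      2 * 0 - 4 * s * 0 + (s^2 - 10 * c) * 0 + 4 * c * s * 0 + 4 * c^2 * 0"
    by (intro tendsto_intros lim)
  moreover have "gauss2 c s x = 2 * (x ^ 0 * gauss c s x) - 4 * s * (x ^ 1 * gauss c s x) + (s^2 - 10 * c) * (x ^ 2 * gauss c s x)
      + 4 * c * s * (x ^ 3 * gauss c s x) + 4 * c^2 * (x ^ 4 * gauss c s x)" for x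
    by (simp add: gauss2_def algebra_simps eval_nat_numeral)
  ultimately show "(\<lambda>r. gauss2 c s (of_nat r)) \<longlonglongrightarrow> 0" by simp
  have "(\<lambda>r. 2 * (of_nat r ^ 3 * ?g r) - s * (of_nat r ^ 4 * ?g r) - 2 * c * (of_nat r ^ 5 * ?g r)) \<longlonglongrightarrow>
      2 * 0 - s * 0 - 2 * c * 0"
    by (intro tendsto_intros lim)
  moreover have "x ^ 2 * gauss1 c s x = 2 * (x ^ 3 * gauss c s x) - s * (x ^ 4 * gauss c s x) - 2 * c * (x ^ 5 * gauss c s x)" for x
    by (simp add: gauss1_def algebra_simps eval_nat_numeral)
  ultimately have "(\<lambda>r. of_nat r ^ 2 * gauss1 c s (of_nat r)) \<longlonglongrightarrow> 0" by simp
  then have "Bseq (\<lambda>r. of_nat r ^ 2 * gauss1 c s (of_nat r))" by (rule convergent_imp_Bseq[OF convergentI])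
  then obtain K where K: "K > 0" "\<And>r. norm (of_nat r ^ 2 * gauss1 c s (of_nat r)) \<le> K"
    unfolding Bseq_def by blast
  have "summable (\<lambda>r. K * (1 / real (r + 1) ^ 2))"
    using inverse_squares_sums by (intro summable_mult) (auto simp: sums_iff add.commute)
  then show "summable (\<lambda>r. gauss1 c s (of_nat (Suc r)))"
  proof (rule summable_comparison_test')
    fix r
    have "real (Suc r) ^ 2 * norm (gauss1 c s (of_nat (Suc r))) \<le> K"
      using K(2)[of "Suc r"] by (simp only: norm_mult norm_power norm_of_nat)
    then show "norm (gauss1 c s (of_nat (Suc r))) \<le> K * (1 / real (r + 1) ^ 2)"
      by (simp add: field_simps)
  qed
qed

lemma gauss_0 [simp]: "gauss1 c s 0 = 0" "gauss2 c s 0 = 2"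
  by (simp_all add: gauss1_def gauss2_def gauss_def)

text \<open>The profile function at a complex argument, as the sum over positive integers of
  \<open>-1/t\<close> times the derivative of \<open>t\<^sup>2 * x\<^sup>2 * exp (- t * m * x)\<close>. The coefficients \<open>C_ser m (exp (- t))\<close>
  have the same shape, with \<open>exp (- t * (x\<^sup>2 + m * x)) * (exp (t * x) - 2 + exp (- t * x))\<close> instead.\<close>

definition profile_sum :: "real \<Rightarrow> complex \<Rightarrow> complex" where
  "profile_sum m t = - (t * (\<Sum>r. gauss1 0 (of_real m * t) (of_nat (Suc r))))"

text \<open>The Euler-Maclaurin rule is applied to the difference of the two functions:
  \<open>gauss2 c s 0 = 2\<close> for every \<open>c\<close>, so the boundary term cancels and only
  the difference of the fourth derivatives remains.\<close>

lemma norm_gauss_correction_le: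
  assumes t: "Re t > 0" "norm t \<le> 2 * Re t" "Re t \<le> 1" and m: "m > 0"
  shows "norm (\<Sum>r. gauss1 t (of_real m * t) (of_nat (Suc r)) - gauss1 0 (of_real m * t) (of_nat (Suc r)))
    \<le> 3276800 * norm t * (1 + pi / (2 * sqrt (Re t / 2)))"
proof -
  define s where "s = of_real m * t"
  have s: "Re s > 0" "norm s \<le> 2 * Re s"
    using m t by (auto simp: s_def norm_mult)
  have s': "Re s \<ge> 0" using s by simp
  define B where "B = (\<lambda>r. 3276800 * norm t * (1 / (1 + Re t / 2 * real r ^ 2)))"
  have b: "Re t / 2 > 0" using t by simp
  note sm = suminf_inverse_quadratic_le[OF b]
  have "norm ((\<Sum>r. gauss1 t s (of_nat (Suc r)) - gauss1 0 s (of_nat (Suc r))) + (gauss2 t s 0 - gauss2 0 s 0) / 12) \<le> suminf B"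
  proof (rule Euler_Maclaurin_deriv_le[where F = "\<lambda>x. x^2 * gauss t s x - x^2 * gauss 0 s x" and
      Fc = "\<lambda>x. gauss3 t s x - gauss3 0 s x" and Fd = "\<lambda>x. gauss4 t s x - gauss4 0 s x" and
      F' = "\<lambda>x. gauss1 t s x - gauss1 0 s x" and F'' = "\<lambda>x. gauss2 t s x - gauss2 0 s x"])
    fix r x assume rx: "real r \<le> x" "x \<le> real r + 1"
    then have "x \<ge> 0" by linarith
    from norm_gauss4_diff_le[OF t(1,2) s' s(2) this]
    have "norm (gauss4 t s (of_real x) - gauss4 0 s (of_real x)) \<le> 3276800 * norm t * (1 / (1 + Re t / 2 * x ^ 2))" by simp
    also have "\<dots> \<le> B r"
      unfolding B_def using rx t
      by (intro mult_left_mono divide_left_mono add_mono power_mono mult_pos_pos add_pos_nonneg) auto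
    finally show "norm (gauss4 t s (of_real x) - gauss4 0 s (of_real x)) \<le> B r" .
  next
    show "summable B" unfolding B_def by (intro summable_mult sm)
    have "(\<lambda>r. of_nat r ^ 2 * gauss t s (of_nat r) - of_nat r ^ 2 * gauss 0 s (of_nat r)) \<longlonglongrightarrow> 0 - 0"
      using t s by (intro tendsto_intros power2_gauss_tendsto_0) auto
    then show "(\<lambda>r. of_nat r ^ 2 * gauss t s (of_nat r) - of_nat r ^ 2 * gauss 0 s (of_nat r)) \<longlonglongrightarrow> 0" by simp
    have "(\<lambda>r. gauss2 t s (of_nat r) - gauss2 0 s (of_nat r)) \<longlonglongrightarrow> 0 - 0"
      using t s by (intro tendsto_intros power2_gauss_tendsto_0) auto
    then show "(\<lambda>r. gauss2 t s (of_nat r) - gauss2 0 s (of_nat r)) \<longlonglongrightarrow> 0" by simp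
    show "summable (\<lambda>r. gauss1 t s (of_nat (Suc r)) - gauss1 0 s (of_nat (Suc r)))"
      using t s by (intro summable_diff power2_gauss_tendsto_0) auto
  qed (intro DERIV_diff has_field_derivative_gauss1 has_field_derivative_gauss2
      has_field_derivative_gauss3 has_field_derivative_gauss4 | simp)+
  also have "suminf B \<le> 3276800 * norm t * (1 + pi / (2 * sqrt (Re t / 2)))"
    unfolding B_def by (subst suminf_mult[OF sm(1)], rule mult_left_mono[OF sm(2)]) simp
  finally show ?thesis by (simp add: s_def)
qed

lemma norm_gauss_rem1_sum_le:
  assumes t: "Re t > 0" "norm t \<le> 2 * Re t" "Re t \<le> 1" and m: "m \<ge> 1"
  shows "summable (\<lambda>r. gauss_rem1 t (of_real m * t) (of_nat (Suc r)))"
    and "norm (\<Sum>r. gauss_rem1 t (of_real m * t) (of_nat (Suc r))) \<le> 262144 * norm t ^ 3 * (1 + pi / (2 * sqrt (Re t / 2)))"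
proof -
  define s where "s = of_real m * t"
  have s: "Re s \<ge> 0" "norm s \<le> 2 * Re s" "Re s > 0" using m t by (auto simp: s_def norm_mult)
  define B where "B = (\<lambda>r. 262144 * norm t ^ 3 * (1 / (1 + Re t / 2 * real r ^ 2)))"
  have b: "Re t / 2 > 0" using t by simp
  note sm = suminf_inverse_quadratic_le[OF b]
  have bound: "norm (gauss_rem2 t s (of_real x)) \<le> B r" if rx: "real r \<le> x" "x \<le> real r + 1" for r x
  proof -
    have "x \<ge> 0" using rx by linarith
    from norm_gauss_rem2_le[OF t s(1,2) this]
    have "norm (gauss_rem2 t s (of_real x)) \<le> 262144 * norm t ^ 3 * (1 / (1 + Re t / 2 * x ^ 2))" by simp
    also have "\<dots> \<le> B r"
      unfolding B_def using rx t
      by (intro mult_left_mono divide_left_mono add_mono power_mono mult_pos_pos add_pos_nonneg) auto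
    finally show ?thesis .
  qed
  have sB: "summable B" unfolding B_def by (intro summable_mult sm)
  have lim: "(\<lambda>r. gauss_rem t s (of_nat r)) \<longlonglongrightarrow> 0"
  proof -
    have split: "gauss t s x * exp (t * x) = gauss t (s - t) x" "gauss t s x * exp (- (t * x)) = gauss t (s + t) x" for x
      by (simp_all add: gauss_def algebra_simps flip: exp_add)
    have gauss_rem_eq: "gauss_rem t s x = gauss t (s - t) x - 2 * gauss t s x + gauss t (s + t) x - t^2 * (x^2 * gauss t s x)" for x
      unfolding gauss_rem_def cosh_rem_def split[symmetric] by (simp add: algebra_simps power2_eq_square)
    have "(\<lambda>r. gauss t (s - t) (of_nat r)) \<longlonglongrightarrow> 0"
    proof (rule Lim_null_comparison)
      have "(\<lambda>r. norm (of_nat r ^ 0 * gauss (of_real (Re t) / 2) (of_real (Re t) / 2) (of_nat r))) \<longlonglongrightarrow> 0"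
        using t by (intro tendsto_norm_zero power_times_gauss_nat_tendsto_0) auto
      then show "(\<lambda>r. norm (gauss (of_real (Re t) / 2) (of_real (Re t) / 2) (of_nat r))) \<longlonglongrightarrow> 0" by simp
      \<comment> \<open>For m = 1 the factor e^(tx) cancels the whole linear part of the exponent,
        so the decay must come from the quadratic part; half of it is traded for a linear one by r
        <= r^2.\<close>
      have "norm (gauss t (s - t) (of_nat r)) \<le> norm (gauss (of_real (Re t) / 2) (of_real (Re t) / 2) (of_nat r))" for r
      proof -
        have "Re t * 1 \<le> Re t * m" using m t by (intro mult_left_mono) auto
        then have "Re (s - t) * real r \<ge> 0" by (simp add: s_def mult.commute)
        moreover have "Re t * real r \<le> Re t * real r ^ 2"
          using t self_le_power[of "real r" 2] by (cases r) (auto intro!: mult_left_mono)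
        ultimately show ?thesis
          using norm_gauss[of t "s - t" "real r"] norm_gauss[of "of_real (Re t) / 2" "of_real (Re t) / 2" "real r"]
          by simp
      qed
      then show "\<forall>\<^sub>F r in sequentially. norm (gauss t (s - t) (of_nat r)) \<le>
          norm (gauss (of_real (Re t) / 2) (of_real (Re t) / 2) (of_nat r))" by simp
    qed
    note lim1 = this
    have lim2: "(\<lambda>r. gauss t s (of_nat r)) \<longlonglongrightarrow> 0" "(\<lambda>r. gauss t (s + t) (of_nat r)) \<longlonglongrightarrow> 0"
      using power_times_gauss_nat_tendsto_0[of t s 0] power_times_gauss_nat_tendsto_0[of t "s + t" 0] s t by auto
    have "(\<lambda>r. of_nat r ^ 2 * gauss t s (of_nat r)) \<longlonglongrightarrow> 0"
      using s t by (intro power2_gauss_tendsto_0) auto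
    then have "(\<lambda>r. gauss t (s - t) (of_nat r) - 2 * gauss t s (of_nat r) + gauss t (s + t) (of_nat r)
        - t^2 * (of_nat r ^ 2 * gauss t s (of_nat r))) \<longlonglongrightarrow> 0 - 2 * 0 + 0 - t^2 * 0"
      by (intro tendsto_intros lim1 lim2)
    then show ?thesis unfolding gauss_rem_eq by simp
  qed
  have 0: "gauss_rem t s 0 = 0" by (simp add: gauss_rem_def cosh_rem_def)
  note * = norm_sum_deriv_le[OF has_field_derivative_gauss_rem has_field_derivative_gauss_rem1 bound sB lim 0]
  from *(1) show "summable (\<lambda>r. gauss_rem1 t (of_real m * t) (of_nat (Suc r)))" by (simp add: s_def)
  have "suminf B \<le> 262144 * norm t ^ 3 * (1 + pi / (2 * sqrt (Re t / 2)))"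
    unfolding B_def by (subst suminf_mult[OF sm(1)], rule mult_left_mono[OF sm(2)]) simp
  with *(2) show "norm (\<Sum>r. gauss_rem1 t (of_real m * t) (of_nat (Suc r))) \<le> 262144 * norm t ^ 3 * (1 + pi / (2 * sqrt (Re t / 2)))"
    by (simp add: s_def)
qed

text \<open>By the total derivative form of the terms, the second difference in m is -1/t times the
  derivative of \<open>gauss t s x\<close> multiplied by e^(tx) - 2 + e^(-tx). Splitting off t^2 x^2
  from this factor and replacing \<open>gauss1 t s\<close> by \<open>gauss1 0 s\<close> produces the
  two error sums.\<close>

lemma C_ser_decomposition:
  assumes t: "Re t > 0" "norm t \<le> 2 * Re t" "Re t \<le> 1" and m: "m \<ge> 1"
  defines "s \<equiv> of_nat m * t"
  shows "C_ser m (exp (- t)) - profile_sum m t =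
    - ((\<Sum>r. gauss_rem1 t s (of_nat (Suc r))) / t + t * (\<Sum>r. gauss1 t s (of_nat (Suc r)) - gauss1 0 s (of_nat (Suc r))))"
proof -
  define q where "q = exp (- t)"
  have nq: "norm q < 1" using t by (simp add: q_def)
  have s: "Re s > 0" "of_nat m * t = of_real (real m) * t" using m t by (auto simp: s_def)
  have tnz: "t \<noteq> 0" using t by auto
  have m': "real m \<ge> 1" using m by simp
  have trm: "of_nat (\<mu> + 2 * Suc r) * q ^ (Suc r * (Suc r + \<mu>)) =
      (of_nat \<mu> + 2 * of_nat (Suc r)) * gauss t (of_nat \<mu> * t) (of_nat (Suc r))" for \<mu> r
  proof -
    have "q ^ (Suc r * (Suc r + \<mu>)) = gauss t (of_nat \<mu> * t) (of_nat (Suc r))"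
      unfolding q_def gauss_def exp_of_nat_mult[symmetric]
      by (rule arg_cong[of _ _ exp]) (simp add: algebra_simps power2_eq_square)
    then show ?thesis by simp
  qed
  have A: "(\<lambda>r. (of_nat \<mu> + 2 * of_nat (Suc r)) * gauss t (of_nat \<mu> * t) (of_nat (Suc r))) sums A_ser \<mu> q" for \<mu>
    using A_ser_sums[OF nq, of \<mu>] unfolding trm .
  let ?R = "\<lambda>r. of_nat (Suc r) :: complex"
  have sums: "(\<lambda>r. (of_nat (m - 1) + 2 * ?R r) * gauss t (of_nat (m - 1) * t) (?R r)
      - 2 * ((of_nat m + 2 * ?R r) * gauss t (of_nat m * t) (?R r))
      + (of_nat (m + 1) + 2 * ?R r) * gauss t (of_nat (m + 1) * t) (?R r)) sums
     (A_ser (m - 1) q - 2 * A_ser m q + A_ser (m + 1) q)"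
    by (intro sums_add sums_diff sums_mult A)
  have eq: "(of_nat (m - 1) + 2 * x) * gauss t (of_nat (m - 1) * t) x
      - 2 * ((of_nat m + 2 * x) * gauss t (of_nat m * t) x)
      + (of_nat (m + 1) + 2 * x) * gauss t (of_nat (m + 1) * t) x
      = - (gauss_rem1 t s x / t + t * (gauss1 t s x - gauss1 0 s x) + t * gauss1 0 s x)" for x
  proof -
    have 1: "gauss t (of_nat (m - 1) * t) x = gauss t s x * exp (t * x)"
      "gauss t (of_nat (m + 1) * t) x = gauss t s x * exp (- (t * x))"
      using m by (simp_all add: gauss_def s_def of_nat_diff algebra_simps flip: exp_add)
    define E E' where "E = exp (t * x)" and "E' = exp (- (t * x))"
    have 2: "of_nat (m - 1) = (of_nat m - 1 :: complex)" using m by (simp add: of_nat_diff)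
    have "t * ((of_nat (m - 1) + 2 * x) * gauss t (of_nat (m - 1) * t) x
      - 2 * ((of_nat m + 2 * x) * gauss t (of_nat m * t) x)
      + (of_nat (m + 1) + 2 * x) * gauss t (of_nat (m + 1) * t) x)
      = - (gauss_rem1 t s x + t^2 * gauss1 t s x)"
      unfolding 1 gauss_rem1_def gauss1_def cosh_rem_def cosh_rem1_def Let_def s_def[symmetric]
      unfolding E_def[symmetric] E'_def[symmetric] 2
      by (simp add: s_def algebra_simps power2_eq_square)
    then show ?thesis using tnz by (simp add: field_simps power2_eq_square)
  qed
  have r: "summable (\<lambda>r. gauss_rem1 t s (?R r))"
    using norm_gauss_rem1_sum_le(1)[OF t m'] by (simp add: s_def)
  have g: "summable (\<lambda>r. gauss1 t s (?R r))" "summable (\<lambda>r. gauss1 0 s (?R r))"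
    by (rule power2_gauss_tendsto_0(3); use t s in simp)+
  have "(\<lambda>r. - (gauss_rem1 t s (?R r) / t + t * (gauss1 t s (?R r) - gauss1 0 s (?R r)) + t * gauss1 0 s (?R r))) sums
      - ((\<Sum>r. gauss_rem1 t s (?R r)) / t + t * (\<Sum>r. gauss1 t s (?R r) - gauss1 0 s (?R r)) + t * (\<Sum>r. gauss1 0 s (?R r)))"
    by (intro sums_minus sums_add sums_divide sums_mult summable_sums r g summable_diff)
  then have "A_ser (m - 1) q - 2 * A_ser m q + A_ser (m + 1) q =
      - ((\<Sum>r. gauss_rem1 t s (?R r)) / t + t * (\<Sum>r. gauss1 t s (?R r) - gauss1 0 s (?R r)) + t * (\<Sum>r. gauss1 0 s (?R r)))"
    using sums unfolding eq by (rule sums_unique2[symmetric])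
  moreover have "profile_sum m t = - (t * (\<Sum>r. gauss1 0 s (?R r)))"
    by (simp add: profile_sum_def s_def)
  ultimately show ?thesis unfolding C_ser_def q_def[symmetric] by simp
qed

text \<open>Telescoping: the values of \<open>gauss1 0 s\<close> at the integers are differences of
  \<open>H\<close>, a quadratic polynomial times a geometric sequence. Its coefficients are found by
  comparing powers of \<open>r\<close>.\<close>

lemma gauss1_0_sums:
  assumes "Re s > 0"
  defines "w \<equiv> exp (- s)"
  shows "(\<lambda>r. gauss1 0 s (of_nat (Suc r))) sums (w / (1 - w)^2 * (2 - s * (1 + w) / (1 - w)))"
proof -
  define \<alpha> where "\<alpha> = - s / (1 - w)"
  define \<gamma> where "\<gamma> = (2 + 2 * w * \<alpha>) / (1 - w)"
  define \<delta> where "\<delta> = w * (\<alpha> + \<gamma>) / (1 - w)"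
  define H where "H = (\<lambda>r. (\<alpha> * of_nat r ^ 2 + \<gamma> * of_nat r + \<delta>) * gauss 0 s (of_nat r))"
  have "norm w < 1" using assms by simp
  then have w: "1 - w \<noteq> 0" by auto
  have coef: "\<alpha> * (1 - w) = - s" "\<gamma> * (1 - w) = 2 + 2 * w * \<alpha>" "\<delta> * (1 - w) = w * (\<alpha> + \<gamma>)"
    using w by (simp_all add: \<alpha>_def \<gamma>_def \<delta>_def)
  have g: "gauss 0 s (of_nat (Suc r)) = w * gauss 0 s (of_nat r)" for r
    unfolding gauss_def w_def by (simp add: algebra_simps flip: exp_add)
  have "H r - H (Suc r) = gauss1 0 s (of_nat r)" for r
  proof -
    let ?r = "of_nat r :: complex"
    have "(\<alpha> * ?r ^ 2 + \<gamma> * ?r + \<delta>) - w * (\<alpha> * (?r + 1) ^ 2 + \<gamma> * (?r + 1) + \<delta>) =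
        ?r ^ 2 * (\<alpha> * (1 - w)) + ?r * (\<gamma> * (1 - w) - 2 * w * \<alpha>) + (\<delta> * (1 - w) - w * (\<alpha> + \<gamma>))"
      by (simp add: algebra_simps power2_eq_square)
    also have "\<dots> = 2 * ?r - ?r ^ 2 * s" unfolding coef by simp
    finally have "((\<alpha> * ?r ^ 2 + \<gamma> * ?r + \<delta>) - w * (\<alpha> * (?r + 1) ^ 2 + \<gamma> * (?r + 1) + \<delta>)) * gauss 0 s ?r =
        (2 * ?r - ?r ^ 2 * s) * gauss 0 s ?r" by simp
    then show ?thesis
      unfolding H_def g gauss1_def Let_def by (simp add: algebra_simps)
  qed
  moreover have "(\<lambda>r. \<alpha> * (of_nat r ^ 2 * gauss 0 s (of_nat r)) + \<gamma> * (of_nat r ^ 1 * gauss 0 s (of_nat r))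
      + \<delta> * (of_nat r ^ 0 * gauss 0 s (of_nat r))) \<longlonglongrightarrow> \<alpha> * 0 + \<gamma> * 0 + \<delta> * 0"
    using assms by (intro tendsto_intros power_times_gauss_nat_tendsto_0) auto
  then have "H \<longlonglongrightarrow> 0" by (simp add: H_def algebra_simps)
  ultimately have "(\<lambda>r. gauss1 0 s (of_nat r)) sums H 0"
    using telescope_sums'[of H 0] by simp
  moreover have "H 0 = w / (1 - w)^2 * (2 - s * (1 + w) / (1 - w))"
  proof -
    have "\<delta> * (1 - w) ^ 2 = (\<delta> * (1 - w)) * (1 - w)"
      by (simp only: power2_eq_square mult.assoc)
    also have "\<dots> = w * (\<alpha> * (1 - w) + \<gamma> * (1 - w))"
      unfolding coef(3) by (simp add: algebra_simps)
    also have "\<dots> = w * (2 + \<alpha> * (1 + w))"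
      unfolding coef(2) by (simp add: algebra_simps)
    also have "\<dots> = w * (2 - s * (1 + w) / (1 - w))" by (simp add: \<alpha>_def)
    finally have "\<delta> = w * (2 - s * (1 + w) / (1 - w)) / (1 - w) ^ 2" using w by (simp add: eq_divide_eq)
    then show ?thesis by (simp add: H_def gauss_def)
  qed
  ultimately show ?thesis
    by (subst sums_Suc_iff) simp
qed

text \<open>With w = e^(-bm) one has sinh(bm/2)^2 = (1-w)^2/(4w) and coth(bm/2) = (1+w)/(1-w), which
  turns the hyperbolic form of the profile into the value found by
  \<open>gauss1_0_sums\<close>.\<close>

lemma profile_sum_eq_profile:
  assumes "m > 0" "b > 0"
  shows "profile_sum m (of_real b) = of_real (profile m b)"
    and "profile m b = b * (exp (- (b * m)) / (1 - exp (- (b * m)))^2 * (b * m * (1 + exp (- (b * m))) / (1 - exp (- (b * m))) - 2))"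
proof -
  define x where "x = b * m"
  define w where "w = exp (- x)"
  have x: "x > 0" using assms by (simp add: x_def)
  then have w: "0 < w" "w < 1" by (simp_all add: w_def)
  have s: "sinh (x / 2) ^ 2 = (1 - w)^2 / (4 * w)"
  proof -
    have e: "exp (x / 2) ^ 2 = exp x" "exp (- (x / 2)) ^ 2 = exp (- x)" "exp (x / 2) * exp (- (x / 2)) = 1"
      by (simp_all flip: exp_of_nat_mult exp_add)
    have "4 * sinh (x / 2) ^ 2 = exp x - 2 + w"
      using e by (simp add: sinh_def power2_eq_square w_def algebra_simps)
    moreover have "exp x = 1 / w" by (simp add: w_def exp_minus field_simps)
    ultimately show ?thesis using w by (simp add: field_simps power2_eq_square)
  qed
  have c: "coth (x / 2) = (1 + w) / (1 - w)"
  proof -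
    have "exp (- (x / 2)) = exp (x / 2) * w" by (simp add: w_def flip: exp_add)
    then have c: "cosh (x / 2) = exp (x / 2) / 2 * (1 + w)" "sinh (x / 2) = exp (x / 2) / 2 * (1 - w)"
      by (simp_all add: cosh_def sinh_def algebra_simps)
    show ?thesis unfolding coth_def c by simp
  qed
  have "profile m b = b / 4 * (1 / ((1 - w)^2 / (4 * w))) * (x * ((1 + w) / (1 - w)) - 2)"
    using profile_eq[of m b] assms s c by (simp add: x_def)
  also have "\<dots> = b * (w / (1 - w)^2 * (x * (1 + w) / (1 - w) - 2))"
    using w by (simp add: field_simps)
  finally show eq: "profile m b = b * (exp (- (b * m)) / (1 - exp (- (b * m)))^2 * (b * m * (1 + exp (- (b * m))) / (1 - exp (- (b * m))) - 2))"
    unfolding w_def x_def .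
  have "(\<Sum>r. gauss1 0 (of_real m * of_real b) (of_nat (Suc r))) = of_real (w / (1 - w)^2 * (2 - x * (1 + w) / (1 - w)))"
  proof -
    have sx: "of_real m * of_real b = complex_of_real x" by (simp add: x_def mult.commute)
    have ew: "exp (- complex_of_real x) = of_real w" by (simp add: w_def exp_of_real flip: of_real_minus)
    have "Re (complex_of_real x) > 0" using x by simp
    from sums_unique[OF gauss1_0_sums[OF this], symmetric] show ?thesis
      unfolding sx ew by simp
  qed
  then have "profile_sum m (of_real b) = of_real (- (b * (w / (1 - w)^2 * (2 - x * (1 + w) / (1 - w)))))"
    unfolding profile_sum_def by simp
  also have "- (b * (w / (1 - w)^2 * (2 - x * (1 + w) / (1 - w)))) = profile m b"
    unfolding eq w_def x_def by (simp add: algebra_simps)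
  finally show "profile_sum m (of_real b) = of_real (profile m b)" .
qed

section \<open>Bounds for the profile and crude bounds for the series\<close>

lemma y_cosh_minus_sinh_ge: "y * cosh y - sinh y \<ge> y ^ 3 / 3" if "y \<ge> 0" for y :: real
proof -
  have sinh_ge: "sinh z \<ge> z" if "z \<ge> 0" for z :: real
  proof -
    have "sinh 0 - 0 \<le> sinh z - z"
    proof (rule DERIV_nonneg_imp_nondecreasing[OF that])
      fix x :: real
      show "\<exists>y. ((\<lambda>x. sinh x - x) has_real_derivative y) (at x) \<and> 0 \<le> y"
        by (rule exI[of _ "cosh x - 1"]) (auto intro!: derivative_eq_intros simp: cosh_real_ge_1)
    qed
    then show ?thesis by simp
  qed
  have "0 * cosh 0 - sinh 0 - 0 ^ 3 / 3 \<le> y * cosh y - sinh y - y ^ 3 / 3"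
  proof (rule DERIV_nonneg_imp_nondecreasing[OF that])
    fix x :: real assume x: "0 \<le> x" "x \<le> y"
    show "\<exists>d. ((\<lambda>x. x * cosh x - sinh x - x ^ 3 / 3) has_real_derivative d) (at x) \<and> 0 \<le> d"
    proof (intro exI conjI)
      show "((\<lambda>x. x * cosh x - sinh x - x ^ 3 / 3) has_real_derivative x * (sinh x - x)) (at x)"
        by (auto intro!: derivative_eq_intros simp: algebra_simps power2_eq_square)
      show "0 \<le> x * (sinh x - x)" using sinh_ge x by simp
    qed
  qed
  then show ?thesis by simp
qed

text \<open>With w = e^(-bm) the profile is b w Q/(1-w)^2, and Q vanishes at bm = 0 to the same
  second order as (1-w)^2; hence the aim Q >= (1-w)^2/30. For y = bm/2 >= 2 already Q >= 2. For
  smaller y, y cosh y - sinh y >= y^3/3 and sinh y <= 5y give Q >= 2y^2/15, while (1-w)^2 <=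
  (2y)^2.\<close>

lemma profile_ge:
  assumes "m > 0" "b > 0"
  shows "profile m b \<ge> b * exp (- (b * m)) / 30"
proof -
  define x where "x = b * m"
  define w where "w = exp (- x)"
  define y where "y = x / 2"
  have x: "x > 0" using assms by (simp add: x_def)
  then have w: "0 < w" "w < 1" by (simp_all add: w_def)
  have y: "y > 0" using x by (simp add: y_def)
  define Q where "Q = x * (1 + w) / (1 - w) - 2"
  have Q_eq: "Q = 2 * ((y * cosh y - sinh y) / sinh y)"
  proof -
    have "exp (- y) = exp y * w" by (simp add: w_def y_def flip: exp_add)
    note e = this
    define a where "a = exp y / 2"
    then have "exp y = 2 * a" by simp
    then have c: "cosh y = a * (1 + w)" "sinh y = a * (1 - w)"
      unfolding cosh_def sinh_def e by (simp_all add: algebra_simps)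
    have "a > 0" "1 - w > 0" using w by (simp_all add: a_def)
    moreover have "y * (a * (1 + w)) - a * (1 - w) = a * (y * (1 + w) - (1 - w))"
      by (simp add: algebra_simps)
    ultimately have "(y * cosh y - sinh y) / sinh y = (y * (1 + w) - (1 - w)) / (1 - w)"
      unfolding c by simp
    also have "\<dots> = y * (1 + w) / (1 - w) - 1" using \<open>1 - w > 0\<close> by (simp add: diff_divide_distrib)
    finally have *: "(y * cosh y - sinh y) / sinh y = y * (1 + w) / (1 - w) - 1" .
    have "x = 2 * y" by (simp add: y_def)
    then show ?thesis unfolding Q_def * by simp
  qed
  have sinh: "sinh y > 0" using y by simp
  have "Q \<ge> (1 - w)^2 / 30"
  proof (cases "y \<ge> 2")
    case True
    have "sinh y \<le> y * cosh y - sinh y"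
    proof -
      have "2 * sinh y \<le> 2 * cosh y" using sinh_less_cosh_real[of y] by simp
      also have "\<dots> \<le> y * cosh y" using True by (intro mult_right_mono) (auto simp: cosh_real_nonneg)
      finally show ?thesis by simp
    qed
    then have "Q \<ge> 2" unfolding Q_eq using sinh by (simp add: pos_le_divide_eq)
    moreover have "(1 - w)^2 \<le> 1 ^ 2" using w by (intro power_mono) auto
    ultimately show ?thesis by simp
  next
    case False
    have "exp (2 :: real) = exp 1 * exp 1" by (simp flip: exp_add)
    also have "\<dots> \<le> 3 * 3" by (intro mult_mono exp_le) auto
    finally have e2: "exp (2 :: real) \<le> 9" by simp
    have "exp (- 2) \<le> exp (0 :: real)" by (subst exp_le_cancel_iff) simp
    with e2 have "exp 2 + exp (- 2) \<le> (10 :: real)" unfolding exp_zero by linarith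
    then have "cosh (2 :: real) \<le> 5" unfolding cosh_def by simp
    moreover have "cosh y \<le> cosh 2" using y False by (subst cosh_real_nonneg_le_iff) auto
    ultimately have "cosh y \<le> 5" by linarith
    have "0 \<le> y ^ 3 / 3" using y by simp
    then have le: "sinh y \<le> y * cosh y" using y_cosh_minus_sinh_ge[of y] y by linarith
    also have "\<dots> \<le> y * 5" using \<open>cosh y \<le> 5\<close> y by (intro mult_left_mono) auto
    finally have "y ^ 3 / 3 / (y * 5) \<le> (y * cosh y - sinh y) / sinh y"
      using y_cosh_minus_sinh_ge[of y] y sinh le by (intro frac_le) auto
    then have "Q \<ge> 2 * (y^2 / 15)"
      unfolding Q_eq using y by (simp add: power2_eq_square power3_eq_cube field_simps)
    moreover have "(1 - w)^2 \<le> (2 * y)^2"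
    proof (rule power_mono)
      show "1 - w \<le> 2 * y" using exp_ge_add_one_self[of "- x"] by (simp add: w_def y_def)
    qed (use w in simp)
    ultimately show ?thesis by (simp add: power_mult_distrib)
  qed
  then have "b * (w / (1 - w)^2 * ((1 - w)^2 / 30)) \<le> b * (w / (1 - w)^2 * Q)"
    using assms w by (intro mult_left_mono) auto
  also have "b * (w / (1 - w)^2 * Q) = profile m b"
    unfolding profile_sum_eq_profile(2)[OF assms] Q_def w_def x_def by simp
  finally have "b * (w / (1 - w)^2 * ((1 - w)^2 / 30)) \<le> profile m b" .
  moreover have "w / (1 - w)^2 * ((1 - w)^2 / 30) = w / 30" using w by simp
  ultimately show ?thesis by (simp add: w_def x_def)
qed

lemma inverse_one_minus_exp_le: "1 / (1 - exp (- x)) \<le> 1 + 1 / x" if "x > 0" for x :: real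
proof -
  have "1 + x \<le> exp x" by (rule exp_ge_add_one_self)
  then have "exp (- x) \<le> 1 / (1 + x)" using that by (simp add: exp_minus field_simps)
  then have "x / (1 + x) \<le> 1 - exp (- x)" using that by (simp add: field_simps)
  then have "1 / (1 - exp (- x)) \<le> 1 / (x / (1 + x))" using that by (intro divide_left_mono) auto
  then show ?thesis using that by (simp add: add_divide_distrib)
qed

text \<open>Crude but uniform in \<open>m\<close>: it serves away from the real axis, where any
  fixed power of 1/b is affordable. The factor x = bm is compensated by x e^(-x) <= 1.\<close>

lemma abs_profile_le:
  assumes "m \<ge> 1" "b > 0" "b \<le> 1"
  shows "\<bar>profile m b\<bar> \<le> 16 / b ^ 2"
proof -
  define x where "x = b * m"
  define w where "w = exp (- x)"
  have "b * 1 \<le> b * m" using assms by (intro mult_left_mono) auto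
  then have x: "x \<ge> b" "x > 0" using assms unfolding x_def by linarith+
  then have w: "0 < w" "w < 1" by (simp_all add: w_def)
  have i: "1 / (1 - w) \<le> 2 / b"
  proof -
    have "w \<le> exp (- b)" using x by (simp add: w_def)
    moreover have "exp (- b) < 1" using assms by simp
    ultimately have "1 / (1 - w) \<le> 1 / (1 - exp (- b))"
      using w by (intro divide_left_mono mult_pos_pos) auto
    also have "\<dots> \<le> 1 + 1 / b" using inverse_one_minus_exp_le[of b] assms by simp
    also have "\<dots> \<le> 2 / b" using assms by (simp add: field_simps)
    finally show ?thesis .
  qed
  have xw: "x * w \<le> 1" 
  proof -
    have "x \<le> exp x" using exp_ge_add_one_self[of x] by linarith
    then show ?thesis by (simp add: w_def exp_minus field_simps)
  qed
  have i2: "1 / (1 - w)^2 \<le> 4 / b^2"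
    using power_mono[OF i, of 2] w by (simp add: power_divide)
  have i3: "1 / (1 - w)^3 \<le> 8 / b^3"
    using power_mono[OF i, of 3] w by (simp add: power_divide)
  have "profile m b = b * (x * w * (1 + w) * (1 / (1 - w)^3) - 2 * w * (1 / (1 - w)^2))"
    unfolding profile_sum_eq_profile(2)[OF order_less_le_trans[OF zero_less_one assms(1)] assms(2)]
      w_def[symmetric] x_def[symmetric]
  proof -
    have "b * (w / D^2 * (x * (1 + w) / D - 2)) = b * (x * w * (1 + w) * (1 / D^3) - 2 * w * (1 / D^2))"
      if "D \<noteq> 0" for D :: real
      using that by (simp add: field_simps power2_eq_square power3_eq_cube)
    then show "b * (w / (1 - w)^2 * (x * (1 + w) / (1 - w) - 2)) = b * (x * w * (1 + w) * (1 / (1 - w)^3) - 2 * w * (1 / (1 - w)^2))"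
      using w by simp
  qed
  also have "\<bar>\<dots>\<bar> \<le> b * (1 * 2 * (8 / b^3))"
  proof -
    have "x * w * (1 + w) * (1 / (1 - w)^3) \<le> 1 * 2 * (8 / b^3)"
      using w x xw by (intro mult_mono i3) auto
    moreover have "2 * w * (1 / (1 - w)^2) \<le> 2 * 1 * (4 / b^2)"
      using w by (intro mult_mono i2) auto
    moreover have "2 * 1 * (4 / b^2) \<le> 1 * 2 * (8 / b^3)"
      using assms by (simp add: field_simps power2_eq_square power3_eq_cube)
    moreover have "0 \<le> x * w * (1 + w) * (1 / (1 - w)^3)" "0 \<le> 2 * w * (1 / (1 - w)^2)"
      using w x by simp_all
    ultimately have "\<bar>x * w * (1 + w) * (1 / (1 - w)^3) - 2 * w * (1 / (1 - w)^2)\<bar> \<le> 1 * 2 * (8 / b^3)"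
      by linarith
    from mult_left_mono[OF this, of b] show ?thesis
      unfolding abs_mult abs_of_pos[OF assms(2)] using assms(2) by simp
  qed
  also have "\<dots> = 16 / b ^ 2" using assms by (simp add: power2_eq_square power3_eq_cube)
  finally show ?thesis .
qed

text \<open>Counterpart of \<open>abs_profile_le\<close> for the series; the linear growth in
  \<open>m\<close> is later controlled by m <= k/b^3.\<close>

lemma norm_A_ser_le_crude:
  assumes "Re t > 0" "Re t \<le> 1"
  shows "norm (A_ser m (exp (- t))) \<le> 8 * real (m + 1) / Re t ^ 2"
proof -
  define w where "w = exp (- Re t)"
  have w: "0 < w" "w < 1" using assms by (simp_all add: w_def)
  have nq: "norm (exp (- t)) = w" by (simp add: w_def)
  have gs: "(\<lambda>r. real (Suc r) * w ^ r) sums (1 / (1 - w)^2)"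
    using w by (intro geometric_deriv_sums) simp
  have gs2: "(\<lambda>r. real (m + 1) * (2 * (real (Suc r) * w ^ r))) sums (real (m + 1) * (2 * (1 / (1 - w)^2)))"
    by (intro sums_mult gs)
  have "norm (A_ser m (exp (- t))) \<le> real (m + 1) * (2 * (1 / (1 - w)^2))"
    unfolding A_ser_def sums_unique[OF gs2]
  proof (rule norm_suminf_le[OF _ sums_summable[OF gs2]])
    fix r
    have "norm (of_nat (m + 2 * Suc r) * exp (- t) ^ (Suc r * (Suc r + m))) \<le>
       (real (m + 1) * w ^ m) * (2 * (real (Suc r) * w ^ Suc r))"
      using A_ser_term_bound[of "exp (- t)" m r] w unfolding nq by blast
    also have "\<dots> \<le> (real (m + 1) * 1) * (2 * (real (Suc r) * w ^ r))"
      using w by (intro mult_mono power_le_one) (auto simp: mult_left_le_one_le)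
    finally show "norm (of_nat (m + 2 * Suc r) * exp (- t) ^ (Suc r * (Suc r + m))) \<le> real (m + 1) * (2 * (real (Suc r) * w ^ r))"
      by simp
  qed
  also have "1 / (1 - w)^2 \<le> 4 / Re t ^ 2"
  proof -
    have "1 / (1 - w) \<le> 1 + 1 / Re t" unfolding w_def by (rule inverse_one_minus_exp_le) fact
    also have "\<dots> \<le> 2 / Re t" using assms by (simp add: field_simps)
    finally have "(1 / (1 - w))^2 \<le> (2 / Re t)^2" using w by (intro power_mono) auto
    then show ?thesis by (simp add: power_divide)
  qed
  then have "real (m + 1) * (2 * (1 / (1 - w)^2)) \<le> real (m + 1) * (2 * (4 / Re t ^ 2))"
    by (intro mult_left_mono) auto
  finally show ?thesis by (simp add: algebra_simps)
qed

text \<open>With s = m z the two expressions are the derivatives in z of z times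
  \<open>gauss1 0 s x\<close> and of z times \<open>gauss4 0 s x\<close>. The constants are 4 * 4096
  and 144 * 4096: half of the exponential decay pays for the polynomials in Z = x Re s.\<close>

lemma profile_kernel_bounds:
  fixes s :: complex and x :: real
  assumes s: "Re s > 0" "norm s \<le> 2 * Re s" and x: "x \<ge> 0"
  defines "X \<equiv> complex_of_real x"
  shows "norm ((2 * X - 4 * s * X^2 + s^2 * X^3) * gauss 0 s X) \<le> 16384 * x * exp (- (Re s * x / 2))"
    and "norm ((36 * s^2 - 44 * X * s^3 + 13 * X^2 * s^4 - X^3 * s^5) * gauss 0 s X) \<le>
      589824 * Re s ^ 2 * exp (- (Re s * x / 2))"
proof -
  define \<sigma> where "\<sigma> = Re s"
  define Z where "Z = \<sigma> * x"
  have \<sigma>: "\<sigma> > 0" and Z: "Z \<ge> 0" using s x by (auto simp: \<sigma>_def Z_def)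
  have nX: "norm X = x" using x by (simp add: X_def)
  have ng: "norm (gauss 0 s X) = exp (- Z)" using norm_gauss[of 0 s x] by (simp add: X_def Z_def \<sigma>_def)
  have sp: "norm s ^ n \<le> 2 ^ n * \<sigma> ^ n" for n
    using power_mono[OF s(2), of n] by (simp add: \<sigma>_def power_mult_distrib)
  have e: "(1 + Z) ^ 4 * exp (- Z) \<le> 4096 * exp (- (Z / 2))"
  proof -
    have "(1 + Z) ^ 4 * exp (- Z) \<le> (4096 * exp (Z / 2)) * exp (- Z)"
      by (intro mult_right_mono one_plus_power4_le Z) simp
    also have "\<dots> = 4096 * exp (- (Z / 2))" by (simp add: mult_exp_exp)
    finally show ?thesis .
  qed
  have "norm (2 * X - 4 * s * X^2 + s^2 * X^3) \<le> 2 * x + 4 * (norm s * x^2) + norm s ^ 2 * x^3"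
    by (rule order_trans[OF norm_triangle_ineq], rule add_mono, rule order_trans[OF norm_triangle_ineq4])
       (simp_all add: norm_mult norm_power nX)
  also have "\<dots> \<le> 2 * x + 4 * (2 * \<sigma> * x^2) + (2^2 * \<sigma>^2) * x^3"
    using sp[of 1] sp[of 2] x by (intro add_mono mult_left_mono mult_right_mono) auto
  also have "\<dots> = x * (2 + 8 * Z + 4 * Z^2)"
    by (simp add: Z_def algebra_simps power2_eq_square power3_eq_cube)
  also have "\<dots> \<le> x * (4 * (1 + Z) ^ 4)"
  proof (rule mult_left_mono[OF _ x])
    have "4 * (1 + Z) ^ 4 - (2 + 8 * Z + 4 * Z^2) = 2 + 8 * Z + 20 * Z^2 + 16 * Z^3 + 4 * Z^4"
      by (simp add: algebra_simps eval_nat_numeral)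
    moreover have "\<dots> \<ge> 0" using Z by simp
    ultimately show "2 + 8 * Z + 4 * Z^2 \<le> 4 * (1 + Z) ^ 4" by linarith
  qed
  finally have "norm (2 * X - 4 * s * X^2 + s^2 * X^3) * exp (- Z) \<le> x * (4 * (1 + Z) ^ 4) * exp (- Z)"
    by (intro mult_right_mono) auto
  also have "\<dots> = (4 * x) * ((1 + Z) ^ 4 * exp (- Z))" by simp
  also have "\<dots> \<le> (4 * x) * (4096 * exp (- (Z / 2)))" by (rule mult_left_mono[OF e]) (use x in simp)
  finally show "norm ((2 * X - 4 * s * X^2 + s^2 * X^3) * gauss 0 s X) \<le> 16384 * x * exp (- (Re s * x / 2))"
    unfolding norm_mult ng by (simp add: Z_def \<sigma>_def)
  have "norm (36 * s^2 - 44 * X * s^3 + 13 * X^2 * s^4 - X^3 * s^5) \<le>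
      36 * norm s^2 + 44 * x * norm s^3 + 13 * x^2 * norm s^4 + x^3 * norm s^5"
    by (rule order_trans[OF norm_triangle_ineq4], rule add_mono, rule order_trans[OF norm_triangle_ineq], rule add_mono,
        rule order_trans[OF norm_triangle_ineq4]) (simp_all add: norm_mult norm_power nX)
  also have "\<dots> \<le> 36 * (2^2 * \<sigma>^2) + 44 * x * (2^3 * \<sigma>^3) + 13 * x^2 * (2^4 * \<sigma>^4) + x^3 * (2^5 * \<sigma>^5)"
    using x by (intro add_mono mult_left_mono sp) auto
  also have "\<dots> = \<sigma>^2 * (144 + 352 * Z + 208 * Z^2 + 32 * Z^3)"
    by (simp add: Z_def algebra_simps eval_nat_numeral)
  also have "\<dots> \<le> \<sigma>^2 * (144 * (1 + Z) ^ 4)"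
  proof (rule mult_left_mono)
    have "144 * (1 + Z) ^ 4 - (144 + 352 * Z + 208 * Z^2 + 32 * Z^3) = 224 * Z + 656 * Z^2 + 544 * Z^3 + 144 * Z^4"
      by (simp add: algebra_simps eval_nat_numeral)
    moreover have "\<dots> \<ge> 0" using Z by simp
    ultimately show "144 + 352 * Z + 208 * Z^2 + 32 * Z^3 \<le> 144 * (1 + Z) ^ 4" by linarith
  qed simp
  finally have "norm (36 * s^2 - 44 * X * s^3 + 13 * X^2 * s^4 - X^3 * s^5) * exp (- Z) \<le> \<sigma>^2 * (144 * (1 + Z) ^ 4) * exp (- Z)"
    by (intro mult_right_mono) auto
  also have "\<dots> = (144 * \<sigma>^2) * ((1 + Z) ^ 4 * exp (- Z))" by simp
  also have "\<dots> \<le> (144 * \<sigma>^2) * (4096 * exp (- (Z / 2)))" by (rule mult_left_mono[OF e]) simp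
  finally show "norm ((36 * s^2 - 44 * X * s^3 + 13 * X^2 * s^4 - X^3 * s^5) * gauss 0 s X) \<le>
      589824 * Re s ^ 2 * exp (- (Re s * x / 2))"
    unfolding norm_mult ng by (simp add: Z_def \<sigma>_def)
qed

section \<open>Passing from a point of the sector to its real part\<close>

lemma vertical_segment:
  assumes "Re t > 0" "\<bar>Im t\<bar> \<le> Re t" "z \<in> closed_segment (of_real (Re t)) t"
  shows "Re z = Re t" "norm z \<le> 2 * Re z"
proof -
  obtain u where u: "0 \<le> u" "u \<le> 1" "z = (1 - u) *\<^sub>R of_real (Re t) + u *\<^sub>R t"
    using assms(3) by (auto simp: in_segment)
  show Re: "Re z = Re t" by (simp add: u algebra_simps)
  have "\<bar>Im z\<bar> \<le> 1 * \<bar>Im t\<bar>"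
    using u by (simp add: u(3) abs_mult mult_left_le_one_le)
  then show "norm z \<le> 2 * Re z" using cmod_le[of z] assms Re by simp
qed

lemma norm_diff_vertical_le:
  assumes t: "Re t > 0" "\<bar>Im t\<bar> \<le> Re t"
    and D: "\<And>z. Re z > 0 \<Longrightarrow> norm z \<le> 2 * Re z \<Longrightarrow> (f has_field_derivative f' z) (at z)"
    and B: "\<And>z. Re z = Re t \<Longrightarrow> norm z \<le> 2 * Re z \<Longrightarrow> norm (f' z) \<le> B"
  shows "norm (f t - f (of_real (Re t))) \<le> B * \<bar>Im t\<bar>"
proof -
  let ?S = "closed_segment (of_real (Re t)) t"
  have "norm (f t - f (of_real (Re t))) \<le> B * norm (t - of_real (Re t))"
  proof (rule field_differentiable_bound[of ?S])
    fix z assume z: "z \<in> ?S"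
    note * = vertical_segment[OF t z]
    show "(f has_field_derivative f' z) (at z within ?S)"
      by (rule has_field_derivative_at_within[OF D]) (use * t in auto)
    show "norm (f' z) \<le> B" by (rule B) (use * in auto)
  qed auto
  moreover have "t - of_real (Re t) = \<i> * of_real (Im t)" by (simp add: complex_eq_iff)
  ultimately show ?thesis by (simp add: norm_mult)
qed

text \<open>Differentiating term by term leads to the sum of r e^(-\<sigma>r/2) with \<sigma> = m Re
  t, which is bounded only while \<sigma> stays away from 0. For \<sigma> < 1 the Euler-Maclaurin
  rule is used instead: the boundary term is (t - Re t)/6, and the fourth derivative carries
  \<sigma>^2, which outweighs the factor 1/\<sigma> from the geometric sum. The second constant is 3
  * 589824 + 1.\<close>

lemma profile_sum_Lipschitz:
  "\<exists>C\<ge>0. \<forall>t m. Re t > 0 \<longrightarrow> \<bar>Im t\<bar> \<le> Re t \<longrightarrow> m > 0 \<longrightarrow>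
     norm (profile_sum m t - profile_sum m (of_real (Re t))) \<le> C * \<bar>Im t\<bar>"
proof -
  define K where "K = (\<Sum>r. 16384 * (real (Suc r) * exp (- 1 / 2) ^ Suc r))"
  have sK: "summable (\<lambda>r. 16384 * (real (Suc r) * exp (- 1 / 2) ^ Suc r))"
    by (intro summable_mult summable_Suc_times_power) auto
  have K0: "K \<ge> 0" unfolding K_def by (intro suminf_nonneg sK) simp
  have "norm (profile_sum m t - profile_sum m (of_real (Re t))) \<le> (K + 1769473) * \<bar>Im t\<bar>"
    if t: "Re t > 0" "\<bar>Im t\<bar> \<le> Re t" and m: "m > 0" for t m
  proof -
    define b where "b = Re t"
    define \<sigma> where "\<sigma> = b * m"
    define p where "p = (\<lambda>z x. z * gauss1 0 (of_real m * z) x)"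
    have b: "b > 0" using t by (simp add: b_def)
    have \<sigma>: "\<sigma> > 0" using b m by (simp add: \<sigma>_def)
    have sp: "Re (of_real m * z) > 0" "norm (of_real m * z) \<le> 2 * Re (of_real m * z)" "Re (of_real m * z) = \<sigma>"
      if "Re z = b" "norm z \<le> 2 * Re z" for z
      using that m b by (auto simp: norm_mult \<sigma>_def mult_ac)
    have tz: "norm t \<le> 2 * Re t" using cmod_le[of t] t by linarith
    have s: "summable (\<lambda>r. p z (of_nat (Suc r)))" if "Re z > 0" for z
      unfolding p_def using that m by (intro summable_mult power2_gauss_tendsto_0) auto
    have st: "summable (\<lambda>r. p t (of_nat (Suc r)))" "summable (\<lambda>r. p (of_real b) (of_nat (Suc r)))"
      by (rule s; use t b in simp)+
    have "profile_sum m z = - (\<Sum>r. p z (of_nat (Suc r)))" if "Re z > 0" for z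
      unfolding profile_sum_def p_def using that m by (subst suminf_mult) (auto intro!: power2_gauss_tendsto_0(3) simp del: of_nat_Suc)
    then have "profile_sum m t - profile_sum m (of_real b) = - ((\<Sum>r. p t (of_nat (Suc r))) - (\<Sum>r. p (of_real b) (of_nat (Suc r))))"
      using t b by simp
    also have "\<dots> = - (\<Sum>r. p t (of_nat (Suc r)) - p (of_real b) (of_nat (Suc r)))"
      by (simp only: suminf_diff[OF st])
    finally have P: "norm (profile_sum m t - profile_sum m (of_real b)) =
        norm (\<Sum>r. p t (of_nat (Suc r)) - p (of_real b) (of_nat (Suc r)))" by simp
    have "norm (\<Sum>r. p t (of_nat (Suc r)) - p (of_real b) (of_nat (Suc r))) \<le> (K + 1769473) * \<bar>Im t\<bar>"
    proof (cases "\<sigma> \<ge> 1")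
      case True
      have bound: "norm (p t (of_nat (Suc r)) - p (of_real b) (of_nat (Suc r))) \<le>
          16384 * (real (Suc r) * exp (- 1 / 2) ^ Suc r) * \<bar>Im t\<bar>" for r
        unfolding b_def
      proof (rule norm_diff_vertical_le[OF t])
        fix z :: complex
        let ?x = "of_nat (Suc r) :: complex" and ?s = "of_real m * z"
        show "((\<lambda>z. p z ?x) has_field_derivative (2 * ?x - 4 * ?s * ?x^2 + ?s^2 * ?x^3) * gauss 0 ?s ?x) (at z)"
          unfolding p_def gauss1_def gauss_def Let_def
          by (rule derivative_eq_intros refl | simp)+ (simp add: algebra_simps power2_eq_square power3_eq_cube)
        assume z: "Re z = Re t" "norm z \<le> 2 * Re z"
        then have z': "Re z = b" by (simp add: b_def)
        note k = profile_kernel_bounds(1)[OF sp(1,2)[OF z' z(2)], of "real (Suc r)", unfolded of_real_of_nat_eq sp(3)[OF z' z(2)]]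
        have "exp (- (\<sigma> * real (Suc r) / 2)) \<le> exp (- (1 * real (Suc r) / 2))"
          using mult_right_mono[OF True, of "real (Suc r)"] by (simp del: of_nat_Suc)
        also have "\<dots> = exp (- 1 / 2) ^ Suc r"
          unfolding exp_of_nat_mult[symmetric] by (rule arg_cong[of _ _ exp]) simp
        finally have "16384 * real (Suc r) * exp (- (\<sigma> * real (Suc r) / 2)) \<le> 16384 * real (Suc r) * exp (- 1 / 2) ^ Suc r"
          by (intro mult_left_mono) auto
        with k show "norm ((2 * ?x - 4 * ?s * ?x^2 + ?s^2 * ?x^3) * gauss 0 ?s ?x) \<le> 16384 * (real (Suc r) * exp (- 1 / 2) ^ Suc r)"
          unfolding mult.assoc[of 16384] by linarith
      qed
      have "norm (\<Sum>r. p t (of_nat (Suc r)) - p (of_real b) (of_nat (Suc r))) \<le>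
          (\<Sum>r. 16384 * (real (Suc r) * exp (- 1 / 2) ^ Suc r) * \<bar>Im t\<bar>)"
        by (rule norm_suminf_le[OF bound summable_mult2[OF sK]])
      also have "\<dots> = K * \<bar>Im t\<bar>" unfolding K_def by (rule suminf_mult2[OF sK, symmetric])
      also have "\<dots> \<le> (K + 1769473) * \<bar>Im t\<bar>" by (intro mult_right_mono) auto
      finally show ?thesis .
    next
      case False
      define e where "e = exp (- (\<sigma> / 2))"
      have e: "0 < e" "e < 1" using \<sigma> by (simp_all add: e_def)
      define B where "B = (\<lambda>r. 589824 * \<sigma> ^ 2 * \<bar>Im t\<bar> * e ^ r)"
      have gs: "B sums (589824 * \<sigma> ^ 2 * \<bar>Im t\<bar> * (1 / (1 - e)))"
        unfolding B_def using e by (intro sums_mult geometric_sums) auto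
      let ?s = "\<lambda>z. of_real m * z"
      have "norm ((\<Sum>r. p t (of_nat (Suc r)) - p (of_real b) (of_nat (Suc r))) +
          (t * gauss2 0 (?s t) 0 - of_real b * gauss2 0 (?s (of_real b)) 0) / 12) \<le> suminf B"
        unfolding p_def
      proof (rule Euler_Maclaurin_deriv_le[where
          F = "\<lambda>x. t * (x^2 * gauss 0 (?s t) x) - of_real b * (x^2 * gauss 0 (?s (of_real b)) x)" and
          Fc = "\<lambda>x. t * gauss3 0 (?s t) x - of_real b * gauss3 0 (?s (of_real b)) x" and
          Fd = "\<lambda>x. t * gauss4 0 (?s t) x - of_real b * gauss4 0 (?s (of_real b)) x" and
          F' = "\<lambda>x. t * gauss1 0 (?s t) x - of_real b * gauss1 0 (?s (of_real b)) x" and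
          F'' = "\<lambda>x. t * gauss2 0 (?s t) x - of_real b * gauss2 0 (?s (of_real b)) x"])
        fix r x assume rx: "real r \<le> x" "x \<le> real r + 1"
        then have x: "x \<ge> 0" by linarith
        let ?X = "complex_of_real x"
        have "norm (t * gauss4 0 (?s t) ?X - of_real (Re t) * gauss4 0 (?s (of_real (Re t))) ?X) \<le>
            (589824 * \<sigma> ^ 2 * e ^ r) * \<bar>Im t\<bar>"
        proof (rule norm_diff_vertical_le[OF t])
          fix z :: complex
          show "((\<lambda>z. z * gauss4 0 (?s z) ?X) has_field_derivative
             (36 * (?s z)^2 - 44 * ?X * (?s z)^3 + 13 * ?X^2 * (?s z)^4 - ?X^3 * (?s z)^5) * gauss 0 (?s z) ?X) (at z)"
            unfolding gauss4_def gauss_def Let_def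
            by (rule derivative_eq_intros refl | simp)+ (simp add: algebra_simps eval_nat_numeral)
          assume z: "Re z = Re t" "norm z \<le> 2 * Re z"
          then have z': "Re z = b" by (simp add: b_def)
          note k = profile_kernel_bounds(2)[OF sp(1,2)[OF z' z(2)] x, unfolded sp(3)[OF z' z(2)]]
          have "exp (- (\<sigma> * x / 2)) \<le> exp (- (\<sigma> * real r / 2))" using rx \<sigma> by simp
          also have "\<dots> = e ^ r" by (simp add: e_def mult.commute flip: exp_of_nat_mult)
          finally have "589824 * \<sigma>^2 * exp (- (\<sigma> * x / 2)) \<le> 589824 * \<sigma>^2 * e ^ r"
            by (intro mult_left_mono) auto
          with k show "norm ((36 * (?s z)^2 - 44 * ?X * (?s z)^3 + 13 * ?X^2 * (?s z)^4 - ?X^3 * (?s z)^5) * gauss 0 (?s z) ?X)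
              \<le> 589824 * \<sigma> ^ 2 * e ^ r" by linarith
        qed
        then show "norm (t * gauss4 0 (?s t) ?X - of_real b * gauss4 0 (?s (of_real b)) ?X) \<le> B r"
          by (simp add: B_def b_def mult_ac)
      next
        show "summable B" using gs by (rule sums_summable)
        have Re: "Re (?s t) > 0" "Re (?s (of_real b)) > 0" using t b m by auto
        have "(\<lambda>r. t * (of_nat r^2 * gauss 0 (?s t) (of_nat r)) - of_real b * (of_nat r^2 * gauss 0 (?s (of_real b)) (of_nat r))) \<longlonglongrightarrow> t * 0 - of_real b * 0"
          using Re by (intro tendsto_intros power2_gauss_tendsto_0) auto
        then show "(\<lambda>r. t * (of_nat r^2 * gauss 0 (?s t) (of_nat r)) - of_real b * (of_nat r^2 * gauss 0 (?s (of_real b)) (of_nat r))) \<longlonglongrightarrow> 0" by simp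
        have "(\<lambda>r. t * gauss2 0 (?s t) (of_nat r) - of_real b * gauss2 0 (?s (of_real b)) (of_nat r)) \<longlonglongrightarrow> t * 0 - of_real b * 0"
          using Re by (intro tendsto_intros power2_gauss_tendsto_0) auto
        then show "(\<lambda>r. t * gauss2 0 (?s t) (of_nat r) - of_real b * gauss2 0 (?s (of_real b)) (of_nat r)) \<longlonglongrightarrow> 0" by simp
        show "summable (\<lambda>r. t * gauss1 0 (?s t) (of_nat (Suc r)) - of_real b * gauss1 0 (?s (of_real b)) (of_nat (Suc r)))"
          using summable_diff[OF st] by (simp add: p_def)
      qed (intro DERIV_diff DERIV_cmult has_field_derivative_gauss1 has_field_derivative_gauss2
          has_field_derivative_gauss3 has_field_derivative_gauss4 | simp)+
      also have "suminf B = 589824 * \<sigma> ^ 2 * \<bar>Im t\<bar> * (1 / (1 - e))" using gs by (rule sums_unique[symmetric])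
      also have "\<dots> \<le> 589824 * \<sigma> ^ 2 * \<bar>Im t\<bar> * (1 + 1 / (\<sigma> / 2))"
        unfolding e_def by (intro mult_left_mono inverse_one_minus_exp_le) (use \<sigma> in auto)
      also have "\<dots> = 589824 * \<bar>Im t\<bar> * (\<sigma> ^ 2 + 2 * \<sigma>)"
        using \<sigma> by (simp add: field_simps power2_eq_square)
      also have "\<dots> \<le> 589824 * \<bar>Im t\<bar> * (1 + 2 * 1)"
        using False \<sigma> by (intro mult_left_mono add_mono power_le_one) auto
      finally have 1: "norm ((\<Sum>r. p t (of_nat (Suc r)) - p (of_real b) (of_nat (Suc r))) + (t * 2 - of_real b * 2) / 12)
          \<le> 1769472 * \<bar>Im t\<bar>" by simp
      have "t * 2 - of_real b * 2 = 2 * \<i> * of_real (Im t)" by (simp add: complex_eq_iff b_def)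
      then have 2: "norm ((t * 2 - of_real b * 2) / 12) \<le> \<bar>Im t\<bar>" by (simp add: norm_mult norm_divide)
      have "norm (\<Sum>r. p t (of_nat (Suc r)) - p (of_real b) (of_nat (Suc r))) \<le> 1769472 * \<bar>Im t\<bar> + \<bar>Im t\<bar>"
        using norm_triangle_ineq4[of "(\<Sum>r. p t (of_nat (Suc r)) - p (of_real b) (of_nat (Suc r))) + (t * 2 - of_real b * 2) / 12"
            "(t * 2 - of_real b * 2) / 12"] 1 2 by simp
      also have "\<dots> \<le> (K + 1769473) * \<bar>Im t\<bar>" using K0 by (simp add: algebra_simps)
      finally show ?thesis .
    qed
    then show ?thesis using P by (simp add: b_def)
  qed
  then show ?thesis using K0 by (intro exI[of _ "K + 1769473"]) auto
qed

text \<open>Both error terms of \<open>C_ser_decomposition\<close> are O(|t|^2 (Re t)^(-1/2)), and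
  |t| <= 2 Re t. The comparison is with the profile at \<open>Re t\<close> because this is constant
  along the circle of integration; moving \<open>profile_sum\<close> to the real point costs |Im
  t|.\<close>

lemma C_ser_near_profile:
  "\<exists>C\<ge>0. \<forall>t m. Re t > 0 \<longrightarrow> \<bar>Im t\<bar> \<le> Re t \<longrightarrow> Re t \<le> 1 \<longrightarrow> m \<ge> 1 \<longrightarrow>
     norm (C_ser m (exp (- t)) - of_real (profile (real m) (Re t)))
       \<le> C * (Re t * sqrt (Re t) + \<bar>Im t\<bar>)"
proof -
  obtain C where C: "C \<ge> 0" "\<And>t m. Re t > 0 \<Longrightarrow> \<bar>Im t\<bar> \<le> Re t \<Longrightarrow> m > 0 \<Longrightarrow>
     norm (profile_sum m t - profile_sum m (of_real (Re t))) \<le> C * \<bar>Im t\<bar>"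
    using profile_sum_Lipschitz by blast
  define K where "K = (262144 * 4 + 3276800 * 4) * (6 :: real)"
  have K0: "K \<ge> 0" by (simp add: K_def)
  have "norm (C_ser m (exp (- t)) - of_real (profile (real m) (Re t)))
       \<le> (K + C) * (Re t * sqrt (Re t) + \<bar>Im t\<bar>)"
    if t: "Re t > 0" "\<bar>Im t\<bar> \<le> Re t" "Re t \<le> 1" and m: "m \<ge> 1" for t m
  proof -
    define b where "b = Re t"
    have b: "0 < b" "b \<le> 1" using t by (auto simp: b_def)
    have tz: "norm t \<le> 2 * Re t" using cmod_le[of t] t by linarith
    have m': "real m \<ge> 1" "real m > 0" using m by auto
    define V where "V = 1 + pi / (2 * sqrt (b / 2))"
    have V: "V \<le> 6 / sqrt b" "V \<ge> 0"
    proof -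
      have "sqrt b \<le> 1" using b by simp
      then have "1 \<le> 1 / sqrt b" using b by simp
      moreover have pi: "pi / (2 * sqrt (b / 2)) \<le> 4 / sqrt b"
      proof -
        have "sqrt b = sqrt 2 * sqrt (b / 2)" by (simp flip: real_sqrt_mult)
        moreover have "sqrt 2 \<le> 2" using real_sqrt_le_mono[of 2 "2^2"] by simp
        ultimately have "sqrt b \<le> 2 * sqrt (b / 2)" using b by simp
        then have "pi / (2 * sqrt (b / 2)) \<le> 4 / sqrt b"
          using b pi_less_4 by (intro frac_le) auto
        then show ?thesis .
      qed
      ultimately have "V \<le> 1 / sqrt b + 4 / sqrt b" unfolding V_def by (intro add_mono)
      also have "\<dots> = 5 / sqrt b" by (simp flip: add_divide_distrib)
      also have "\<dots> \<le> 6 / sqrt b" using b by (intro divide_right_mono) auto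
      finally show "V \<le> 6 / sqrt b" .
      show "V \<ge> 0" using b by (simp add: V_def)
    qed
    have tb: "b \<le> norm t" "norm t > 0" using complex_Re_le_cmod[of t] b by (auto simp: b_def)
    let ?R = "\<Sum>r. gauss_rem1 t (of_nat m * t) (of_nat (Suc r))"
    let ?G = "\<Sum>r. gauss1 t (of_nat m * t) (of_nat (Suc r)) - gauss1 0 (of_nat m * t) (of_nat (Suc r))"
    have "norm (- (?R / t + t * ?G)) \<le> norm ?R / norm t + norm t * norm ?G"
      unfolding norm_minus_cancel using norm_triangle_ineq[of "?R / t" "t * ?G"]
      by (simp add: norm_divide norm_mult)
    also have "\<dots> \<le> (262144 * norm t ^ 3 * V) / norm t + norm t * (3276800 * norm t * V)"
      using norm_gauss_rem1_sum_le(2)[OF t(1) tz t(3) m'(1)] norm_gauss_correction_le[OF t(1) tz t(3) m'(2)]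
      by (intro add_mono divide_right_mono mult_left_mono) (simp_all add: V_def b_def)
    also have "\<dots> = (262144 + 3276800) * norm t ^ 2 * V"
      using tb by (simp add: power2_eq_square power3_eq_cube field_simps)
    also have "\<dots> \<le> (262144 + 3276800) * (2 * b) ^ 2 * (6 / sqrt b)"
      using tz V b by (intro mult_mono mult_left_mono power_mono) (auto simp: b_def)
    also have "\<dots> = K * (b ^ 2 / sqrt b)" by (simp add: K_def power_mult_distrib)
    also have "b ^ 2 / sqrt b = b * sqrt b"
      using b by (simp add: power2_eq_square field_simps)
    finally have 1: "norm (C_ser m (exp (- t)) - profile_sum m t) \<le> K * (b * sqrt b)"
      unfolding C_ser_decomposition[OF t(1) tz t(3) m] .
    have 2: "norm (profile_sum m t - of_real (profile m b)) \<le> C * \<bar>Im t\<bar>"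
      using C(2)[OF t(1,2) m'(2)] profile_sum_eq_profile(1)[OF m'(2) b(1)] by (simp add: b_def)
    have "norm (C_ser m (exp (- t)) - of_real (profile m b))
       \<le> K * (b * sqrt b) + C * \<bar>Im t\<bar>"
      by (rule order_trans[OF eq_refl[OF arg_cong[of _ _ norm]] norm_triangle_mono[OF 1 2]]) simp
    also have "\<dots> \<le> (K + C) * (b * sqrt b + \<bar>Im t\<bar>)"
      using K0 C(1) b by (simp add: algebra_simps)
    finally show ?thesis by (simp add: b_def)
  qed
  then show ?thesis using K0 C(1) by (intro exI[of _ "K + C"]) auto
qed

section \<open>The circle method\<close>

lemma one_minus_cos_ge: "1 - cos y \<ge> y ^ 2 / 8" if "\<bar>y\<bar> \<le> pi" for y :: real
proof -
  define u where "u = \<bar>y\<bar> / pi"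
  have u: "0 \<le> u" "u \<le> 1" using that by (auto simp: u_def)
  \<comment> \<open>Concavity of the sine on [0, pi/2] puts it above its chord: sin(u pi/2) >=
    u.\<close>
  have "convex_on {0..pi / 2} (\<lambda>x. - sin x :: real)"
  proof (rule f''_ge0_imp_convex)
    show "((\<lambda>x. - sin x) has_real_derivative - cos x) (at x)" for x :: real
      by (auto intro!: derivative_eq_intros)
    show "((\<lambda>x. - cos x) has_real_derivative sin x) (at x)" for x :: real
      by (auto intro!: derivative_eq_intros)
    show "0 \<le> sin x" if "x \<in> {0..pi / 2}" for x using that by (intro sin_ge_zero) auto
  qed auto
  from convex_onD[OF this u(1,2), of 0 "pi / 2"]
  have "u \<le> sin (u * (pi / 2))" by simp
  then have "u \<le> sin (\<bar>y\<bar> / 2)" by (simp add: u_def)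
  then have "u ^ 2 \<le> sin (\<bar>y\<bar> / 2) ^ 2" using u by (intro power_mono)
  also have "sin (\<bar>y\<bar> / 2) ^ 2 = (1 - cos y) / 2"
    using cos_double_sin[of "\<bar>y\<bar> / 2"] by simp
  finally have "2 * (\<bar>y\<bar> / pi)^2 \<le> 1 - cos y" by (simp add: u_def)
  moreover have "y^2 / 8 \<le> 2 * (\<bar>y\<bar> / pi)^2"
  proof -
    have "pi^2 \<le> 4^2" using pi_less_4 by (intro power_mono) auto
    then have "y^2 / 16 \<le> y^2 / pi^2" by (intro divide_left_mono) auto
    then show ?thesis by (simp add: power_divide mult.commute)
  qed
  ultimately show ?thesis by linarith
qed

text \<open>Among points of equal modulus every term of the series has its largest real part at the
  real point \<open>r\<close>, so all differences but the first may be dropped. The first is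
  explicit in \<rho> = e^(-Re t) and 1 - cos(Im t); the 24 is 3 * 8, from \<rho> >= 1/3 and 1 - cos
  y >= y^2/8.\<close>

lemma Re_qlog_le:
  assumes t: "Re t > 0" "Re t \<le> 1" "\<bar>Im t\<bar> \<le> pi"
  defines "q \<equiv> exp (- t)" and "r \<equiv> exp (- complex_of_real (Re t))"
  shows "Re (qlog q q) \<le> Re (qlog r r) - Im t ^ 2 / (24 * (Re t * (Re t ^ 2 + Im t ^ 2)))"
proof -
  define b where "b = Re t"
  define y where "y = Im t"
  define \<rho> where "\<rho> = exp (- b)"
  have b: "0 < b" "b \<le> 1" using t by (auto simp: b_def)
  have r: "r = of_real \<rho>" by (simp add: r_def \<rho>_def b_def exp_of_real flip: of_real_minus)
  have \<rho>: "0 < \<rho>" "\<rho> < 1" using b by (simp_all add: \<rho>_def)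
  have nq: "norm q = \<rho>" by (simp add: q_def \<rho>_def b_def)
  have nr: "norm r < 1" "norm q < 1" using \<rho> nq by (simp_all add: r)
  define A where "A = (\<lambda>l. Re (q ^ Suc l / (of_nat (Suc l) * (1 - q ^ Suc l))))"
  define B where "B = (\<lambda>l. \<rho> ^ Suc l / (real (Suc l) * (1 - \<rho> ^ Suc l)))"
  have "Re (r ^ Suc l / (of_nat (Suc l) * (1 - r ^ Suc l))) = B l" for l
  proof -
    have "r ^ Suc l / (of_nat (Suc l) * (1 - r ^ Suc l)) = of_real (B l)" by (simp add: r B_def)
    then show ?thesis by simp
  qed
  with sums_Re[OF qlog_sums[OF nr(1) nr(1)]] have "B sums Re (qlog r r)" by simp
  moreover have "A sums Re (qlog q q)" unfolding A_def by (rule sums_Re[OF qlog_sums[OF nr(2) nr(2)]])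
  ultimately have diff: "(\<lambda>l. B l - A l) sums (Re (qlog r r) - Re (qlog q q))" by (rule sums_diff)
  have "A l \<le> B l" for l
  proof -
    have p: "\<rho> ^ Suc l < 1" using \<rho> by (intro power_Suc_less_one) auto
    have "1 - \<rho> ^ Suc l \<le> norm (1 - q ^ Suc l)"
      using norm_triangle_ineq2[of 1 "q ^ Suc l"] by (simp add: norm_mult norm_power nq)
    then have "\<rho> ^ Suc l / (real (Suc l) * norm (1 - q ^ Suc l)) \<le> B l"
      unfolding B_def using \<rho> p by (intro divide_left_mono mult_left_mono mult_pos_pos) auto
    moreover have "A l \<le> \<rho> ^ Suc l / (real (Suc l) * norm (1 - q ^ Suc l))"
      unfolding A_def
      by (rule order_trans[OF complex_Re_le_cmod]) (simp only: norm_divide norm_mult norm_power nq norm_of_nat)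
    ultimately show ?thesis by linarith
  qed
  then have "(\<Sum>l\<in>{0}. B l - A l) \<le> (\<Sum>l. B l - A l)"
    using diff by (intro sum_le_suminf) (auto simp: sums_iff)
  then have main: "B 0 - A 0 \<le> Re (qlog r r) - Re (qlog q q)" using diff by (simp add: sums_iff)
  define c where "c = cos y"
  define \<delta> where "\<delta> = 1 - c"
  have q: "Re q = \<rho> * c" "Im q = - (\<rho> * sin y)"
    by (simp_all add: q_def \<rho>_def b_def c_def y_def Re_exp Im_exp)
  define D where "D = (1 - \<rho>)^2 + 2 * \<rho> * \<delta>"
  have \<delta>0: "\<delta> \<ge> 0" by (simp add: \<delta>_def c_def)
  have D: "D > 0" using \<rho> \<delta>0 by (auto simp: D_def intro!: add_pos_nonneg)
  have D_eq: "(1 - Re q)^2 + (Im q)^2 = D"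
  proof -
    have s: "sin y ^ 2 = 1 - c^2" by (simp add: c_def sin_squared_eq)
    have "(1 - Re q)^2 + (Im q)^2 = (1 - \<rho> * c)^2 + \<rho>^2 * sin y ^ 2"
      unfolding q by (simp add: power_mult_distrib)
    also have "\<dots> = D" unfolding s D_def \<delta>_def by (simp add: power2_eq_square algebra_simps)
    finally show ?thesis .
  qed
  have A0: "A 0 = (\<rho> * c - \<rho>^2) / D"
  proof -
    have "Re q * (1 - Re q) + Im q * (- Im q) = \<rho> * c - \<rho>^2"
    proof -
      have s: "sin y ^ 2 = 1 - c^2" by (simp add: c_def sin_squared_eq)
      have "Re q * (1 - Re q) + Im q * (- Im q) = \<rho> * c * (1 - \<rho> * c) - \<rho>^2 * sin y ^ 2"
        unfolding q by (simp add: power2_eq_square)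
      also have "\<dots> = \<rho> * c - \<rho>^2" unfolding s by (simp add: power2_eq_square algebra_simps)
      finally show ?thesis .
    qed
    then show ?thesis using D_eq by (simp add: A_def Re_divide)
  qed
  have "B 0 - A 0 = \<rho> * (1 + \<rho>) * \<delta> / ((1 - \<rho>) * D)"
  proof -
    have "B 0 - A 0 = (\<rho> * D - (\<rho> * c - \<rho>^2) * (1 - \<rho>)) / ((1 - \<rho>) * D)"
      using \<rho> D unfolding A0 by (simp add: B_def diff_frac_eq)
    also have "\<rho> * D - (\<rho> * c - \<rho>^2) * (1 - \<rho>) = \<rho> * (1 + \<rho>) * \<delta>"
      by (simp add: D_def \<delta>_def algebra_simps power2_eq_square)
    finally show ?thesis .
  qed
  moreover have "y^2 / (24 * (b * (b^2 + y^2))) \<le> \<rho> * (1 + \<rho>) * \<delta> / ((1 - \<rho>) * D)"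
  proof -
    have \<rho>b: "1 - \<rho> \<le> b" using exp_ge_add_one_self[of "- b"] by (simp add: \<rho>_def)
    have \<rho>3: "\<rho> \<ge> 1 / 3"
    proof -
      have "exp b \<le> exp 1" using b by simp
      then have "exp b \<le> 3" using exp_le by linarith
      then show ?thesis by (simp add: \<rho>_def exp_minus field_simps)
    qed
    have \<delta>: "y^2 / 8 \<le> \<delta>" using one_minus_cos_ge[of y] t by (simp add: \<delta>_def c_def y_def)
    have D_le: "D \<le> b^2 + 2 * \<delta>"
    proof -
      have "(1 - \<rho>)^2 \<le> b^2" using \<rho>b \<rho> by (intro power_mono) auto
      moreover have "2 * \<rho> * \<delta> \<le> 2 * 1 * \<delta>" using \<rho> \<delta>0 by (intro mult_right_mono) auto
      ultimately show ?thesis by (simp add: D_def)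
    qed
    have "y^2 * (b^2 + 2 * \<delta>) \<le> \<delta> * (8 * (b^2 + y^2))"
    proof -
      have "y^2 * b^2 \<le> (8 * \<delta>) * b^2" using \<delta> by (intro mult_right_mono) auto
      moreover have "y^2 * (2 * \<delta>) \<le> 8 * \<delta> * y^2" using \<delta>0 by simp
      ultimately show ?thesis by (simp add: algebra_simps)
    qed
    then have "y^2 / (8 * (b^2 + y^2)) \<le> \<delta> / (b^2 + 2 * \<delta>)"
      using b \<delta>0 by (subst divide_le_eq le_divide_eq; simp add: add_pos_nonneg mult_ac)+
    then have "(1 / 3) * (1 / b) * (y^2 / (8 * (b^2 + y^2))) \<le> \<rho> * (1 / b) * (\<delta> / (b^2 + 2 * \<delta>))"
      using \<rho>3 b \<rho> by (intro mult_mono) auto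
    also have "\<dots> = \<rho> * \<delta> / (b * (b^2 + 2 * \<delta>))" by simp
    also have "\<dots> \<le> \<rho> * (1 + \<rho>) * \<delta> / ((1 - \<rho>) * D)"
    proof (rule frac_le)
      have "\<rho> * 1 * \<delta> \<le> \<rho> * (1 + \<rho>) * \<delta>" using \<rho> \<delta>0 by (intro mult_right_mono mult_left_mono) auto
      then show "\<rho> * \<delta> \<le> \<rho> * (1 + \<rho>) * \<delta>" by simp
      show "(1 - \<rho>) * D \<le> b * (b^2 + 2 * \<delta>)" using \<rho>b D_le D b by (intro mult_mono) auto
    qed (use \<rho> D \<delta>0 in auto)
    finally show ?thesis by (simp add: mult_ac)
  qed
  ultimately show ?thesis using main by (simp add: b_def y_def)
qed

text \<open>Put T = y^2/(b(b^2+y^2)) and U = y^2/b^3. For |y| <= b one has U <= 2T; otherwise T >=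
  1/(2b) while U <= 16/b^3. So 1 + U is bounded by a multiple of (1 + T)^3, and its tenth power by
  thirty powers of 1 + T, which exp(T/24) absorbs (720 = 24 * 30). The exponent 10 is nine powers to
  be spent on powers of 1/b outside the sector and one for integrability.\<close>

lemma exp_decay_bound:
  "\<exists>K>0. \<forall>b y. 0 < b \<longrightarrow> b \<le> 1 \<longrightarrow> \<bar>y\<bar> \<le> pi \<longrightarrow>
     exp (- (y^2 / (24 * (b * (b^2 + y^2))))) \<le> K / (1 + y^2 / b^3) ^ 10"
proof -
  define K where "K = (128 :: real) ^ 10 * 720 ^ 30"
  have K: "K > 0" unfolding K_def by (intro mult_pos_pos zero_less_power) auto
  have "exp (- (y^2 / (24 * (b * (b^2 + y^2))))) \<le> K / (1 + y^2 / b^3) ^ 10"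
    if b: "0 < b" "b \<le> 1" and y: "\<bar>y\<bar> \<le> pi" for b y
  proof -
    define T where "T = y^2 / (b * (b^2 + y^2))"
    define U where "U = y^2 / b^3"
    have pos: "b * (b^2 + y^2) > 0" using b by (intro mult_pos_pos add_pos_nonneg) auto
    then have T: "T \<ge> 0" and U: "U \<ge> 0" using b by (simp_all add: T_def U_def)
    have UT: "1 + U \<le> 128 * (1 + T) ^ 3"
    proof (cases "y^2 \<le> b^2")
      case True
      have "b * (b^2 + y^2) \<le> b * (b^2 + b^2)" using True b by (intro mult_left_mono) auto
      then have "y^2 / (2 * b^3) \<le> T"
        unfolding T_def using pos b
        by (intro divide_left_mono mult_pos_pos[OF _ pos]) (auto simp: power2_eq_square power3_eq_cube)
      then have "U \<le> 2 * T" by (simp add: U_def)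
      moreover have "1 + T \<le> (1 + T) ^ 3" using T by (intro self_le_power) auto
      ultimately show ?thesis using T by linarith
    next
      case False
      then have "b * (b^2 + y^2) \<le> b * (y^2 + y^2)" using b by (intro mult_left_mono) auto
      then have "y^2 / (b * (y^2 + y^2)) \<le> T"
        unfolding T_def using pos b False
        by (intro divide_left_mono mult_pos_pos) (auto intro!: add_pos_pos simp: zero_less_power2)
      moreover have "y \<noteq> 0" using False by auto
      ultimately have "1 / b \<le> 2 * T" using b by (simp add: field_simps)
      then have "(1 / b) ^ 3 \<le> (2 * T) ^ 3" using b by (intro power_mono) auto
      moreover have "y^2 \<le> 4^2"
        using power_mono[of "\<bar>y\<bar>" 4 2] y pi_less_4 by simp
      ultimately have "U \<le> 16 * (2 * T) ^ 3"
        unfolding U_def using mult_mono[of "y^2" 16 "(1 / b) ^ 3" "(2 * T) ^ 3"] b by (simp add: power_divide)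
      then have "U \<le> 128 * T ^ 3" by (simp add: power_mult_distrib)
      moreover have "1 + T ^ 3 \<le> (1 + T) ^ 3"
      proof -
        have "(1 + T) ^ 3 = 1 + T ^ 3 + 3 * T + 3 * T^2" by (simp add: eval_nat_numeral algebra_simps)
        then show ?thesis using T by simp
      qed
      ultimately show ?thesis by linarith
    qed
    have "(1 + U) ^ 10 \<le> (128 * (1 + T) ^ 3) ^ 10" using UT U by (intro power_mono) auto
    also have "\<dots> = 128 ^ 10 * (1 + T) ^ 30" by (simp only: power_mult_distrib power_mult[symmetric]) simp
    also have "(1 + T) ^ 30 \<le> (720 * (1 + T / 720)) ^ 30" using T by (intro power_mono) auto
    also have "\<dots> = 720 ^ 30 * (1 + T / 720) ^ 30" by (rule power_mult_distrib)
    also have "(1 + T / 720) ^ 30 \<le> exp (T / 720) ^ 30"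
      using T by (intro power_mono exp_ge_add_one_self) auto
    also have "exp (T / 720) ^ 30 = exp (T / 24)" by (simp flip: exp_of_nat_mult)
    finally have "(1 + U) ^ 10 \<le> K * exp (T / 24)" by (simp add: K_def mult_left_mono)
    then have "exp (- (T / 24)) * (1 + U) ^ 10 \<le> exp (- (T / 24)) * (K * exp (T / 24))"
      by (intro mult_left_mono) auto
    also have "\<dots> = K" by (simp add: exp_minus)
    finally have "exp (- (T / 24)) \<le> K / (1 + U) ^ 10" using U by (simp add: pos_le_divide_eq)
    then show ?thesis unfolding T_def U_def by (simp add: mult.commute)
  qed
  then show ?thesis using K by blast
qed

text \<open>Cauchy's coefficient formula on the circle of radius e^(-b), in the variable y of q =
  e^(-(b+iy)). Lebesgue integrals with an indicator are used because rescaling and dominated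
  convergence follow; integrability of the sum, hence its measurability, is a product of the
  termwise integration.\<close>

lemma Fourier_coefficient:
  fixes a :: "nat \<Rightarrow> complex" and b :: real
  assumes a: "summable (\<lambda>j. norm (a j) * exp (- b) ^ j)"
    and f: "\<And>y. (\<lambda>j. a j * exp (- Complex b y) ^ j) sums f y"
  shows "integrable lborel (\<lambda>y. indicator {-pi..pi} y *\<^sub>R (f y * exp (of_nat n * Complex b y)))"
    and "(\<integral>y. indicator {-pi..pi} y *\<^sub>R (f y * exp (of_nat n * Complex b y)) \<partial>lborel) = 2 * of_real pi * a n"
proof -
  define e where "e = (\<lambda>j y. a j * exp ((of_nat n - of_nat j) * Complex b y))"
  define g where "g = (\<lambda>j y. indicator {-pi..pi} y *\<^sub>R e j y)"
  have ne: "norm (e j y) = norm (a j) * (exp (real n * b) * exp (- b) ^ j)" for j y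
    unfolding e_def by (simp add: norm_mult algebra_simps flip: exp_of_nat_mult exp_add)
  have int: "integrable lborel (g j)" for j
    unfolding g_def e_def Complex_eq by (intro borel_integrable_compact) (auto intro!: continuous_intros)
  have sn: "summable (\<lambda>j. norm (e j y))" for y
    unfolding ne using summable_mult[OF a, of "exp (real n * b)"] by (simp add: mult_ac)
  have e_sums: "(\<lambda>j. e j y) sums (f y * exp (of_nat n * Complex b y))" for y
  proof -
    have "e j y = a j * exp (- Complex b y) ^ j * exp (of_nat n * Complex b y)" for j
      unfolding e_def by (simp add: algebra_simps flip: exp_of_nat_mult exp_add)
    then show ?thesis using sums_mult2[OF f] by simp
  qed
  have gsum: "(\<Sum>j. g j y) = indicator {-pi..pi} y *\<^sub>R (f y * exp (of_nat n * Complex b y))" for y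
    unfolding g_def by (rule sums_unique[symmetric, OF sums_scaleR_right[OF e_sums]])
  have ae: "AE y in lborel. summable (\<lambda>j. norm (g j y))"
  proof (rule AE_I2)
    fix y :: real
    show "summable (\<lambda>j. norm (g j y))"
      unfolding g_def norm_scaleR by (intro summable_mult sn)
  qed
  have "(\<integral>y. norm (g j y) \<partial>lborel) = 2 * pi * (norm (a j) * (exp (real n * b) * exp (- b) ^ j))" for j
  proof -
    have "(\<integral>y. norm (g j y) \<partial>lborel) = (\<integral>y. indicator {-pi..pi} y *\<^sub>R (norm (a j) * (exp (real n * b) * exp (- b) ^ j)) \<partial>lborel)"
      by (intro Bochner_Integration.integral_cong refl) (simp add: g_def ne)
    then show ?thesis by simp
  qed
  then have sint: "summable (\<lambda>j. \<integral>y. norm (g j y) \<partial>lborel)"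
    using summable_mult[OF a, of "2 * pi * exp (real n * b)"] by (simp add: mult_ac)
  show "integrable lborel (\<lambda>y. indicator {-pi..pi} y *\<^sub>R (f y * exp (of_nat n * Complex b y)))"
    using integrable_suminf[OF int ae sint] unfolding gsum .
  have ig: "(\<integral>y. g j y \<partial>lborel) = (if j = n then 2 * of_real pi * a n else 0)" for j
  proof (cases "j = n")
    case True
    then have "g j = (\<lambda>y. indicator {-pi..pi} y *\<^sub>R a n)" by (auto simp: g_def e_def)
    then show ?thesis using True by (simp add: scaleR_conv_of_real)
  next
    case False
    define c where "c = (of_nat n - of_nat j :: complex)"
    have c: "c \<noteq> 0" using False by (simp add: c_def)
    define G where "G = (\<lambda>y. a j * exp (c * Complex b y) / (c * \<i>))"
    have "(\<integral>y. indicator {-pi..pi} y *\<^sub>R e j y \<partial>lborel) = G pi - G (- pi)"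
    proof (rule integral_FTC_Icc)
      fix y :: real
      have 1: "((\<lambda>w. a j * exp (c * w) / (c * \<i>)) has_field_derivative a j * exp (c * Complex b y) / \<i>) (at (Complex b y))"
        using c by (auto intro!: derivative_eq_intros)
      have 2: "((\<lambda>y. Complex b y) has_vector_derivative \<i>) (at y)"
        unfolding Complex_eq by (auto intro!: derivative_eq_intros)
      show "(G has_vector_derivative e j y) (at y within {- pi..pi})"
        using has_vector_derivative_at_within[OF field_vector_diff_chain_at[OF 2 1]]
        by (simp add: o_def G_def e_def c_def)
    qed (auto simp: e_def Complex_eq intro!: continuous_intros)
    also have "G pi = G (- pi)"
    proof -
      have "exp (c * Complex b pi) = exp (c * Complex b (- pi)) * exp (2 * of_int (int n - int j) * of_real pi * \<i>)"
        by (simp add: c_def Complex_eq algebra_simps flip: exp_add)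
      also have "exp (2 * of_int (int n - int j) * of_real pi * \<i>) = 1"
        by (simp only: exp_eq_1) (auto intro!: exI[of _ "int n - int j"])
      finally show ?thesis by (simp add: G_def)
    qed
    finally show ?thesis using False by (simp add: g_def)
  qed
  have "(\<lambda>j. \<integral>y. g j y \<partial>lborel) sums (\<integral>y. (\<Sum>j. g j y) \<partial>lborel)"
    by (rule sums_integral[OF int ae sint])
  moreover have "(\<lambda>j. \<integral>y. g j y \<partial>lborel) sums (2 * of_real pi * a n)"
    unfolding ig using sums_single[of n "\<lambda>_. 2 * of_real pi * a n"] by simp
  ultimately show "(\<integral>y. indicator {-pi..pi} y *\<^sub>R (f y * exp (of_nat n * Complex b y)) \<partial>lborel) = 2 * of_real pi * a n"
    unfolding gsum by (rule sums_unique2)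
qed

text \<open>At q = e^(-z) the term of \<open>qlog q q\<close> with N = l + 1 is 1/(N(e^(Nz) - 1)).
  Removing the pole 1/(Nz) of 1/(e^(Nz) - 1) leaves \<open>Bose\<close>, and the removed parts add
  up to pi^2/(6z).\<close>

definition Bose :: "complex \<Rightarrow> complex" where "Bose z = 1 / (exp z - 1) - 1 / z"

lemma exp_nz_right_half_plane: "Re z > 0 \<Longrightarrow> exp z - 1 \<noteq> 0"
  by (metis eq_iff_diff_eq_0 norm_exp_eq_Re norm_one one_less_exp_iff order_less_irrefl)

text \<open>The fraction e^z/(e^z-1)^2 is 1/D with D = (2 sinh(z/2))^2, and |D| >= (Re z)^2. For Re
  z <= 1 the double poles cancel, since 1/z^2 - 1/D = \<open>cosh_rem z\<close>/(z^2 D) has a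
  numerator of order 4; for larger Re z the two terms are small separately.\<close>

lemma Bose_deriv:
  assumes z: "Re z > 0" "norm z \<le> 2 * Re z"
  shows "(Bose has_field_derivative (1 / z^2 - exp z / (exp z - 1)^2)) (at z)"
    and "norm (1 / z^2 - exp z / (exp z - 1)^2) \<le> 24 / (1 + Re z ^ 2)"
proof -
  define a where "a = Re z"
  have a: "a > 0" "a \<le> norm z" using z complex_Re_le_cmod by (auto simp: a_def)
  have nz: "z \<noteq> 0" "exp z - 1 \<noteq> 0" using z exp_nz_right_half_plane by auto
  show "(Bose has_field_derivative (1 / z^2 - exp z / (exp z - 1)^2)) (at z)"
    unfolding Bose_def[abs_def] using nz
    by (auto intro!: derivative_eq_intros simp: power2_eq_square)
  define D where "D = exp z - 2 + exp (- z)"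
  have e1: "exp z * exp (- z) = 1" by (simp flip: exp_add)
  have D1: "exp z * D = (exp z - 1)^2"
    using e1 by (simp add: D_def power2_eq_square algebra_simps)
  have Dnz: "D \<noteq> 0" using D1 nz by auto
  have DW: "D = cosh_rem z + z^2" by (simp add: D_def cosh_rem_def)
  have nD: "norm D \<ge> a^2"
  proof -
    define p where "p = exp (z / 2)"
    define m where "m = exp (- (z / 2))"
    have pm: "p * m = 1" "p^2 = exp z" "m^2 = exp (- z)"
      unfolding p_def m_def by (simp_all flip: exp_add exp_of_nat_mult)
    have "D = (p - m)^2" unfolding D_def using pm by (simp add: power2_eq_square algebra_simps)
    then have "norm D = norm (p - m) ^ 2" by (simp add: norm_power)
    moreover have "a \<le> norm (p - m)"
    proof -
      have "exp (a / 2) - exp (- (a / 2)) \<le> norm (p - m)"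
        using norm_triangle_ineq2[of p m] by (simp add: p_def m_def a_def)
      moreover have "a \<le> exp (a / 2) - exp (- (a / 2))"
      proof -
        have "(\<lambda>x. exp (x / 2) - exp (- (x / 2)) - x) 0 \<le> (\<lambda>x. exp (x / 2) - exp (- (x / 2)) - x) a"
        proof (rule DERIV_nonneg_imp_nondecreasing[of 0 a])
          fix x :: real
          have "exp (x / 2) * exp (- (x / 2)) = 1" by (simp flip: exp_add)
          then have "(exp (x / 2) - exp (- (x / 2)))^2 + 4 = (exp (x / 2) + exp (- (x / 2)))^2"
            by (simp add: power2_eq_square algebra_simps)
          moreover have four: "(2 :: real)^2 = 4" by simp
          ultimately have "2^2 \<le> (exp (x / 2) + exp (- (x / 2)))^2"
            using zero_le_power2[of "exp (x / 2) - exp (- (x / 2))"] four by linarith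
          then have "2 \<le> exp (x / 2) + exp (- (x / 2))"
            by (rule power2_le_imp_le) (simp add: add_nonneg_nonneg)
          then show "\<exists>d. ((\<lambda>x. exp (x / 2) - exp (- (x / 2)) - x) has_real_derivative d) (at x) \<and> 0 \<le> d"
            by (intro exI[of _ "(exp (x / 2) + exp (- (x / 2))) / 2 - 1"])
               (auto intro!: derivative_eq_intros simp: field_simps)
        qed (use a in simp)
        then show ?thesis by simp
      qed
      ultimately show ?thesis by linarith
    qed
    ultimately show ?thesis using a by (simp add: power_mono)
  qed
  have eq: "exp z / (exp z - 1)^2 = 1 / D" unfolding D1[symmetric] using Dnz by simp
  show "norm (1 / z^2 - exp z / (exp z - 1)^2) \<le> 24 / (1 + Re z ^ 2)"
  proof (cases "a \<le> 1")
    case True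
    have "1 / z^2 - 1 / D = cosh_rem z / (z^2 * D)" using nz Dnz by (simp add: DW field_simps)
    then have "norm (1 / z^2 - 1 / D) = norm (cosh_rem z) / (norm z^2 * norm D)"
      by (simp add: norm_divide norm_mult norm_power)
    also have "\<dots> \<le> (exp a * norm z ^ 4) / (norm z^2 * (norm z^2 / 4))"
    proof (rule frac_le)
      show "norm (cosh_rem z) \<le> exp a * norm z ^ 4" using norm_cosh_rem_le(1)[of z] a by (simp add: a_def)
      have "norm z^2 \<le> (2 * a)^2" using z by (intro power_mono) (auto simp: a_def)
      then have "norm z^2 / 4 \<le> norm D" using nD by (simp add: power_mult_distrib)
      then show "norm z^2 * (norm z^2 / 4) \<le> norm z^2 * norm D" by (intro mult_left_mono) auto
    qed (use nz in auto)
    also have "\<dots> = 4 * exp a" using nz by (simp add: power2_eq_square power4_eq_xxxx)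
    also have "\<dots> \<le> 12"
    proof -
      have "exp a \<le> exp 1" using True by simp
      then show ?thesis using exp_le by linarith
    qed
    also have "12 \<le> 24 / (1 + a^2)"
    proof -
      have "a^2 \<le> 1" using True a by (simp add: power_le_one)
      then show ?thesis using a by (simp add: field_simps add_pos_pos)
    qed
    finally show ?thesis by (simp add: eq a_def)
  next
    case False
    have "norm (1 / z^2 - 1 / D) \<le> 1 / norm z^2 + 1 / norm D"
      using norm_triangle_ineq4[of "1 / z^2" "1 / D"] by (simp add: norm_divide norm_power)
    also have "\<dots> \<le> 1 / a^2 + 1 / a^2"
      using a nD Dnz nz by (intro add_mono divide_left_mono power_mono mult_pos_pos) auto
    also have "\<dots> \<le> 24 / (1 + a^2)"
    proof -
      have "1 \<le> a^2" using False by (simp add: one_le_power)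
      then show ?thesis using a by (simp add: field_simps)
    qed
    finally show ?thesis by (simp add: eq a_def)
  qed
qed

text \<open>Only the variation between \<open>t\<close> and \<open>Re t\<close> is estimated, so the
  logarithmic term of the full expansion, which varies by O(|Im t|/Re t), is part of the error. The
  derivative of \<open>Bose\<close> is integrated along vertical segments in each term, and the sum
  over the terms costs a factor 3/b: 72 = 24 * 3.\<close>

lemma qlog_asymptotics:
  assumes t: "Re t > 0" "Re t \<le> 1" "\<bar>Im t\<bar> \<le> Re t"
  defines "q \<equiv> exp (- t)" and "r \<equiv> exp (- complex_of_real (Re t))"
  shows "norm (qlog q q - qlog r r - of_real (pi^2 / 6) * (1 / t - 1 / of_real (Re t))) \<le> 72 * \<bar>Im t\<bar> / Re t"
proof -
  define b where "b = Re t"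
  have b: "0 < b" "b \<le> 1" using t by (auto simp: b_def)
  have lam: "(\<lambda>l. Bose (of_nat (Suc l) * z) / of_nat (Suc l)) sums (qlog (exp (- z)) (exp (- z)) - of_real (pi^2 / 6) * (1 / z))"
    if z: "Re z > 0" for z
  proof -
    have n: "norm (exp (- z)) < 1" using z by simp
    have "(\<lambda>l. of_real (1 / (real l + 1)^2)) sums (of_real (pi^2 / 6) :: complex)"
      using inverse_squares_sums by (subst sums_of_real_iff) (simp add: add.commute)
    from sums_diff[OF qlog_sums[OF n n] sums_mult2[OF this, of "1 / z"]]
    have "(\<lambda>l. exp (- z) ^ Suc l / (of_nat (Suc l) * (1 - exp (- z) ^ Suc l)) - of_real (1 / (real l + 1)^2) * (1 / z))
        sums (qlog (exp (- z)) (exp (- z)) - of_real (pi^2 / 6) * (1 / z))" .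
    moreover have "exp (- z) ^ Suc l / (of_nat (Suc l) * (1 - exp (- z) ^ Suc l)) - of_real (1 / (real l + 1)^2) * (1 / z)
        = Bose (of_nat (Suc l) * z) / of_nat (Suc l)" for l
    proof -
      define N where "N = (of_nat (Suc l) :: complex)"
      have N: "N \<noteq> 0" "of_real (1 / (real l + 1)^2) = 1 / N^2" unfolding N_def by (simp_all add: add.commute del: of_nat_Suc) (simp add: add.commute)
      define E where "E = exp (N * z)"
      have "exp (- z) ^ Suc l = exp (- (N * z))"
        unfolding N_def exp_of_nat_mult[symmetric] by (simp only: mult_minus_right)
      then have E: "exp (- z) ^ Suc l = 1 / E" by (simp only: E_def exp_minus inverse_eq_divide)
      have "E - 1 \<noteq> 0" "E \<noteq> 0" "z \<noteq> 0"
        unfolding E_def by (rule exp_nz_right_half_plane) (use z in \<open>auto simp: N_def\<close>)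
      moreover from this have "1 - 1 / E \<noteq> 0" by simp
      ultimately have eqE: "1 / E / (N * (1 - 1 / E)) = 1 / (N * (E - 1))" by (simp add: field_simps)
      show ?thesis
        unfolding E N(2) N_def[symmetric] Bose_def E_def[symmetric] eqE
        by (simp add: diff_divide_distrib power2_eq_square mult_ac)
    qed
    ultimately show ?thesis by simp
  qed
  have "Re (complex_of_real b) > 0" using b by simp
  note d = sums_diff[OF lam[OF t(1)] lam[OF this]]
  have s: "(\<lambda>l. Bose (of_nat (Suc l) * t) / of_nat (Suc l) - Bose (of_nat (Suc l) * of_real b) / of_nat (Suc l)) sums
     (qlog q q - qlog r r - of_real (pi^2 / 6) * (1 / t - 1 / of_real (Re t)))"
  proof -
    have gen: "x - y - w * (u - v) = (x - w * u) - (y - w * v)" for x y w u v :: complex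
      by (simp add: algebra_simps)
    show ?thesis using d unfolding gen q_def r_def b_def .
  qed
  define B where "B = (\<lambda>l. 24 * \<bar>Im t\<bar> * (1 / (1 + b^2 * real l ^ 2)))"
  have bound: "norm (Bose (of_nat (Suc l) * t) / of_nat (Suc l) - Bose (of_nat (Suc l) * of_real b) / of_nat (Suc l)) \<le> B l" for l
  proof -
    let ?N = "real (Suc l)"
    let ?t = "of_nat (Suc l) * t"
    have Re: "Re ?t = ?N * b" "Im ?t = ?N * Im t" by (simp_all add: b_def)
    have "norm (Bose ?t - Bose (of_real (Re ?t))) \<le> 24 / (1 + (?N * b)^2) * \<bar>Im ?t\<bar>"
    proof (rule norm_diff_vertical_le)
      show "Re ?t > 0" unfolding Re using b by simp
      show "\<bar>Im ?t\<bar> \<le> Re ?t" unfolding Re abs_mult using t by (intro mult_mono) (auto simp: b_def)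
    next
      fix z assume z: "Re z > 0" "norm z \<le> 2 * Re z"
      show "(Bose has_field_derivative (1 / z^2 - exp z / (exp z - 1)^2)) (at z)" by (rule Bose_deriv[OF z])
    next
      fix z assume z: "Re z = Re ?t" "norm z \<le> 2 * Re z"
      moreover have "Re ?t > 0" unfolding Re using b by simp
      ultimately have "Re z > 0" by simp
      from Bose_deriv(2)[OF this z(2)] show "norm (1 / z^2 - exp z / (exp z - 1)^2) \<le> 24 / (1 + (?N * b)^2)"
        unfolding z(1) Re .
    qed
    then have "norm (Bose ?t - Bose (of_nat (Suc l) * of_real b)) \<le> ?N * (24 * \<bar>Im t\<bar> / (1 + (?N * b)^2))"
      unfolding Re abs_mult by (simp add: mult_ac del: of_nat_Suc)
    then have "norm (Bose ?t - Bose (of_nat (Suc l) * of_real b)) / ?N \<le> 24 * \<bar>Im t\<bar> / (1 + (?N * b)^2)"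
      by (simp add: divide_le_eq mult.commute del: of_nat_Suc)
    also have "\<dots> \<le> 24 * \<bar>Im t\<bar> / (1 + b^2 * real l ^ 2)"
    proof (rule divide_left_mono)
      have "b^2 * real l ^ 2 \<le> b^2 * ?N ^ 2" by (intro mult_left_mono power_mono) auto
      then show "1 + b^2 * real l ^ 2 \<le> 1 + (?N * b)^2" by (simp add: power_mult_distrib mult.commute del: of_nat_Suc)
      show "0 < (1 + (?N * b)^2) * (1 + b^2 * real l ^ 2)" by (intro mult_pos_pos add_pos_nonneg) auto
    qed auto
    finally show ?thesis
      unfolding B_def diff_divide_distrib[symmetric] norm_divide norm_of_nat by simp
  qed
  have b2: "b^2 > 0" using b by simp
  note sq = suminf_inverse_quadratic_le[OF b2]
  have "norm (qlog q q - qlog r r - of_real (pi^2 / 6) * (1 / t - 1 / of_real (Re t))) \<le> suminf B"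
    unfolding sums_unique[OF s] by (rule norm_suminf_le[OF bound]) (unfold B_def, intro summable_mult sq)
  also have "suminf B \<le> 24 * \<bar>Im t\<bar> * (1 + pi / (2 * sqrt (b^2)))"
    unfolding B_def by (subst suminf_mult[OF sq(1)], rule mult_left_mono[OF sq(2)]) simp
  also have "\<dots> \<le> 24 * \<bar>Im t\<bar> * (3 / b)"
  proof (rule mult_left_mono)
    have "1 \<le> 1 / b" using b by simp
    moreover have "pi / (2 * b) \<le> 2 / b" using b pi_less_4 by (simp add: field_simps)
    ultimately have "1 + pi / (2 * b) \<le> 1 / b + 2 / b" by (rule add_mono)
    then show "1 + pi / (2 * sqrt (b^2)) \<le> 3 / b" using b by simp
  qed simp
  finally show ?thesis by (simp add: b_def)
qed

section \<open>The partition generating function and integrals over the circle\<close>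

definition part_gf :: "nat \<Rightarrow> complex \<Rightarrow> complex" where
  "part_gf k t = exp (of_nat k * qlog (exp (- t)) (exp (- t)))"

lemma part_gf_nonzero [simp]: "part_gf k t \<noteq> 0"
  by (simp add: part_gf_def)

lemma part_gf_decay:
  assumes "k \<ge> 1"
  shows "\<exists>K>0. \<forall>b y. 0 < b \<longrightarrow> b \<le> 1 \<longrightarrow> \<bar>y\<bar> \<le> pi \<longrightarrow>
    norm (part_gf k (Complex b y)) \<le> norm (part_gf k (of_real b)) * (K / (1 + y^2 / b^3) ^ 10)"
proof -
  obtain K where K: "K > 0" "\<And>b y. 0 < b \<Longrightarrow> b \<le> 1 \<Longrightarrow> \<bar>y\<bar> \<le> pi \<Longrightarrow>
     exp (- (y^2 / (24 * (b * (b^2 + y^2))))) \<le> K / (1 + y^2 / b^3) ^ 10"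
    using exp_decay_bound by blast
  have "norm (part_gf k (Complex b y)) \<le> norm (part_gf k (of_real b)) * (K / (1 + y^2 / b^3) ^ 10)"
    if b: "0 < b" "b \<le> 1" and y: "\<bar>y\<bar> \<le> pi" for b y
  proof -
    let ?q = "exp (- Complex b y)" and ?r = "exp (- complex_of_real b)"
    define T where "T = y^2 / (24 * (b * (b^2 + y^2)))"
    have T: "T \<ge> 0" using b by (simp add: T_def)
    have "Re (qlog ?q ?q) \<le> Re (qlog ?r ?r) - T"
      using Re_qlog_le[of "Complex b y"] b y by (simp add: T_def)
    then have "real k * Re (qlog ?q ?q) \<le> real k * (Re (qlog ?r ?r) - T)"
      by (intro mult_left_mono) auto
    also have "\<dots> \<le> real k * Re (qlog ?r ?r) - T"
      using mult_right_mono[of 1 "real k" T] assms T by (simp add: algebra_simps)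
    finally have "norm (part_gf k (Complex b y)) \<le> norm (part_gf k (of_real b)) * exp (- T)"
      unfolding part_gf_def by (simp flip: exp_add)
    also have "\<dots> \<le> norm (part_gf k (of_real b)) * (K / (1 + y^2 / b^3) ^ 10)"
      unfolding T_def by (intro mult_left_mono K b y) auto
    finally show ?thesis .
  qed
  then show ?thesis using K(1) by blast
qed

lemma p_col_integral:
  assumes b: "b > 0"
  shows "integrable lborel (\<lambda>y. indicator {-pi..pi} y *\<^sub>R (part_gf k (Complex b y) * exp (of_nat n * Complex b y)))"
    and "(\<integral>y. indicator {-pi..pi} y *\<^sub>R (part_gf k (Complex b y) * exp (of_nat n * Complex b y)) \<partial>lborel)
      = 2 * of_real pi * of_nat (p_col k n)"
proof -
  have n: "norm (exp (- Complex b y)) < 1" for y using b by simp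
  have s: "summable (\<lambda>j. norm (of_nat (p_col k j) :: complex) * exp (- b) ^ j)"
    using p_col_sums(1)[OF n[of 0], of k] by simp
  have f: "(\<lambda>j. of_nat (p_col k j) * exp (- Complex b y) ^ j) sums part_gf k (Complex b y)" for y
    unfolding part_gf_def by (rule p_col_sums(2)[OF n])
  from Fourier_coefficient[OF s f]
  show "integrable lborel (\<lambda>y. indicator {-pi..pi} y *\<^sub>R (part_gf k (Complex b y) * exp (of_nat n * Complex b y)))"
    "(\<integral>y. indicator {-pi..pi} y *\<^sub>R (part_gf k (Complex b y) * exp (of_nat n * Complex b y)) \<partial>lborel)
      = 2 * of_real pi * of_nat (p_col k n)" by blast+
qed

lemma f_coeff_integral:
  assumes b: "b > 0" and m: "m \<ge> 1"
  shows "integrable lborel (\<lambda>y. indicator {-pi..pi} y *\<^sub>R (C_ser m (exp (- Complex b y)) * part_gf k (Complex b y) * exp (of_nat n * Complex b y)))"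
    and "(\<integral>y. indicator {-pi..pi} y *\<^sub>R (C_ser m (exp (- Complex b y)) * part_gf k (Complex b y) * exp (of_nat n * Complex b y)) \<partial>lborel)
      = 2 * of_real pi * of_real (f_coeff k (int m) n)"
proof -
  have n: "norm (exp (- Complex b y)) < 1" for y using b by simp
  have s: "summable (\<lambda>j. norm (of_real (f_coeff k (int m) j) :: complex) * exp (- b) ^ j)"
    using f_coeff_sums(2)[OF n[of 0] m, of k] by (simp add: norm_mult norm_power)
  have f: "(\<lambda>j. of_real (f_coeff k (int m) j) * exp (- Complex b y) ^ j) sums (C_ser m (exp (- Complex b y)) * part_gf k (Complex b y))" for y
    unfolding part_gf_def by (rule f_coeff_sums(1)[OF n m])
  from Fourier_coefficient[OF s f]
  show "integrable lborel (\<lambda>y. indicator {-pi..pi} y *\<^sub>R (C_ser m (exp (- Complex b y)) * part_gf k (Complex b y) * exp (of_nat n * Complex b y)))"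
    "(\<integral>y. indicator {-pi..pi} y *\<^sub>R (C_ser m (exp (- Complex b y)) * part_gf k (Complex b y) * exp (of_nat n * Complex b y)) \<partial>lborel)
      = 2 * of_real pi * of_real (f_coeff k (int m) n)" by blast+
qed

text \<open>The second equation is the saddle point condition: \<open>beta k n\<close> is the
  positive critical point of k pi^2/(6t) + n t. The third rewrites the range of m in terms of
  it.\<close>

lemma beta_facts:
  assumes "k \<ge> 1" "n \<ge> 1"
  shows "beta k n > 0" "real n * beta k n ^ 2 = real k * pi ^ 2 / 6"
    "sqrt (real n / (6 * real k)) * (ln (real n) / pi) = ln (real n) / (6 * beta k n)"
proof -
  show pos: "beta k n > 0" using assms by (simp add: beta_def)
  show "real n * beta k n ^ 2 = real k * pi ^ 2 / 6"
    using assms by (simp add: beta_def power_mult_distrib)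
  have "sqrt (real n / (6 * real k)) * sqrt (real k / (6 * real n)) = sqrt ((1 / 6)^2)"
    using assms by (subst real_sqrt_mult[symmetric]) (simp add: power2_eq_square)
  then have "6 * beta k n * sqrt (real n / (6 * real k)) = pi"
    by (simp add: beta_def mult_ac)
  then show "sqrt (real n / (6 * real k)) * (ln (real n) / pi) = ln (real n) / (6 * beta k n)"
    using pos by (simp add: field_simps)
qed

lemma beta_tendsto_0: "(\<lambda>n. beta k n) \<longlonglongrightarrow> 0"
proof -
  have "(\<lambda>n. pi * sqrt (real k / 6 * (1 / real n))) \<longlonglongrightarrow> pi * sqrt (real k / 6 * 0)"
    by (intro tendsto_intros lim_1_over_n)
  then show ?thesis by (simp add: beta_def[abs_def])
qed

text \<open>Write t = b w with w = 1 + i sqrt(b) u. By the saddle point condition the linear terms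
  cancel exactly, and the main exponent is n b (w-1)^2/w = -n b^2 u^2/w, which converges since n b^2
  = k pi^2/6 does not depend on n. The error from \<open>qlog_asymptotics\<close> is O(sqrt(b)
  |u|).\<close>

lemma part_gf_ratio_tendsto:
  fixes u :: real
  assumes k: "k \<ge> 1"
  defines "c \<equiv> \<lambda>n. beta k n * sqrt (beta k n)"
  shows "(\<lambda>n. part_gf k (Complex (beta k n) (c n * u)) * exp (of_nat n * Complex (beta k n) (c n * u))
      / (part_gf k (of_real (beta k n)) * exp (of_nat n * of_real (beta k n))))
     \<longlonglongrightarrow> of_real (exp (- (real k * pi^2 / 6 * u^2)))"
proof -
  define b where "b = beta k"
  define err where "err = (\<lambda>n. qlog (exp (- Complex (b n) (c n * u))) (exp (- Complex (b n) (c n * u)))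
      - qlog (exp (- of_real (b n))) (exp (- of_real (b n)))
      - of_real (pi^2 / 6) * (1 / Complex (b n) (c n * u) - 1 / of_real (b n)))"
  have b0: "b \<longlonglongrightarrow> 0" unfolding b_def by (rule beta_tendsto_0)
  then have sb0: "(\<lambda>n. sqrt (b n)) \<longlonglongrightarrow> 0" using tendsto_real_sqrt[OF b0] by simp
  have ev1: "eventually (\<lambda>n. n \<ge> 1) sequentially" by (rule eventually_ge_at_top)
  have ev2: "eventually (\<lambda>n. b n < 1) sequentially" using order_tendstoD(2)[OF b0] by simp
  have "(\<lambda>n. sqrt (b n) * \<bar>u\<bar>) \<longlonglongrightarrow> 0 * \<bar>u\<bar>" by (intro tendsto_intros sb0)
  from order_tendstoD(2)[OF this, of 1]
  have ev3: "eventually (\<lambda>n. sqrt (b n) * \<bar>u\<bar> < 1) sequentially" by simp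
  have e0: "err \<longlonglongrightarrow> 0"
  proof (rule Lim_null_comparison)
    show "\<forall>\<^sub>F n in sequentially. norm (err n) \<le> 72 * (sqrt (b n) * \<bar>u\<bar>)"
      using ev1 ev2 ev3
    proof eventually_elim
      case (elim n)
      have bp: "b n > 0" using beta_facts(1)[OF k elim(1)] by (simp add: b_def)
      have ab: "\<bar>c n * u\<bar> = b n * (sqrt (b n) * \<bar>u\<bar>)" using bp by (simp add: c_def b_def abs_mult)
      then have "\<bar>c n * u\<bar> \<le> b n * 1" using elim bp by (simp only:) (intro mult_left_mono, auto)
      with qlog_asymptotics[of "Complex (b n) (c n * u)"] elim bp
      have "norm (err n) \<le> 72 * \<bar>c n * u\<bar> / b n" by (simp add: err_def)
      also have "\<dots> = 72 * (sqrt (b n) * \<bar>u\<bar>)" unfolding ab using bp by simp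
      finally show ?case .
    qed
    have "(\<lambda>n. 72 * (sqrt (b n) * \<bar>u\<bar>)) \<longlonglongrightarrow> 72 * (0 * \<bar>u\<bar>)" by (intro tendsto_intros sb0)
    then show "(\<lambda>n. 72 * (sqrt (b n) * \<bar>u\<bar>)) \<longlonglongrightarrow> 0" by simp
  qed
  have u0: "(\<lambda>n. of_real (u^2) / (1 + \<i> * of_real (sqrt (b n)) * of_real u) :: complex) \<longlonglongrightarrow> of_real (u^2) / (1 + \<i> * of_real 0 * of_real u)"
    by (intro tendsto_intros sb0) simp
  have "(\<lambda>n. exp (of_nat k * err n - of_real (real k * pi^2 / 6) * (of_real (u^2) / (1 + \<i> * of_real (sqrt (b n)) * of_real u))))
      \<longlonglongrightarrow> exp (of_nat k * 0 - of_real (real k * pi^2 / 6) * (of_real (u^2) / (1 + \<i> * of_real 0 * of_real u)))"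
    by (rule tendsto_exp[OF tendsto_diff[OF tendsto_mult_left[OF e0] tendsto_mult_left[OF u0]]])
  also have "exp (of_nat k * 0 - of_real (real k * pi^2 / 6) * (of_real (u^2) / (1 + \<i> * of_real 0 * of_real u))) =
      complex_of_real (exp (- (real k * pi^2 / 6 * u^2)))"
    by (simp flip: exp_of_real)
  finally show ?thesis
  proof (rule Lim_transform_eventually)
    show "\<forall>\<^sub>F n in sequentially. exp (of_nat k * err n - of_real (real k * pi^2 / 6) * (of_real (u^2) / (1 + \<i> * of_real (sqrt (b n)) * of_real u)))
      = part_gf k (Complex (beta k n) (c n * u)) * exp (of_nat n * Complex (beta k n) (c n * u))
      / (part_gf k (of_real (beta k n)) * exp (of_nat n * of_real (beta k n)))"
      using ev1
    proof eventually_elim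
      case (elim n)
      have bp: "b n > 0" using beta_facts(1)[OF k elim] by (simp add: b_def)
      define B where "B = complex_of_real (b n)"
      define w where "w = 1 + \<i> * of_real (sqrt (b n)) * of_real u"
      define t where "t = Complex (b n) (c n * u)"
      have B: "B \<noteq> 0" using bp by (simp add: B_def)
      have w: "w \<noteq> 0" by (simp add: w_def complex_eq_iff)
      have t: "t = B * w"
        by (simp add: t_def B_def w_def c_def b_def complex_eq_iff)
      have kn: "of_real (real k * pi^2 / 6) = of_nat n * B^2"
      proof -
        have "real n * b n ^ 2 = real k * pi^2 / 6" using beta_facts(2)[OF k elim] by (simp add: b_def)
        then have "complex_of_real (real k * pi^2 / 6) = of_real (real n * b n ^ 2)" by (simp only:)
        then show ?thesis by (simp add: B_def)
      qed
      have w1: "B * (w - 1)^2 = - (B^2 * of_real (u^2))"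
      proof -
        have "(w - 1)^2 = - (of_real (sqrt (b n) ^ 2) * of_real (u^2))"
          by (simp add: w_def power_mult_distrib)
        also have "sqrt (b n) ^ 2 = b n" using bp by simp
        finally show ?thesis by (simp add: B_def power2_eq_square)
      qed
      have key: "of_nat n * B^2 * (1 / t - 1 / B) + of_nat n * (t - B) = - (of_nat n * B^2 * (of_real (u^2) / w))"
      proof -
        have "of_nat n * B^2 * (1 / t - 1 / B) + of_nat n * (t - B) = of_nat n * (B * (w - 1)^2) / w"
          unfolding t using B w by (simp add: field_simps power2_eq_square)
        then show ?thesis unfolding w1 by simp
      qed
      have "of_nat k * err n - of_real (real k * pi^2 / 6) * (of_real (u^2) / w) =
         of_nat k * (qlog (exp (- t)) (exp (- t)) - qlog (exp (- B)) (exp (- B)))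
          - of_nat k * of_real (pi^2 / 6) * (1 / t - 1 / B) - of_nat n * B^2 * (of_real (u^2) / w)"
        unfolding kn err_def t_def[symmetric] B_def[symmetric] by (simp add: algebra_simps)
      also have "of_nat k * of_real (pi^2 / 6) = of_nat n * B^2" unfolding kn[symmetric] by simp
      also have "of_nat k * (qlog (exp (- t)) (exp (- t)) - qlog (exp (- B)) (exp (- B)))
          - of_nat n * B^2 * (1 / t - 1 / B) - of_nat n * B^2 * (of_real (u^2) / w) =
          (of_nat k * qlog (exp (- t)) (exp (- t)) + of_nat n * t) - (of_nat k * qlog (exp (- B)) (exp (- B)) + of_nat n * B)"
        using key by (simp add: algebra_simps)
      finally show ?case
        unfolding part_gf_def w_def[symmetric] b_def[symmetric] t_def[symmetric] B_def[symmetric]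
        by (simp only: exp_diff exp_add)
    qed
  qed
qed

lemma p_col_lower_bound:
  assumes k: "k \<ge> 1"
  shows "\<exists>c0>0. \<forall>\<^sub>F n in sequentially.
     c0 * (beta k n * sqrt (beta k n)) * exp (real n * beta k n) * norm (part_gf k (of_real (beta k n))) \<le> real (p_col k n)"
proof -
  define b where "b = beta k"
  define c where "c = (\<lambda>n. b n * sqrt (b n))"
  define h where "h = (\<lambda>n y. indicator {-pi..pi} y *\<^sub>R (part_gf k (Complex (b n) y) * exp (of_nat n * Complex (b n) y)))"
  define d where "d = (\<lambda>n. part_gf k (of_real (b n)) * exp (of_nat n * of_real (b n)))"
  define s where "s = (\<lambda>n u. h n (c n * u) / d n)"
  define f where "f = (\<lambda>u. complex_of_real (exp (- (real k * pi^2 / 6 * u^2))))"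
  obtain K where K: "K > 0" "\<And>b y. 0 < b \<Longrightarrow> b \<le> 1 \<Longrightarrow> \<bar>y\<bar> \<le> pi \<Longrightarrow>
    norm (part_gf k (Complex b y)) \<le> norm (part_gf k (of_real b)) * (K / (1 + y^2 / b^3) ^ 10)"
    using part_gf_decay[OF k] by blast
  have b0: "b \<longlonglongrightarrow> 0" unfolding b_def by (rule beta_tendsto_0)
  obtain N0 where N0: "\<And>n. n \<ge> N0 \<Longrightarrow> b n < 1"
    using order_tendstoD(2)[OF b0, of 1] unfolding eventually_sequentially by auto
  \<comment> \<open>Dominated convergence asks for the bound at every index, so the sequence starts
    at \<open>N\<close>, from where on b is positive and less than 1.\<close>
  define N where "N = max 1 N0"
  have N: "N \<ge> 1" "\<And>n. n \<ge> N \<Longrightarrow> b n < 1" using N0 by (auto simp: N_def)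
  have bp: "b n > 0" if "n \<ge> N" for n using beta_facts(1)[OF k, of n] N(1) that by (simp add: b_def)
  have cp: "c n > 0" if "n \<ge> N" for n using bp[OF that] by (simp add: c_def)
  have c2: "c n ^ 2 = b n ^ 3" if "n \<ge> N" for n
    using bp[OF that] by (simp add: c_def power_mult_distrib power2_eq_square power3_eq_cube)
  have dnz: "d n \<noteq> 0" for n by (simp add: d_def)
  have int: "integrable lborel (h n)" if "n \<ge> N" for n
    unfolding h_def by (rule p_col_integral[OF bp[OF that]])
  have meas: "s (n + N) \<in> borel_measurable lborel" for n
  proof -
    have "integrable lborel (\<lambda>u. h (n + N) (0 + c (n + N) * u))"
      using cp[of "n + N"] by (intro lborel_integrable_real_affine int) auto
    then have "(\<lambda>u. h (n + N) (c (n + N) * u)) \<in> borel_measurable lborel" by (simp add: borel_measurable_integrable)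
    then show ?thesis unfolding s_def by measurable
  qed
  have w: "integrable lborel (\<lambda>u :: real. K * inverse (1 + u^2))"
    using integrable_inverse_1_plus_square by (simp add: set_integrable_def)
  have fm: "f \<in> borel_measurable lborel" unfolding f_def by measurable
  have lim: "(\<lambda>n. s (n + N) u) \<longlonglongrightarrow> f u" for u
  proof (rule LIMSEQ_ignore_initial_segment)
    have "(\<lambda>n. b n * sqrt (b n) * u) \<longlonglongrightarrow> 0 * sqrt 0 * u" by (intro tendsto_intros b0)
    then have "(\<lambda>n. \<bar>c n * u\<bar>) \<longlonglongrightarrow> 0" unfolding c_def by (simp add: tendsto_rabs_zero)
    from order_tendstoD(2)[OF this pi_gt_zero]
    have "\<forall>\<^sub>F n in sequentially. \<bar>c n * u\<bar> < pi" .
    then have "\<forall>\<^sub>F n in sequentially. part_gf k (Complex (b n) (c n * u)) * exp (of_nat n * Complex (b n) (c n * u)) / d n = s n u"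
    proof eventually_elim
      case (elim n)
      then have "c n * u \<in> {- pi..pi}" by auto
      then show ?case by (simp add: s_def h_def)
    qed
    moreover have "(\<lambda>n. part_gf k (Complex (b n) (c n * u)) * exp (of_nat n * Complex (b n) (c n * u)) / d n) \<longlonglongrightarrow> f u"
      using part_gf_ratio_tendsto[OF k, of u] by (simp add: b_def c_def d_def f_def)
    ultimately show "(\<lambda>n. s n u) \<longlonglongrightarrow> f u" by (rule Lim_transform_eventually[rotated])
  qed
  have bound: "norm (s (n + N) u) \<le> K * inverse (1 + u^2)" for n u
  proof (cases "c (n + N) * u \<in> {- pi..pi}")
    case True
    let ?n = "n + N" let ?y = "c ?n * u"
    have bn: "b ?n > 0" "b ?n \<le> 1" using bp[of ?n] N(2)[of ?n] by auto
    have yy: "?y^2 / b ?n ^ 3 = u^2" using c2[of ?n] bn by (simp add: power_mult_distrib)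
    have "norm (part_gf k (Complex (b ?n) ?y)) \<le> norm (part_gf k (of_real (b ?n))) * (K / (1 + u^2) ^ 10)"
      using K(2)[OF bn, of ?y] True unfolding yy by auto
    moreover have "K / (1 + u^2) ^ 10 \<le> K / (1 + u^2)"
      using K(1) by (intro divide_left_mono self_le_power mult_pos_pos zero_less_power add_pos_nonneg) auto
    ultimately have "norm (part_gf k (Complex (b ?n) ?y)) \<le> norm (part_gf k (of_real (b ?n))) * (K / (1 + u^2))"
      using mult_left_mono[of "K / (1 + u^2) ^ 10" "K / (1 + u^2)" "norm (part_gf k (of_real (b ?n)))"] by simp
    then have "norm (part_gf k (Complex (b ?n) ?y)) / norm (part_gf k (of_real (b ?n))) \<le> K / (1 + u^2)"
      by (simp add: divide_le_eq mult.commute)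
    moreover have "norm (s ?n u) = norm (part_gf k (Complex (b ?n) ?y)) / norm (part_gf k (of_real (b ?n)))"
      using True by (simp add: s_def h_def d_def norm_divide norm_mult)
    ultimately show ?thesis by (simp add: divide_inverse)
  qed (use K in \<open>simp add: s_def h_def add_nonneg_nonneg\<close>)
  note dct = integral_dominated_convergence[where s = "\<lambda>n. s (n + N)", OF fm meas w AE_I2[OF lim] AE_I2[OF bound]]
  have fint: "integrable lborel f"
    by (rule integrable_dominated_convergence[where s = "\<lambda>n. s (n + N)", OF fm meas w AE_I2[OF lim] AE_I2[OF bound]])
  define L where "L = (\<integral>u. exp (- (real k * pi^2 / 6 * u^2)) \<partial>lborel)"
  have fr: "integrable lborel (\<lambda>u. exp (- (real k * pi^2 / 6 * u^2)))"
    using integrable_Re[OF fint] by (simp add: f_def)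
  have intf: "(\<integral>u. f u \<partial>lborel) = of_real L"
    unfolding f_def L_def by (rule integral_complex_of_real)
  have "L > 0"
  proof -
    have "L \<noteq> 0"
    proof
      assume "L = 0"
      then have "AE u in (lborel :: real measure). exp (- (real k * pi^2 / 6 * u^2)) = 0"
        unfolding L_def using integral_nonneg_eq_0_iff_AE[OF fr] by simp
      then obtain Z where "{u \<in> space (lborel :: real measure). exp (- (real k * pi^2 / 6 * u^2)) \<noteq> 0} \<subseteq> Z" "emeasure lborel Z = 0"
        by (rule AE_E)
      then have "emeasure lborel (UNIV :: real set) = 0" by (simp add: top.extremum_unique)
      then show False by simp
    qed
    moreover have "L \<ge> 0" unfolding L_def by (intro Bochner_Integration.integral_nonneg) simp
    ultimately show ?thesis by simp
  qed
  have "(\<lambda>n. norm (\<integral>u. s (n + N) u \<partial>lborel)) \<longlonglongrightarrow> norm (complex_of_real L)"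
    using tendsto_norm[OF dct] unfolding intf .
  then have "(\<lambda>n. norm (\<integral>u. s (n + N) u \<partial>lborel)) \<longlonglongrightarrow> L" using \<open>L > 0\<close> by simp
  from order_tendstoD(1)[OF this, of "L / 2"] \<open>L > 0\<close>
  have "\<forall>\<^sub>F n in sequentially. norm (\<integral>u. s (n + N) u \<partial>lborel) > L / 2" by simp
  then have "\<forall>\<^sub>F n in sequentially. norm (\<integral>u. s n u \<partial>lborel) > L / 2"
    by (subst (asm) eventually_sequentially_seg)
  \<comment> \<open>Half of the limit L is kept, and the coefficient formula divides by 2 pi; hence
    L/(4 pi).\<close>
  then have "\<forall>\<^sub>F n in sequentially. L / (4 * pi) * c n * exp (real n * b n) * norm (part_gf k (of_real (b n))) \<le> real (p_col k n)"
    using eventually_ge_at_top[of N]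
  proof eventually_elim
    case (elim n)
    have "2 * of_real pi * of_nat (p_col k n) = (\<integral>y. h n y \<partial>lborel)"
      unfolding h_def by (rule p_col_integral(2)[OF bp[OF elim(2)], symmetric])
    also have "\<dots> = \<bar>c n\<bar> *\<^sub>R (\<integral>u. h n (0 + c n * u) \<partial>lborel)"
      using cp[OF elim(2)] by (intro lborel_integral_real_affine) auto
    also have "(\<lambda>u. h n (0 + c n * u)) = (\<lambda>u. d n * s n u)" using dnz by (simp add: s_def)
    also have "(\<integral>u. d n * s n u \<partial>lborel) = d n * (\<integral>u. s n u \<partial>lborel)" by simp
    finally have "norm (2 * of_real pi * of_nat (p_col k n) :: complex) = norm (\<bar>c n\<bar> *\<^sub>R (d n * (\<integral>u. s n u \<partial>lborel)))" by simp
    then have "2 * pi * real (p_col k n) = c n * (norm (d n) * norm (\<integral>u. s n u \<partial>lborel))"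
      using cp[OF elim(2)] by (simp add: norm_mult)
    also have "\<dots> \<ge> c n * (norm (d n) * (L / 2))"
      using elim cp[OF elim(2)] by (intro mult_left_mono) auto
    finally have "c n * (norm (d n) * (L / 2)) \<le> 2 * pi * real (p_col k n)" .
    moreover have "norm (d n) = norm (part_gf k (of_real (b n))) * exp (real n * b n)"
      by (simp add: d_def norm_mult)
    ultimately show ?case by (simp add: field_simps)
  qed
  then show ?thesis using \<open>L > 0\<close> by (intro exI[of _ "L / (4 * pi)"]) (simp add: b_def c_def)
qed

section \<open>The error integral\<close>

lemma integral_Lorentzian_le:
  assumes "c > 0"
  shows "integrable lborel (\<lambda>y. indicator {-pi..pi} y * (1 / (1 + y^2 / c^2)))"
    and "(\<integral>y. indicator {-pi..pi} y * (1 / (1 + y^2 / c^2)) \<partial>lborel) \<le> pi * c"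
proof -
  let ?f = "\<lambda>y. 1 / (1 + y^2 / c^2)" and ?F = "\<lambda>y. c * arctan (1 / c * y)"
  have pos: "1 + y^2 / c^2 > 0" for y :: real by (simp add: add_pos_nonneg)
  have D: "(?F has_real_derivative ?f y) (at y)" for y
  proof -
    have "(?F has_real_derivative c * (inverse (1 + (1 / c * y)^2) * (1 / c))) (at y)"
      by (rule DERIV_cmult[OF DERIV_chain2[OF DERIV_arctan DERIV_cmult_Id]])
    then show ?thesis using assms by (simp add: power_divide inverse_eq_divide)
  qed
  have cont: "continuous_on {-pi..pi} ?f"
    using pos assms by (intro continuous_intros) (auto simp: less_imp_neq[symmetric])
  have D': "(?F has_vector_derivative ?f y) (at y within {-pi..pi})" for y
    using D[of y] by (simp add: has_real_derivative_iff_has_vector_derivative has_vector_derivative_at_within)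
  have "has_bochner_integral lborel (\<lambda>y. indicator {-pi..pi} y *\<^sub>R ?f y) (?F pi - ?F (- pi))"
    by (rule has_bochner_integral_FTC_Icc[OF _ D' cont]) simp
  then have 1: "integrable lborel (\<lambda>y. indicator {-pi..pi} y *\<^sub>R ?f y)"
    "(\<integral>y. indicator {-pi..pi} y *\<^sub>R ?f y \<partial>lborel) = ?F pi - ?F (- pi)"
    by (auto simp: has_bochner_integral_iff)
  from 1(1) show "integrable lborel (\<lambda>y. indicator {-pi..pi} y * (1 / (1 + y^2 / c^2)))" by simp
  have "arctan (1 / c * pi) - arctan (1 / c * (- pi)) \<le> pi / 2 + pi / 2"
    using arctan_ubound[of "1 / c * pi"] arctan_lbound[of "1 / c * (- pi)"] by linarith
  then have "c * (arctan (1 / c * pi) - arctan (1 / c * (- pi))) \<le> c * (pi / 2 + pi / 2)"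
    using assms by (intro mult_left_mono) auto
  with 1(2) show "(\<integral>y. indicator {-pi..pi} y * (1 / (1 + y^2 / c^2)) \<partial>lborel) \<le> pi * c"
    by (simp add: right_diff_distrib mult.commute)
qed

text \<open>Let c = b^(3/2) and U = (y/c)^2. For |y| <= b the error c + |y| is at most 2c(1+U),
  which costs one power of 1 + U. Otherwise the crude bounds give O(b^(-5)), using m <= k/b^3; but
  there 1/b <= 1 + U, so nine powers of decay win back b^9 and leave b^4 <= c. In both cases a
  factor 1/(1+U) survives.\<close>

lemma integrand_bound:
  assumes k: "k \<ge> 1"
  shows "\<exists>K>0. \<forall>b y m. 0 < b \<longrightarrow> b \<le> 1 \<longrightarrow> \<bar>y\<bar> \<le> pi \<longrightarrow> m \<ge> 1 \<longrightarrow> real m \<le> real k / b^3 \<longrightarrow>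
    norm ((C_ser m (exp (- Complex b y)) - of_real (profile (real m) b)) * part_gf k (Complex b y)) \<le>
      norm (part_gf k (of_real b)) * (K * (b * sqrt b)) * (1 / (1 + y^2 / (b * sqrt b)^2))"
proof -
  obtain C where C: "C \<ge> 0" "\<And>t m. Re t > 0 \<Longrightarrow> \<bar>Im t\<bar> \<le> Re t \<Longrightarrow> Re t \<le> 1 \<Longrightarrow> m \<ge> 1 \<Longrightarrow>
     norm (C_ser m (exp (- t)) - of_real (profile (real m) (Re t)))
       \<le> C * (Re t * sqrt (Re t) + \<bar>Im t\<bar>)"
    using C_ser_near_profile by blast
  obtain K where K: "K > 0" "\<And>b y. 0 < b \<Longrightarrow> b \<le> 1 \<Longrightarrow> \<bar>y\<bar> \<le> pi \<Longrightarrow>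
    norm (part_gf k (Complex b y)) \<le> norm (part_gf k (of_real b)) * (K / (1 + y^2 / b^3) ^ 10)"
    using part_gf_decay[OF k] by blast
  define J where "J = K * (2 * C + 32 * real k + 80)"
  have J: "J > 0" unfolding J_def using K(1) C(1) by (intro mult_pos_pos add_nonneg_pos) auto
  have "norm ((C_ser m (exp (- Complex b y)) - of_real (profile (real m) b)) * part_gf k (Complex b y)) \<le>
      norm (part_gf k (of_real b)) * (J * (b * sqrt b)) * (1 / (1 + y^2 / (b * sqrt b)^2))"
    if b: "0 < b" "b \<le> 1" and y: "\<bar>y\<bar> \<le> pi" and m: "m \<ge> 1" "real m \<le> real k / b^3" for b y m
  proof -
    define c where "c = b * sqrt b"
    define U where "U = y^2 / b^3"
    define X where "X = norm (C_ser m (exp (- Complex b y)) - of_real (profile (real m) b))"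
    define G where "G = norm (part_gf k (of_real b))"
    have c: "c > 0" "c^2 = b^3" using b by (simp_all add: c_def power_mult_distrib power2_eq_square power3_eq_cube)
    have U: "U \<ge> 0" using b by (simp add: U_def)
    have bc: "b^4 \<le> c"
    proof -
      have "b * b^3 \<le> b * sqrt b"
      proof (rule mult_left_mono)
        have "b^3 \<le> b" using b power_decreasing[of 1 3 b] by simp
        also have "b \<le> sqrt b" using b by (simp add: real_le_rsqrt power2_eq_square mult_left_le)
        finally show "b^3 \<le> sqrt b" .
      qed (use b in simp)
      then show ?thesis by (simp add: c_def eval_nat_numeral)
    qed
    have H: "norm (part_gf k (Complex b y)) \<le> G * (K / (1 + U) ^ 10)"
      unfolding G_def U_def by (rule K(2)[OF b y])
    have "X * (K / (1 + U) ^ 10) \<le> J * c / (1 + U)"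
    proof (cases "\<bar>y\<bar> \<le> b")
      case True
      have "X \<le> C * (c + \<bar>y\<bar>)"
        using C(2)[of "Complex b y" m] b True m by (simp add: X_def c_def)
      also have "c + \<bar>y\<bar> \<le> 2 * c * (1 + U)"
      proof -
        define u where "u = \<bar>y\<bar> / c"
        have "u^2 = U" using c by (simp add: u_def U_def power_divide)
        have "(u - 1)^2 = u^2 - 2 * u + 1" by (simp add: power2_eq_square algebra_simps)
        then have "0 \<le> u^2 - 2 * u + 1" by (metis zero_le_power2)
        moreover have "0 \<le> u^2" by simp
        ultimately have "1 + u \<le> 2 * (1 + u^2)" unfolding distrib_left by linarith
        then have "c * (1 + u) \<le> c * (2 * (1 + u^2))" using c by (intro mult_left_mono) auto
        moreover have "c * u = \<bar>y\<bar>" using c by (simp add: u_def)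
        ultimately show ?thesis unfolding \<open>u^2 = U\<close> by (simp add: algebra_simps)
      qed
      finally have "X \<le> C * (2 * c * (1 + U))" using C(1) by (simp add: mult_left_mono)
      then have "X * (K / (1 + U) ^ 10) \<le> (C * (2 * c * (1 + U))) * (K / (1 + U) ^ 2)"
        using K(1) U c C(1)
        by (intro mult_mono divide_left_mono power_increasing mult_pos_pos zero_less_power add_pos_nonneg) auto
      also have "\<dots> = K * (2 * C) * c / (1 + U)"
        using U by (simp add: power2_eq_square)
      also have "\<dots> \<le> J * c / (1 + U)"
        unfolding J_def using K(1) c U by (intro divide_right_mono mult_right_mono mult_left_mono) auto
      finally show ?thesis .
    next
      case False
      have A: "norm (A_ser j (exp (- Complex b y))) \<le> 8 * real (m + 2) / b^2" if "j \<le> m + 1" for j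
      proof -
        have "norm (A_ser j (exp (- Complex b y))) \<le> 8 * real (j + 1) / b^2"
          using norm_A_ser_le_crude[of "Complex b y" j] b by simp
        also have "\<dots> \<le> 8 * real (m + 2) / b^2" using that by (intro divide_right_mono mult_left_mono) auto
        finally show ?thesis .
      qed
      have "X \<le> norm (A_ser (m - 1) (exp (- Complex b y))) + norm (2 * A_ser m (exp (- Complex b y)))
          + norm (A_ser (m + 1) (exp (- Complex b y))) + norm (complex_of_real (profile (real m) b))"
        unfolding X_def C_ser_def
        by (rule order_trans[OF norm_triangle_ineq4 add_right_mono[OF order_trans[OF norm_triangle_ineq add_right_mono[OF norm_triangle_ineq4]]]])
      also have "\<dots> \<le> 8 * real (m + 2) / b^2 + 2 * (8 * real (m + 2) / b^2) + 8 * real (m + 2) / b^2 + 16 / b^2"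
      proof (intro add_mono)
        show "norm (2 * A_ser m (exp (- Complex b y))) \<le> 2 * (8 * real (m + 2) / b^2)"
          unfolding norm_mult norm_numeral by (intro mult_left_mono A) auto
        show "norm (complex_of_real (profile (real m) b)) \<le> 16 / b^2"
          using abs_profile_le[of "real m" b] m b by simp
      qed (intro A; simp)+
      also have "\<dots> = (32 * real m + 80) / b^2" by (simp add: add_divide_distrib algebra_simps)
      also have "\<dots> \<le> ((32 * real k + 80) / b^3) / b^2"
      proof (rule divide_right_mono)
        have "1 \<le> 1 / b^3" using b by (simp add: power_le_one)
        then have "80 \<le> 80 / b^3" by simp
        moreover have "32 * real m \<le> 32 * real k / b^3" using m by simp
        ultimately show "32 * real m + 80 \<le> (32 * real k + 80) / b^3" by (simp add: add_divide_distrib)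
      qed simp
      also have "\<dots> = (32 * real k + 80) / b^5" by (simp add: eval_nat_numeral)
      finally have X: "X \<le> (32 * real k + 80) / b^5" .
      have "1 / b \<le> 1 + U"
      proof -
        have "b^2 \<le> y^2" using False b power_mono[of b "\<bar>y\<bar>" 2] by simp
        then have "b^2 / b^3 \<le> U" unfolding U_def using b by (intro divide_right_mono) auto
        then show ?thesis using b by (simp add: power2_eq_square power3_eq_cube)
      qed
      then have "(1 / b)^9 \<le> (1 + U)^9" using b by (intro power_mono) auto
      then have "(1 / b)^9 * (1 + U) \<le> (1 + U)^9 * (1 + U)" using U by (intro mult_right_mono) auto
      then have "(1 / b^9) * (1 + U) \<le> (1 + U)^10" by (simp add: power_divide eval_nat_numeral mult_ac)
      then have "K / (1 + U)^10 \<le> K / ((1 / b^9) * (1 + U))"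
        using K(1) U b by (intro divide_left_mono mult_pos_pos zero_less_power add_pos_nonneg) auto
      then have "X * (K / (1 + U)^10) \<le> ((32 * real k + 80) / b^5) * (K / ((1 / b^9) * (1 + U)))"
        using X K(1) U b by (intro mult_mono) (auto simp: X_def)
      also have "\<dots> = K * (32 * real k + 80) * b^4 / (1 + U)"
      proof -
        have gen: "(M / x) * (K / ((1 / (x * z)) * V)) = K * M * z / V"
          if "x \<noteq> 0" "z \<noteq> 0" "V \<noteq> 0" for M x z V :: real
          using that by (simp add: field_simps)
        have "b^9 = b^5 * b^4" by (simp flip: power_add)
        then show ?thesis using gen[of "b^5" "b^4" "1 + U"] b U by simp
      qed
      also have "\<dots> \<le> J * c / (1 + U)"
        unfolding J_def using K(1) C(1) bc U b by (intro divide_right_mono mult_mono mult_left_mono) auto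
      finally show ?thesis .
    qed
    then have "G * (X * (K / (1 + U) ^ 10)) \<le> G * (J * c / (1 + U))"
      unfolding G_def by (intro mult_left_mono) auto
    moreover have "X * norm (part_gf k (Complex b y)) \<le> X * (G * (K / (1 + U) ^ 10))"
      using H unfolding X_def by (intro mult_left_mono) auto
    ultimately have "X * norm (part_gf k (Complex b y)) \<le> G * (J * c / (1 + U))"
      by (simp add: mult.left_commute)
    then show ?thesis
      unfolding norm_mult X_def[symmetric] G_def[symmetric] c_def[symmetric] c(2) U_def[symmetric] by simp
  qed
  then show ?thesis using J by blast
qed

text \<open>No stationary-phase cancellation is needed: the product concentrates at distance \<open>b\<^bsup>3/2\<^esup>\<close> from the
  real axis, and there \<open>C_ser\<close> is within a constant times \<open>b\<^bsup>3/2\<^esup>\<close> of the profile function.\<close>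

lemma f_coeff_ratio_near_profile:
  assumes k: "k \<ge> 1"
  shows "\<exists>K>0. \<forall>\<^sub>F n in sequentially. \<forall>m. m \<ge> 1 \<longrightarrow> real m \<le> ln (real n) / (6 * beta k n) \<longrightarrow>
    p_col k n > 0 \<and> \<bar>f_coeff k (int m) n / real (p_col k n) - profile (real m) (beta k n)\<bar> \<le>
      K * (beta k n * sqrt (beta k n))"
proof -
  obtain K where K: "K > 0" "\<And>b y m. 0 < b \<Longrightarrow> b \<le> 1 \<Longrightarrow> \<bar>y\<bar> \<le> pi \<Longrightarrow> m \<ge> 1 \<Longrightarrow> real m \<le> real k / b^3 \<Longrightarrow>
    norm ((C_ser m (exp (- Complex b y)) - of_real (profile (real m) b)) * part_gf k (Complex b y)) \<le>
      norm (part_gf k (of_real b)) * (K * (b * sqrt b)) * (1 / (1 + y^2 / (b * sqrt b)^2))"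
    using integrand_bound[OF k] by blast
  obtain c0 where c0: "c0 > 0" "\<forall>\<^sub>F n in sequentially.
     c0 * (beta k n * sqrt (beta k n)) * exp (real n * beta k n) * norm (part_gf k (of_real (beta k n))) \<le> real (p_col k n)"
    using p_col_lower_bound[OF k] by blast
  have ev: "\<forall>\<^sub>F n in sequentially. beta k n < 1" using order_tendstoD(2)[OF beta_tendsto_0, of 1 k] by simp
  have "\<forall>\<^sub>F n in sequentially. \<forall>m. m \<ge> 1 \<longrightarrow> real m \<le> ln (real n) / (6 * beta k n) \<longrightarrow>
    p_col k n > 0 \<and> \<bar>f_coeff k (int m) n / real (p_col k n) - profile (real m) (beta k n)\<bar> \<le>
      K / (2 * c0) * (beta k n * sqrt (beta k n))"
    using c0(2) ev eventually_ge_at_top[of 1]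
  proof eventually_elim
    case (elim n)
    define b where "b = beta k n"
    define c where "c = b * sqrt b"
    define G where "G = norm (part_gf k (of_real b))"
    define P where "P = (\<lambda>m. profile (real m) b)"
    have b: "0 < b" "b \<le> 1" using beta_facts(1)[OF k elim(3)] elim(2) by (simp_all add: b_def)
    have c: "c > 0" using b by (simp add: c_def)
    have G: "G > 0" by (simp add: G_def)
    have p_ge: "c0 * c * exp (real n * b) * G \<le> real (p_col k n)"
      using elim(1) by (simp add: b_def c_def G_def)
    have "0 < c0 * c * exp (real n * b) * G" using c0(1) c G by simp
    with p_ge have p: "real (p_col k n) > 0" by linarith
    have main: "\<bar>f_coeff k (int m) n / real (p_col k n) - P m\<bar> \<le> K / (2 * c0) * c"
      if m: "m \<ge> 1" "real m \<le> ln (real n) / (6 * b)" for m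
    proof -
      \<comment> \<open>From ln n <= n and, by the saddle point condition, n <= 6k/b^2. A polynomial
        bound on m is all that \<open>integrand_bound\<close> asks for.\<close>
      have mb: "real m \<le> real k / b^3"
      proof -
        have "real n * b^2 = real k * pi^2 / 6" using beta_facts(2)[OF k elim(3)] by (simp add: b_def)
        moreover have "pi^2 \<le> 4^2" using pi_less_4 by (intro power_mono) auto
        then have "real k * pi^2 \<le> real k * 4^2" by (intro mult_left_mono) auto
        ultimately have "real n * b^2 \<le> 6 * real k" by simp
        then have "real n \<le> 6 * real k / b^2" using b by (simp add: field_simps)
        moreover have "ln (real n) \<le> real n"
          using ln_le_minus_one[of "real n"] elim(3) by simp
        ultimately have "ln (real n) / (6 * b) \<le> (6 * real k / b^2) / (6 * b)"
          using b by (intro divide_right_mono) auto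
        also have "\<dots> = real k / b^3" using b by (simp add: power2_eq_square power3_eq_cube)
        finally show ?thesis using m(2) by linarith
      qed
      note If = f_coeff_integral[OF b(1) m(1), of k n] and Ip = p_col_integral[OF b(1), of k n]
      \<comment> \<open>The profile does not depend on y, so subtracting it under the integral
        subtracts a multiple of the integral for \<open>p_col k n\<close>.\<close>
      define I where "I = (\<lambda>y. indicator {-pi..pi} y *\<^sub>R ((C_ser m (exp (- Complex b y)) - of_real (P m)) * part_gf k (Complex b y) * exp (of_nat n * Complex b y)))"
      have I_eq: "I y = indicator {-pi..pi} y *\<^sub>R (C_ser m (exp (- Complex b y)) * part_gf k (Complex b y) * exp (of_nat n * Complex b y))
          - of_real (P m) * (indicator {-pi..pi} y *\<^sub>R (part_gf k (Complex b y) * exp (of_nat n * Complex b y)))" for y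
        by (simp add: I_def algebra_simps indicator_def)
      have i2: "integrable lborel (\<lambda>y. of_real (P m) * (indicator {-pi..pi} y *\<^sub>R (part_gf k (Complex b y) * exp (of_nat n * Complex b y))))"
        by (intro integrable_mult_right Ip)
      have "(\<integral>y. I y \<partial>lborel) = 2 * of_real pi * of_real (f_coeff k (int m) n) - of_real (P m) * (2 * of_real pi * of_nat (p_col k n))"
        unfolding I_eq
          Bochner_Integration.integral_diff[OF If(1) i2] integral_mult_right_zero If(2) Ip(2) ..
      also have "\<dots> = of_real (2 * pi * (f_coeff k (int m) n - P m * real (p_col k n)))"
        by (simp add: algebra_simps)
      finally have "norm (\<integral>y. I y \<partial>lborel) = \<bar>2 * pi * (f_coeff k (int m) n - P m * real (p_col k n))\<bar>"
        by (simp only: norm_of_real)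
      then have "2 * pi * \<bar>f_coeff k (int m) n - P m * real (p_col k n)\<bar> = norm (\<integral>y. I y \<partial>lborel)"
        by (simp add: abs_mult)
      also have "\<dots> \<le> (\<integral>y. (exp (real n * b) * G * (K * c)) * (indicator {-pi..pi} y * (1 / (1 + y^2 / c^2))) \<partial>lborel)"
      proof (rule Bochner_Integration.integral_norm_bound_integral)
        show "integrable lborel I"
          unfolding I_eq[abs_def] by (intro Bochner_Integration.integrable_diff integrable_mult_right If Ip)
        show "integrable lborel (\<lambda>y. (exp (real n * b) * G * (K * c)) * (indicator {-pi..pi} y * (1 / (1 + y^2 / c^2))))"
          by (intro integrable_mult_right integral_Lorentzian_le c)
        fix y :: real
        show "norm (I y) \<le> (exp (real n * b) * G * (K * c)) * (indicator {-pi..pi} y * (1 / (1 + y^2 / c^2)))"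
        proof (cases "y \<in> {-pi..pi}")
          case True
          then have y: "\<bar>y\<bar> \<le> pi" by auto
          have "norm (I y) = norm ((C_ser m (exp (- Complex b y)) - of_real (P m)) * part_gf k (Complex b y)) * exp (real n * b)"
            using True by (simp add: I_def norm_mult)
          also have "\<dots> \<le> (G * (K * c) * (1 / (1 + y^2 / c^2))) * exp (real n * b)"
            unfolding G_def c_def P_def by (intro mult_right_mono K(2) b y m(1) mb) simp
          finally show ?thesis using True by (simp add: mult_ac)
        qed (simp add: I_def)
      qed
      also have "\<dots> \<le> (exp (real n * b) * G * (K * c)) * (pi * c)"
        unfolding integral_mult_right_zero
        by (rule mult_left_mono[OF integral_Lorentzian_le(2)[OF c]]) (use G K(1) c in simp)
      \<comment> \<open>One factor c is the size of the error and one the width of the peak; the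
        lower bound for \<open>p_col k n\<close> contains the latter as well, so a single c survives
        in the quotient.\<close>
      finally have "\<bar>f_coeff k (int m) n - P m * real (p_col k n)\<bar> \<le> (K / 2 * c) * (c * exp (real n * b) * G)"
        by (simp add: field_simps)
      also have "\<dots> \<le> (K / 2 * c) * (real (p_col k n) / c0)"
        using p_ge c0(1) K(1) c by (intro mult_left_mono) (auto simp: field_simps)
      finally have "\<bar>f_coeff k (int m) n - P m * real (p_col k n)\<bar> / real (p_col k n) \<le> K / (2 * c0) * c"
        using p by (simp add: divide_le_eq mult_ac)
      moreover have "f_coeff k (int m) n / real (p_col k n) - P m = (f_coeff k (int m) n - P m * real (p_col k n)) / real (p_col k n)"
        using p by (simp add: field_simps)
      ultimately show ?thesis using p by (simp add: abs_divide)
    qed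
    show ?case using main p unfolding P_def b_def c_def by simp
  qed
  then show ?thesis using K(1) c0(1) by (intro exI[of _ "K / (2 * c0)"]) simp
qed

text \<open>The range of m says \<beta>m <= (ln n)/6, hence e^(\<beta>m) <= n^(1/6). If \<beta>m >
  1, then n <= n \<beta>^2 m^2 <= 3k m^2, which turns this into a multiple of m^(1/3); otherwise
  e^(\<beta>m) <= 3.\<close>

lemma exp_beta_le:
  assumes k: "k \<ge> 1" and n: "n \<ge> 1" and m: "m \<ge> 1" and le: "m \<le> ln (real n) / (6 * beta k n)"
  shows "exp (beta k n * m) \<le> (3 + 3 * real k) * m powr (1 / 3)"
proof (cases "beta k n * m \<le> 1")
  case True
  have "exp (beta k n * m) \<le> exp 1" using True by simp
  also have "\<dots> \<le> 3 * 1" using exp_le by simp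
  also have "\<dots> \<le> (3 + 3 * real k) * m powr (1 / 3)"
    using m by (intro mult_mono ge_one_powr_ge_zero) auto
  finally show ?thesis .
next
  case False
  define b where "b = beta k n"
  have b: "b > 0" using beta_facts(1)[OF k n] by (simp add: b_def)
  have "b * m \<le> ln (real n) / 6" using le b by (simp add: b_def field_simps)
  then have "exp (b * m) \<le> exp (ln (real n) / 6)" by simp
  also have "\<dots> = real n powr (1 / 6)" using n by (simp add: powr_def)
  also have "\<dots> \<le> (3 * real k * m^2) powr (1 / 6)"
  proof (rule powr_mono2)
    have "pi^2 \<le> 4^2" using pi_less_4 by (intro power_mono) auto
    then have "real k * pi^2 \<le> real k * 4^2" by (intro mult_left_mono) auto
    then have "real n * b^2 \<le> 3 * real k" using beta_facts(2)[OF k n] by (simp add: b_def)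
    moreover have "1^2 \<le> (b * m)^2" using False by (intro power_mono) (auto simp: b_def)
    then have "real n * 1 \<le> real n * (b * m)^2" by (intro mult_left_mono) auto
    then have "real n \<le> (real n * b^2) * m^2" by (simp add: power_mult_distrib)
    ultimately show "real n \<le> 3 * real k * m^2"
      by (meson mult_right_mono order_trans zero_le_power2)
  qed auto
  also have "\<dots> = (3 * real k) powr (1 / 6) * m powr (1 / 3)"
  proof -
    have "(m^2) powr (1 / 6) = m powr (1 / 3)"
      using m by (simp add: powr_powr flip: powr_numeral)
    then show ?thesis by (simp add: powr_mult)
  qed
  also have "(3 * real k) powr (1 / 6) \<le> (3 * real k) powr 1"
    using k by (intro powr_mono) auto
  then have "(3 * real k) powr (1 / 6) * m powr (1 / 3) \<le> (3 + 3 * real k) * m powr (1 / 3)"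
    by (intro mult_right_mono) auto
  finally show ?thesis by (simp add: b_def)
qed

section \<open>From the absolute to the relative error\<close>

lemma profile_minus: "m \<noteq> 0 \<Longrightarrow> b \<noteq> 0 \<Longrightarrow> profile (- m) b = profile m b"
  by (simp add: profile_eq coth_def)

theorem theorem1p2:
  fixes k :: nat
  assumes "k \<ge> 1"
  shows "\<exists>C::real. \<exists>N::nat. \<forall>n\<ge>N. \<forall>m::int.
           1 \<le> \<bar>m\<bar> \<and> real_of_int \<bar>m\<bar> \<le> sqrt (real n / (6 * real k)) * (ln (real n) / pi) \<longrightarrow>
           (\<exists>E::real.
              \<bar>E\<bar> \<le> C * (beta k n powr (1 / 2) * real_of_int \<bar>m\<bar> powr (1 / 3)) \<and>
              a_coeff k m n / real (p_col k n) = profile (real_of_int m) (beta k n) * (1 + E))"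
proof -
  obtain K where K: "K > 0" "\<forall>\<^sub>F n in sequentially. \<forall>m. m \<ge> 1 \<longrightarrow> real m \<le> ln (real n) / (6 * beta k n) \<longrightarrow>
    p_col k n > 0 \<and> \<bar>f_coeff k (int m) n / real (p_col k n) - profile (real m) (beta k n)\<bar> \<le>
      K * (beta k n * sqrt (beta k n))"
    using f_coeff_ratio_near_profile[OF assms] by blast
  then obtain N where N: "\<And>n m. n \<ge> N \<Longrightarrow> m \<ge> 1 \<Longrightarrow> real m \<le> ln (real n) / (6 * beta k n) \<Longrightarrow>
    \<bar>f_coeff k (int m) n / real (p_col k n) - profile (real m) (beta k n)\<bar> \<le> K * (beta k n * sqrt (beta k n))"
    unfolding eventually_sequentially by blast
  \<comment> \<open>30 is from \<open>profile_ge\<close>, \<open>K\<close> from the absolute error,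
    and \<open>3 + 3 * real k\<close> from \<open>exp_beta_le\<close>.\<close>
  define C where "C = 30 * K * (3 + 3 * real k)"
  have "\<exists>E. \<bar>E\<bar> \<le> C * (beta k n powr (1 / 2) * real_of_int \<bar>m\<bar> powr (1 / 3)) \<and>
      a_coeff k m n / real (p_col k n) = profile (real_of_int m) (beta k n) * (1 + E)"
    if n: "n \<ge> max N 1" and m: "1 \<le> \<bar>m\<bar>" "real_of_int \<bar>m\<bar> \<le> sqrt (real n / (6 * real k)) * (ln (real n) / pi)" for n m
  proof -
    define \<mu> where "\<mu> = nat \<bar>m\<bar>"
    define b where "b = beta k n"
    define R where "R = f_coeff k (int \<mu>) n / real (p_col k n)"
    define P where "P = profile (real \<mu>) b"
    have n1: "n \<ge> 1" "n \<ge> N" using n by auto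
    note bf = beta_facts[OF assms n1(1)]
    have b: "b > 0" using bf(1) by (simp add: b_def)
    have \<mu>: "\<mu> \<ge> 1" "real \<mu> = real_of_int \<bar>m\<bar>" using m(1) by (auto simp: \<mu>_def)
    have le: "real \<mu> \<le> ln (real n) / (6 * beta k n)" using m(2) unfolding bf(3) \<mu>(2) .
    have R: "\<bar>R - P\<bar> \<le> K * (b * sqrt b)" using N[OF n1(2) \<mu>(1) le] by (simp add: R_def P_def b_def)
    have P: "P \<ge> b * exp (- (b * real \<mu>)) / 30" unfolding P_def using profile_ge[of "real \<mu>" b] \<mu>(1) b by simp
    have pos: "b * exp (- (b * real \<mu>)) / 30 > 0" using b by simp
    with P have P0: "P > 0" by linarith
    \<comment> \<open>Dividing b sqrt(b) by the lower bound b e^(-bm)/30 leaves sqrt(b), the factor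
      \<beta>^(1/2) of the claim, and e^(bm), which becomes the factor |m|^(1/3).\<close>
    have "\<bar>R - P\<bar> / P \<le> K * (b * sqrt b) / (b * exp (- (b * real \<mu>)) / 30)"
      using R P pos K(1) b by (intro frac_le) auto
    also have "\<dots> = 30 * K * (sqrt b * exp (b * real \<mu>))" using b by (simp add: exp_minus field_simps)
    also have "\<dots> \<le> 30 * K * (sqrt b * ((3 + 3 * real k) * real \<mu> powr (1 / 3)))"
      using exp_beta_le[OF assms n1(1) _ le] \<mu>(1) K(1) b by (intro mult_left_mono) (auto simp: b_def)
    also have "\<dots> = C * (b powr (1 / 2) * real \<mu> powr (1 / 3))"
      using b by (simp add: C_def powr_half_sqrt)
    finally have E: "\<bar>R - P\<bar> / P \<le> C * (b powr (1 / 2) * real \<mu> powr (1 / 3))" .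
    \<comment> \<open>The coefficients and the profile are even in m, so the positive index \<mu> =
      |m| settles both signs.\<close>
    have a: "a_coeff k m n = f_coeff k (int \<mu>) n"
      unfolding a_coeff_eq \<mu>_def by (cases "m \<ge> 0") (simp_all add: f_coeff_minus)
    have p: "profile (real_of_int m) b = P"
    proof (cases "m \<ge> 0")
      case False
      then have "real_of_int m = - real \<mu>" using \<mu>(2) by simp
      then show ?thesis using \<mu>(1) b profile_minus[of "real \<mu>" b] by (simp add: P_def)
    qed (use \<mu>(2) in \<open>simp add: P_def\<close>)
    show ?thesis
    proof (intro exI conjI)
      show "\<bar>(R - P) / P\<bar> \<le> C * (beta k n powr (1 / 2) * real_of_int \<bar>m\<bar> powr (1 / 3))"
        using E P0 \<mu>(2) by (simp add: abs_divide b_def)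
      show "a_coeff k m n / real (p_col k n) = profile (real_of_int m) (beta k n) * (1 + (R - P) / P)"
        using P0 unfolding a b_def[symmetric] p R_def[symmetric] by (simp add: field_simps)
    qed
  qed
  then show ?thesis by (intro exI[of _ C] exI[of _ "max N 1"]) blast
qed

end
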